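(* Let $\Omega\subset\mathbb{R}^n$ be open and bounded, let $d:=\dim_b(\partial\Omega)$, and assume $n-1\le d<n$. Let $\alpha_1,\dots,\alpha_n\in(0,1]$ and let $v=(v^1,\dots,v^n):\Omega\to\mathbb{R}^n$ be a continuous map with $v^i\in C^{0,\alpha_i}(\Omega)$ for each $i$. (1) If $\sum_{i=1}^n\alpha_i>d$, then $\deg(v,\Omega,\cdot)\in L^1(\mathbb{R}^n)$ and $$\|\deg(v,\Omega,\cdot)\|_{L^1}\le C\prod_{i=1}^n[v^i]_{C^{0,\alpha_i}},$$ where the constant $C=C(\Omega,n,\alpha_1,\dots,\alpha_n)$ does not depend on $v$. (2) If in addition $\alpha:=\min_i\alpha_i>\frac{d}{n}$, then for every $\gamma\in(0,1)$ with $(n-1+\gamma)\alpha>d$, every $R>0$ with $\overline{v(\Omega)}\subset B_R(0)$, and every $\psi\in C^1(\mathbb{R}^n,\mathbb{R}^n)$, $$\left|\int_{\mathbb{R}^n}\deg(v,\Omega,y)\,\operatorname{div}\psi(y)\,dy\right|\le C\,[v]_{C^{0,\alpha}(\Omega)}^{\,n-1+\gamma}\,[\psi]_{C^{0,\gamma}(B_R)},$$ where the constant $C=C(\Omega,n,\alpha,\gamma)$ does not depend on $v$, $\psi$ or $R$.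
   Context: $n$ is a positive integer. $\dim_b$ is the box counting (Minkowski) dimension: $\dim_b(K)=\limsup_{\varepsilon\to0}\frac{\log N_\varepsilon(K)}{\log(1/\varepsilon)}$, where $N_\varepsilon(K)$ is the minimal number of balls of radius $\varepsilon$ covering the bounded set $K$ (it is the limit whenever the limit exists). For a (scalar or vector valued) function $f$ on a set $U$, $[f]_{C^{0,\alpha}(U)}=\sup_{x\ne y\in U}\frac{|f(x)-f(y)|}{|x-y|^\alpha}$ is the Hölder seminorm; $[v^i]_{C^{0,\alpha_i}}$ is taken on $\Omega$. $B_R=B_R(0)$ is the open ball of radius $R$ centred at $0$. The map $v$ extends uniquely to a continuous map on $\overline\Omega$, still denoted $v$, and $\deg(v,\Omega,y)$ is the Brouwer degree, defined for $y\in\mathbb{R}^n\setminus v(\partial\Omega)$ (it vanishes for $y\notin v(\overline\Omega)$). Under the hypotheses here $v(\partial\Omega)$ is Lebesgue-null, so $\deg(v,\Omega,\cdot)$ is regarded as an a.e. defined function on $\mathbb{R}^n$. *)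

theory Defs
  imports "HOL-Analysis.Analysis"
begin

section \<open>Box counting dimension\<close>

definition covering_number :: "real \<Rightarrow> 'a::metric_space set \<Rightarrow> nat" where
  "covering_number \<epsilon> K = Inf {card A |A. finite A \<and> K \<subseteq> (\<Union>a\<in>A. ball a \<epsilon>)}"

text \<open>Only meant for totally bounded \<open>K\<close>. As \<open>ln 0 = 0\<close>, the empty set gets dimension 0.\<close>

definition box_dim :: "'a::metric_space set \<Rightarrow> ereal" where
  "box_dim K =
     Limsup (at_right (0::real)) (\<lambda>\<epsilon>. ereal (ln (real (covering_number \<epsilon> K)) / ln (1 / \<epsilon>)))"


section \<open>Hoelder continuity\<close>

definition holder_quotients ::
    "real \<Rightarrow> 'a::metric_space set \<Rightarrow> ('a \<Rightarrow> 'b::metric_space) \<Rightarrow> real set" where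
  "holder_quotients \<alpha> U f =
     {dist (f x) (f y) / dist x y powr \<alpha> |x y. x \<in> U \<and> y \<in> U \<and> x \<noteq> y}"

definition holder_on :: "real \<Rightarrow> 'a::metric_space set \<Rightarrow> ('a \<Rightarrow> 'b::metric_space) \<Rightarrow> bool" where
  "holder_on \<alpha> U f \<longleftrightarrow> bdd_above (holder_quotients \<alpha> U f)"

text \<open>The quotients are nonnegative, so inserting 0 only affects sets \<open>U\<close> with at most one
  point, where it makes the seminorm 0 instead of the unspecified \<open>Sup {}\<close>. The value is
  meaningful only if \<open>holder_on \<alpha> U f\<close> holds.\<close>

definition holder_seminorm ::
    "real \<Rightarrow> 'a::metric_space set \<Rightarrow> ('a \<Rightarrow> 'b::metric_space) \<Rightarrow> real" where
  "holder_seminorm \<alpha> U f = Sup (insert 0 (holder_quotients \<alpha> U f))"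


section \<open>Differentiable maps\<close>

definition C1_map :: "('a::real_normed_vector \<Rightarrow> 'b::real_normed_vector) \<Rightarrow> bool" where
  "C1_map f \<longleftrightarrow> (\<exists>f' :: 'a \<Rightarrow> 'a \<Rightarrow>\<^sub>L 'b.
     (\<forall>x. (f has_derivative blinfun_apply (f' x)) (at x)) \<and> continuous_on UNIV f')"

definition C2_map :: "('a::real_normed_vector \<Rightarrow> 'b::real_normed_vector) \<Rightarrow> bool" where
  "C2_map f \<longleftrightarrow> (\<exists>f' :: 'a \<Rightarrow> 'a \<Rightarrow>\<^sub>L 'b.
     (\<forall>x. (f has_derivative blinfun_apply (f' x)) (at x)) \<and> C1_map f')"

definition divergence :: "(real^'n \<Rightarrow> real^'n) \<Rightarrow> real^'n \<Rightarrow> real" where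
  "divergence \<psi> y = (\<Sum>i\<in>UNIV. frechet_derivative \<psi> (at y) (axis i 1) $ i)"

definition jacobian_det :: "(real^'n \<Rightarrow> real^'n) \<Rightarrow> real^'n \<Rightarrow> real" where
  "jacobian_det g x = det (matrix (frechet_derivative g (at x)))"


section \<open>Brouwer degree\<close>

text \<open>The continuous extension of \<open>v\<close> from an open set \<open>\<Omega>\<close> to its closure, if there is one.\<close>

definition closure_extension ::
    "'a::t2_space set \<Rightarrow> ('a \<Rightarrow> 'b::t2_space) \<Rightarrow> 'a \<Rightarrow> 'b" where
  "closure_extension \<Omega> v x = (if x \<in> \<Omega> then v x else Lim (at x within \<Omega>) v)"

text \<open>The classical analytic definition of the degree of a map \<open>f\<close>, continuous on the closure of
  the bounded open set \<open>\<Omega>\<close>, at a point \<open>y\<close> off \<open>f (\<partial>\<Omega>)\<close>: replace \<open>f\<close> by a \<open>C\<^sup>2\<close> map \<open>g\<close> having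
  \<open>y\<close> as a regular value in \<open>\<Omega>\<close>, and count the solutions of \<open>g x = y\<close> with the sign of the
  Jacobian. The result is the same for all \<open>g\<close> with
  \<open>sup {|g x - f x| : x \<in> closure \<Omega>} < dist (y, f (\<partial>\<Omega>))\<close>; by compactness this inequality is the
  pointwise one in the next definition.\<close>

definition degree_approximant ::
    "(real^'n \<Rightarrow> real^'n) \<Rightarrow> (real^'n) set \<Rightarrow> real^'n \<Rightarrow> (real^'n \<Rightarrow> real^'n) \<Rightarrow> bool" where
  "degree_approximant f \<Omega> y g \<longleftrightarrow>
     C2_map g \<and>
     (\<forall>x\<in>closure \<Omega>. \<forall>z\<in>frontier \<Omega>. dist (g x) (f x) < dist y (f z)) \<and>
     (\<forall>x\<in>\<Omega>. g x = y \<longrightarrow> jacobian_det g x \<noteq> 0)"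

text \<open>The value 0 on \<open>f (\<partial>\<Omega>)\<close>, where the degree is undefined, is a convention.\<close>

definition brouwer_degree ::
    "(real^'n \<Rightarrow> real^'n) \<Rightarrow> (real^'n) set \<Rightarrow> real^'n \<Rightarrow> int" where
  "brouwer_degree f \<Omega> y =
     (if y \<in> f ` frontier \<Omega> then 0
      else THE k. \<forall>g. degree_approximant f \<Omega> y g \<longrightarrow>
             of_int k = (\<Sum>x\<in>{x\<in>\<Omega>. g x = y}. sgn (jacobian_det g x)))"

end

theory Submission
  imports Defs
begin

text \<open>Let \<open>f\<close> be continuous on the closure of \<open>\<Omega>\<close> and let \<open>u\<close> be \<open>C\<^sup>1\<close> in \<open>\<Omega>\<close>, continuous up to
  the boundary, with \<open>u = f\<close> there. Since the integral of \<open>\<phi> (u x)\<close> times the Jacobian determinant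
  \<open>J u\<close> is invariant under homotopies which keep the boundary values away from the support of
  \<open>\<phi>\<close>, it equals the integral of \<open>\<phi>\<close> times the degree. Hence \<open>u\<close> computes the degree, whose
  \<open>L\<^sup>1\<close> norm is at most the integral of \<open>|J u|\<close> over \<open>\<Omega>\<close>. Averaging \<open>f\<close> over balls of radius comparable
  to the distance \<open>\<delta>\<close> from the boundary gives such a \<open>u\<close> with \<open>|D u\<^sup>i| \<le> c H\<^sub>i \<delta>\<close> to the power
  \<open>\<alpha>\<^sub>i - 1\<close>, where \<open>H\<^sub>i\<close> is the Hoelder constant of the \<open>i\<close>-th component, and a negative power
  \<open>\<delta> powr -s\<close> is integrable over \<open>\<Omega>\<close> as soon as the box dimension of the boundary is less than
  \<open>n - s\<close>. With \<open>s = n - (\<Sum>i. \<alpha>\<^sub>i)\<close> this is the first claim.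

  For the second claim let \<open>\<Psi>\<^sub>i\<close> be the identity with its \<open>i\<close>-th component replaced by that of \<open>\<psi>\<close>.
  The Jacobian determinant of \<open>\<Psi>\<^sub>i\<close> is the \<open>i\<close>-th summand of the divergence of \<open>\<psi>\<close>, and its
  integral against the degree of \<open>v\<close> is the integral of the degree of the composition of \<open>\<Psi>\<^sub>i\<close> and \<open>v\<close>, which is
  Hoelder continuous with exponent \<open>\<gamma> \<alpha>\<close> in the \<open>i\<close>-th component and \<open>\<alpha>\<close> in all others. So
  the first claim applies to it.\<close>

text \<open>\<open>brouwer_degree\<close> is a definite description over all approximants, so its
  well-definedness is part of the proof. It comes from the extension \<open>u\<close> too: every
  approximant \<open>g\<close> is compared with the same \<open>u\<close>, and the integral of the
  Jacobian of \<open>u\<close> over the preimage of a small box determines the signed count of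
  \<open>g\<close>. The maps are only C^1. The usual proof that the integral of a Jacobian does not
  change under perturbations inside \<Omega> uses divergence-free cofactors and hence second
  derivatives; a polynomial identity in an auxiliary parameter replaces it. Test functions that are
  themselves Jacobians reduce weighted integrals to this case by the chain rule. The derivative of
  \<open>u\<close> may blow up at the boundary. Integrability of its Jacobian is all that is carried
  along; it identifies the degree as the density of the push-forward of that Jacobian off the image
  of the boundary. The test functions of the second claim do not vanish near this image, which must
  therefore be a null set; small balls covering the boundary show this, since the exponents add up
  to more than \<open>d\<close>.\<close>

section \<open>Change of variables and Sard's theorem for arbitrary index types\<close>

text \<open>The library has both theorems only for vectors with a well-ordered index type. They are
  transferred along a bijection of \<open>'n\<close> with the following type, which is well-ordered and has as
  many elements.\<close>

typedef ('n::finite) idx = "{..<CARD('n)}"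
  by (rule exI[of _ 0]) simp

setup_lifting type_definition_idx

instantiation idx :: (finite) linorder
begin
lift_definition less_eq_idx :: "'a idx \<Rightarrow> 'a idx \<Rightarrow> bool" is "(\<le>)" .
lift_definition less_idx :: "'a idx \<Rightarrow> 'a idx \<Rightarrow> bool" is "(<)" .
instance by standard (transfer; auto)+
end

instance idx :: (finite) wellorder
proof
  fix P :: "'a idx \<Rightarrow> bool" and a
  assume step: "\<And>x. (\<And>y. y < x \<Longrightarrow> P y) \<Longrightarrow> P x"
  show "P a"
    by (induction a rule: measure_induct_rule[of Rep_idx]) (metis step less_idx.rep_eq)
qed

lemma card_idx: "CARD('n::finite idx) = CARD('n)"
  using type_definition.card[OF type_definition_idx] by simp

instance idx :: (finite) finite
proof
  show "finite (UNIV :: 'a idx set)"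
    using card_idx[where 'n='a] by (metis card.infinite zero_less_card_finite less_irrefl)
qed

lemma ex_idx_bij: "\<exists>b :: 'n::finite idx \<Rightarrow> 'n. bij b"
  by (metis card_idx finite finite_same_card_bij)

definition reindex :: "('m::finite \<Rightarrow> 'n::finite) \<Rightarrow> real^'n \<Rightarrow> real^'m" where
  "reindex b x = (\<chi> j. x $ b j)"

lemma linear_reindex: "linear (reindex b)"
  by (auto simp: linear_iff reindex_def vec_eq_iff)

lemma bounded_linear_reindex: "bounded_linear (reindex b)"
  using linear_reindex linear_conv_bounded_linear by blast

lemma reindex_inv [simp]:
  assumes "bij b" shows "reindex (inv b) (reindex b x) = x" "reindex b (reindex (inv b) y) = y"
  using assms by (auto simp: reindex_def vec_eq_iff bij_is_inj bij_is_surj surj_f_inv_f)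

lemma borel_measurable_reindex [measurable]: "reindex b \<in> borel_measurable borel"
  by (intro borel_measurable_continuous_onI linear_continuous_on bounded_linear_reindex)

text \<open>Conjugation by \<open>b\<close> is a sign-preserving bijection between the permutations
  of the two index types, so the Leibniz expansions agree term by term.\<close>

lemma det_reindex:
  fixes A :: "real^'n^'n" and b :: "'m::finite \<Rightarrow> 'n::finite"
  assumes b: "bij b"
  shows "det (\<chi> i j. A $ b i $ b j) = det A"
proof -
  let ?F = "\<lambda>p. inv b \<circ> p \<circ> b"
  have bi: "bij (inv b)" using b by (rule bij_imp_bij_inv)
  have sgn: "sign (?F p) = sign p" if p: "p permutes (UNIV :: 'n set)" for p
  proof -
    have "sign (map_permutation UNIV (inv b) p) = sign p"
      using p bi by (intro sign_map_permutation) (auto simp: bij_is_inj)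
    moreover have "map_permutation UNIV (inv b) p = ?F p"
      using b bi by (simp add: map_permutation_def fun_eq_iff restrict_id_def bij_is_surj inv_inv_eq)
    ultimately show ?thesis by simp
  qed
  have bij: "bij_betw ?F {p. p permutes (UNIV::'n set)} {p. p permutes (UNIV::'m set)}"
  proof (rule bij_betwI[where g = "\<lambda>q. b \<circ> q \<circ> inv b"])
    show "?F \<in> {p. p permutes UNIV} \<rightarrow> {p. p permutes UNIV}"
      using b bi by (auto simp: permutes_bij intro!: bij_imp_permutes bij_comp dest: permutes_bij)
    show "(\<lambda>q. b \<circ> q \<circ> inv b) \<in> {p. p permutes UNIV} \<rightarrow> {p. p permutes UNIV}"
      using b bi by (auto simp: permutes_bij intro!: bij_imp_permutes bij_comp dest: permutes_bij)
  qed (use b in \<open>auto simp: fun_eq_iff bij_is_inj bij_is_surj surj_f_inv_f\<close>)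
  have "det (\<chi> i j. A $ b i $ b j)
      = (\<Sum>q | q permutes UNIV. of_int (sign q) * (\<Prod>i\<in>UNIV. A $ b i $ b (q i)))"
    by (simp add: det_def)
  also have "\<dots> = (\<Sum>p | p permutes UNIV. of_int (sign (?F p)) * (\<Prod>i\<in>UNIV. A $ b i $ b (?F p i)))"
    by (rule sum.reindex_bij_betw[OF bij, symmetric])
  also have "\<dots> = (\<Sum>p | p permutes UNIV. of_int (sign p) * (\<Prod>i\<in>UNIV. A $ i $ p i))"
  proof (intro sum.cong refl)
    fix p assume "p \<in> {p. p permutes (UNIV::'n set)}"
    moreover have "(\<Prod>i\<in>UNIV. A $ b i $ b (?F p i)) = (\<Prod>i\<in>UNIV. A $ i $ p i)"
      using b by (subst prod.reindex_bij_betw[of b UNIV UNIV "\<lambda>i. A $ i $ p i", symmetric])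
        (auto simp: bij_is_surj surj_f_inv_f)
    ultimately show "of_int (sign (?F p)) * (\<Prod>i\<in>UNIV. A $ b i $ b (?F p i))
        = of_int (sign p) * (\<Prod>i\<in>UNIV. A $ i $ p i)"
      by (simp only: sgn mem_Collect_eq)
  qed
  finally show ?thesis by (simp add: det_def)
qed

lemma matrix_reindex:
  fixes h :: "real^'n \<Rightarrow> real^'n" and b :: "'m::finite \<Rightarrow> 'n::finite"
  assumes b: "bij b"
  shows "matrix (reindex b \<circ> h \<circ> reindex (inv b)) = (\<chi> i j. matrix h $ b i $ b j)"
proof -
  have "reindex (inv b) (axis j 1) = axis (b j) 1" for j
    using b by (auto simp: reindex_def axis_def vec_eq_iff bij_is_inj bij_is_surj surj_f_inv_f inv_f_f)
  then show ?thesis by (simp add: matrix_def vec_eq_iff reindex_def)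
qed

lemma reindex_vimage_box:
  fixes b :: "'m::finite \<Rightarrow> 'n::finite"
  assumes b: "bij b"
  shows "reindex b -` box l u = box (reindex (inv b) l) (reindex (inv b) u)"
proof -
  have "(\<forall>j. P (b j) j) \<longleftrightarrow> (\<forall>i. P i (inv b i))" for P
    using b by (metis bij_inv_eq_iff)
  from this[of "\<lambda>i j. l $ j < _ $ i \<and> _ $ i < u $ j"] show ?thesis
    by (simp add: set_eq_iff mem_box_cart reindex_def)
qed

lemma emeasure_lborel_box_cart:
  fixes l u :: "real^'n"
  assumes "\<And>i. l $ i \<le> u $ i"
  shows "emeasure lborel (box l u) = (\<Prod>i\<in>UNIV. ennreal (u $ i - l $ i))"
proof -
  have "emeasure lborel (box l u) = (\<Prod>b\<in>Basis. (u - l) \<bullet> b)"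
    by (intro emeasure_lborel_box) (use assms in \<open>auto simp: Basis_vec_def cart_eq_inner_axis[symmetric]\<close>)
  also have "(\<Prod>b\<in>(Basis::(real^'n) set). (u - l) \<bullet> b) = (\<Prod>i\<in>UNIV. u $ i - l $ i)"
  proof -
    have B: "(Basis::(real^'n) set) = range (\<lambda>i. axis i 1)" by (auto simp: Basis_vec_def)
    have inj: "inj (\<lambda>i. axis i 1 :: real^'n)" by (auto simp: inj_on_def axis_eq_axis)
    have "(\<Prod>b\<in>(Basis::(real^'n) set). (u - l) \<bullet> b) = (\<Prod>i\<in>UNIV. (u - l) \<bullet> axis i 1)"
      unfolding B by (subst prod.reindex[OF inj]) (simp add: o_def)
    then show ?thesis by (simp only: cart_eq_inner_axis inner_diff_left)
  qed
  finally show ?thesis using assms by (simp add: prod_ennreal)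
qed

text \<open>Lebesgue measure is characterised by its values on boxes, and renaming the coordinates
  only permutes the side lengths.\<close>

lemma lborel_distr_reindex:
  fixes b :: "'m::finite \<Rightarrow> 'n::finite"
  assumes b: "bij b"
  shows "distr lborel borel (reindex b) = lborel"
proof (rule sym, rule lborel_eqI)
  fix l u :: "real^'m"
  assume "\<And>b. b \<in> Basis \<Longrightarrow> l \<bullet> b \<le> u \<bullet> b"
  then have le: "l $ i \<le> u $ i" for i by (metis axis_in_Basis_iff cart_eq_inner_axis UNIV_I Basis_real_def singletonI)
  have le2: "reindex (inv b) l $ i \<le> reindex (inv b) u $ i" for i using le by (simp add: reindex_def)
  have "emeasure (distr lborel borel (reindex b)) (box l u) = emeasure lborel (box (reindex (inv b) l) (reindex (inv b) u))"
    by (subst emeasure_distr) (auto simp: reindex_vimage_box[OF b])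
  also have "\<dots> = (\<Prod>i\<in>UNIV. ennreal (u $ i - l $ i))"
    unfolding emeasure_lborel_box_cart[OF le2]
    using prod.reindex_bij_betw[of "inv b" UNIV UNIV "\<lambda>i. ennreal (u $ i - l $ i)"] b
    by (simp add: reindex_def bij_imp_bij_inv)
  also have "\<dots> = emeasure lborel (box l u)" using emeasure_lborel_box_cart[OF le] by simp
  finally show "emeasure (distr lborel borel (reindex b)) (box l u) = (\<Prod>b\<in>Basis. (u - l) \<bullet> b)"
    using emeasure_lborel_box[of l u] \<open>\<And>b. b \<in> Basis \<Longrightarrow> l \<bullet> b \<le> u \<bullet> b\<close> by simp
qed simp

lemma integrable_reindex:
  fixes F :: "real^'m::finite \<Rightarrow> real" and b :: "'m \<Rightarrow> 'n::finite"
  assumes b: "bij b" and [measurable]: "F \<in> borel_measurable borel"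
  shows "integrable lborel (\<lambda>x. F (reindex b x)) \<longleftrightarrow> integrable lborel F"
    and "(LINT x|lborel. F (reindex b x)) = (LINT y|lborel. F y)"
proof -
  have "integrable (distr lborel borel (reindex b)) F \<longleftrightarrow> integrable lborel (\<lambda>x. F (reindex b x))"
    by (rule integrable_distr_eq) auto
  then show "integrable lborel (\<lambda>x. F (reindex b x)) \<longleftrightarrow> integrable lborel F"
    by (simp only: lborel_distr_reindex[OF b])
  have "integral\<^sup>L (distr lborel borel (reindex b)) F = (LINT x|lborel. F (reindex b x))"
    by (rule integral_distr) auto
  then show "(LINT x|lborel. F (reindex b x)) = (LINT y|lborel. F y)"
    by (simp only: lborel_distr_reindex[OF b])
qed

text \<open>The equivalence of integrability stands next to the equality of the values because the
  integral of a nonintegrable function is 0 by default, so that equal values alone would say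
  little.\<close>

lemma change_of_variables_wellorder:
  fixes g :: "real^'m::{finite,wellorder} \<Rightarrow> real^'m::_" and \<phi> :: "real^'m::_ \<Rightarrow> real"
  assumes U: "open U" and g: "\<And>x. x \<in> U \<Longrightarrow> (g has_derivative g' x) (at x)" and inj: "inj_on g U"
    and [measurable]: "\<phi> \<in> borel_measurable borel" "(\<lambda>x. indicator U x * (\<bar>det (matrix (g' x))\<bar> * \<phi> (g x))) \<in> borel_measurable borel"
    "g ` U \<in> sets borel"
  shows "integrable lborel (\<lambda>x. indicator U x * (\<bar>det (matrix (g' x))\<bar> * \<phi> (g x)))
           \<longleftrightarrow> integrable lborel (\<lambda>y. indicator (g ` U) y * \<phi> y)" (is "?I1 \<longleftrightarrow> ?I2")
    and "(LINT x|lborel. indicator U x * (\<bar>det (matrix (g' x))\<bar> * \<phi> (g x)))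
           = (LINT y|lborel. indicator (g ` U) y * \<phi> y)" (is "?L1 = ?L2")
proof -
  let ?A = "\<lambda>x. \<bar>det (matrix (g' x))\<bar> * \<phi> (g x)"
  \<comment> \<open>The library theorem has vector-valued integrands; a scalar one is passed through
    \<open>real^1\<close>.\<close>
  have "(\<lambda>x. \<bar>det (matrix (g' x))\<bar> *\<^sub>R (vec (\<phi> (g x)) :: real^1)) absolutely_integrable_on U \<and>
           integral U (\<lambda>x. \<bar>det (matrix (g' x))\<bar> *\<^sub>R (vec (\<phi> (g x)) :: real^1)) = vec b
     \<longleftrightarrow> (\<lambda>y. vec (\<phi> y) :: real^1) absolutely_integrable_on (g ` U) \<and> integral (g ` U) (\<lambda>y. vec (\<phi> y) :: real^1) = vec b" for b
    by (rule has_absolute_integral_change_of_variables)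
      (use U inj g in \<open>auto intro: has_derivative_at_withinI borel_open\<close>)
  then have *: "?A absolutely_integrable_on U \<and> integral U ?A = b
     \<longleftrightarrow> \<phi> absolutely_integrable_on (g ` U) \<and> integral (g ` U) \<phi> = b" for b
    by (simp add: absolutely_integrable_on_1_iff integral_on_1_eq)
  have 1: "?A absolutely_integrable_on U \<longleftrightarrow> ?I1"
    by (simp add: set_integrable_def integrable_completion)
  have 2: "\<phi> absolutely_integrable_on (g ` U) \<longleftrightarrow> ?I2"
    by (simp add: set_integrable_def integrable_completion)
  \<comment> \<open>The equivalence couples integrability with the value \<open>b\<close>; inserting
    either integral for \<open>b\<close> separates the two.\<close>
  show 3: "?I1 \<longleftrightarrow> ?I2" using *[of "integral U ?A"] *[of "integral (g ` U) \<phi>"] 1 2 by blast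
  show "?L1 = ?L2"
  proof (cases ?I1)
    case True
    have "integral U ?A = integral (g ` U) \<phi>" using True *[of "integral U ?A"] 1 by simp
    moreover have "integral U ?A = ?L1"
      using True 1 set_lebesgue_integral_eq_integral(2)[of U ?A]
      by (simp add: set_lebesgue_integral_def integral_completion)
    moreover have "integral (g ` U) \<phi> = ?L2"
      using True 2 3 set_lebesgue_integral_eq_integral(2)[of "g ` U" \<phi>]
      by (simp add: set_lebesgue_integral_def integral_completion)
    ultimately show ?thesis by simp
  next
    case False
    then show ?thesis using 3 by (simp add: not_integrable_integral_eq)
  qed
qed

lemma change_of_variables_open:
  fixes g :: "real^'n::finite \<Rightarrow> real^'n" and \<phi> :: "real^'n \<Rightarrow> real"
  assumes U: "open U" and g: "\<And>x. x \<in> U \<Longrightarrow> (g has_derivative g' x) (at x)" and inj: "inj_on g U"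
    and \<phi>[measurable]: "\<phi> \<in> borel_measurable borel"
    and m[measurable]: "(\<lambda>x. indicator U x * (\<bar>det (matrix (g' x))\<bar> * \<phi> (g x))) \<in> borel_measurable borel"
  shows "integrable lborel (\<lambda>x. indicator U x * (\<bar>det (matrix (g' x))\<bar> * \<phi> (g x)))
           \<longleftrightarrow> integrable lborel (\<lambda>y. indicator (g ` U) y * \<phi> y)" (is "?I1 \<longleftrightarrow> ?I2")
    and "(LINT x|lborel. indicator U x * (\<bar>det (matrix (g' x))\<bar> * \<phi> (g x)))
           = (LINT y|lborel. indicator (g ` U) y * \<phi> y)" (is "?L1 = ?L2")
proof -
  obtain b :: "'n idx \<Rightarrow> 'n" where b: "bij b" using ex_idx_bij by blast
  let ?T = "reindex b" and ?S = "reindex (inv b)"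
  let ?g = "?T \<circ> g \<circ> ?S" and ?g' = "\<lambda>y. ?T \<circ> g' (?S y) \<circ> ?S" and ?U = "?S -` U" and ?p = "\<phi> \<circ> ?S"
  have contg: "continuous_on U g" using g by (meson continuous_at_imp_continuous_on has_derivative_continuous)
  have contS: "continuous_on A ?S" for A by (intro linear_continuous_on bounded_linear_reindex)
  have U': "open ?U" using U contS by (rule open_vimage)
  have d: "(?g has_derivative ?g' y) (at y)" if "y \<in> ?U" for y
  proof -
    have 1: "(?S has_derivative ?S) (at y)" by (rule bounded_linear_imp_has_derivative[OF bounded_linear_reindex])
    have 2: "(g has_derivative g' (?S y)) (at (?S y))" using g that by auto
    have 3: "(?T has_derivative ?T) (at ((g \<circ> ?S) y))" by (rule bounded_linear_imp_has_derivative[OF bounded_linear_reindex])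
    show ?thesis using diff_chain_at[OF diff_chain_at[OF 1 2] 3] by (simp only: o_assoc)
  qed
  have inj': "inj_on ?g ?U"
    using inj b unfolding inj_on_def by (metis comp_apply reindex_inv vimageD)
  have im: "?g ` ?U = ?S -` (g ` U)"
  proof (intro set_eqI iffI)
    fix y assume "y \<in> ?g ` ?U"
    then show "y \<in> ?S -` (g ` U)" using b by (auto simp: bij_is_inj)
  next
    fix y assume "y \<in> ?S -` (g ` U)"
    then obtain x where x: "x \<in> U" "?S y = g x" by auto
    have "y = ?g (?T x)" using x reindex_inv[OF b] by (metis comp_apply)
    moreover have "?T x \<in> ?U" using x reindex_inv[OF b] by simp
    ultimately show "y \<in> ?g ` ?U" by (rule image_eqI)
  qed
  have "open (g ` U)" using invariance_of_domain[OF contg U inj] .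
  then have im_b: "?g ` ?U \<in> sets borel" unfolding im using contS by (intro borel_open open_vimage)
  have J: "det (matrix (?g' y)) = det (matrix (g' (?S y)))" for y
    by (subst matrix_reindex[OF b]) (rule det_reindex[OF b])
  have e1: "(\<lambda>x. indicator ?U x * (\<bar>det (matrix (?g' x))\<bar> * ?p (?g x)))
      = (\<lambda>x. (\<lambda>x. indicator U x * (\<bar>det (matrix (g' x))\<bar> * \<phi> (g x))) (?S x))"
    using b by (auto simp: J indicator_def fun_eq_iff)
  have e2: "(\<lambda>y. indicator (?g ` ?U) y * ?p y) = (\<lambda>y. (\<lambda>y. indicator (g ` U) y * \<phi> y) (?S y))"
    unfolding im by (auto simp: indicator_def fun_eq_iff)
  have m1: "(\<lambda>x. indicator ?U x * (\<bar>det (matrix (?g' x))\<bar> * ?p (?g x))) \<in> borel_measurable borel"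
    unfolding e1 by measurable
  have [measurable]: "g ` U \<in> sets borel" using \<open>open (g ` U)\<close> by simp
  have p: "?p \<in> borel_measurable borel" unfolding o_def by measurable
  note c = change_of_variables_wellorder[where g = ?g and g' = ?g' and U = ?U and \<phi> = ?p, OF U' d inj' p m1 im_b]
  have bi: "bij (inv b)" using b by (rule bij_imp_bij_inv)
  have m2: "(\<lambda>y. indicator (g ` U) y * \<phi> y) \<in> borel_measurable borel" by measurable
  show "?I1 \<longleftrightarrow> ?I2" using c(1) unfolding e1 e2 integrable_reindex(1)[OF bi m] integrable_reindex(1)[OF bi m2] .
  show "?L1 = ?L2" using c(2) unfolding e1 e2 integrable_reindex(2)[OF bi m] integrable_reindex(2)[OF bi m2] .
qed

lemma negligible_critical_values:
  fixes g :: "real^'n::finite \<Rightarrow> real^'n"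
  assumes g: "\<And>x. x \<in> S \<Longrightarrow> (g has_derivative g' x) (at x)" and 0: "\<And>x. x \<in> S \<Longrightarrow> det (matrix (g' x)) = 0"
  shows "negligible (g ` S)"
proof -
  obtain b :: "'n idx \<Rightarrow> 'n" where b: "bij b" using ex_idx_bij by blast
  let ?T = "reindex b" and ?S = "reindex (inv b)"
  let ?g = "?T \<circ> g \<circ> ?S" and ?g' = "\<lambda>y. ?T \<circ> g' (?S y) \<circ> ?S" and ?U = "?S -` S"
  have J: "det (matrix (?g' y)) = det (matrix (g' (?S y)))" for y
    by (subst matrix_reindex[OF b]) (rule det_reindex[OF b])
  have d: "(?g has_derivative ?g' y) (at y)" if "y \<in> ?U" for y
  proof -
    have 1: "(?S has_derivative ?S) (at y)" by (rule bounded_linear_imp_has_derivative[OF bounded_linear_reindex])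
    have 2: "(g has_derivative g' (?S y)) (at (?S y))" using g that by auto
    have 3: "(?T has_derivative ?T) (at ((g \<circ> ?S) y))" by (rule bounded_linear_imp_has_derivative[OF bounded_linear_reindex])
    show ?thesis using diff_chain_at[OF diff_chain_at[OF 1 2] 3] by (simp only: o_assoc)
  qed
  have "negligible (?g ` ?U)"
  proof (rule baby_Sard)
    show "(?g has_derivative ?g' x) (at x within ?U)" if "x \<in> ?U" for x
      using d[OF that] by (rule has_derivative_at_withinI)
    show "rank (matrix (?g' x)) < CARD('n idx)" if "x \<in> ?U" for x
    proof -
      have "det (matrix (?g' x)) = 0" using J[of x] 0 that by simp
      then show ?thesis by (simp only: det_eq_0_rank)
    qed
  qed simp
  moreover have "?g ` ?U = ?T ` g ` S"
  proof -
    have "surj ?S" using reindex_inv(1)[OF b] by (metis surjI)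
    then show ?thesis by (simp only: image_comp[symmetric] surj_image_vimage_eq)
  qed
  ultimately have "negligible (?T ` g ` S)" by simp
  then have "negligible (?S ` ?T ` g ` S)"
    by (rule negligible_differentiable_image_negligible[rotated])
      (auto intro!: bounded_linear_imp_differentiable_on bounded_linear_reindex simp: card_idx)
  then show ?thesis using b by (simp add: image_image)
qed

section \<open>Continuously differentiable maps\<close>

text \<open>The derivative is that of the ambient space, so values of \<open>f\<close> near but
  outside \<open>S\<close> matter too. For open \<open>S\<close> this is ordinary continuous
  differentiability.\<close>

definition C1_on :: "'a::real_normed_vector set \<Rightarrow> ('a \<Rightarrow> 'b::real_normed_vector) \<Rightarrow> bool" where
  "C1_on S f \<longleftrightarrow> (\<exists>f' :: 'a \<Rightarrow> 'a \<Rightarrow>\<^sub>L 'b.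
     (\<forall>x\<in>S. (f has_derivative blinfun_apply (f' x)) (at x)) \<and> continuous_on S f')"

lemma C1_map_eq_C1_on: "C1_map f \<longleftrightarrow> C1_on UNIV f"
  by (simp add: C1_map_def C1_on_def)

lemma C1_on_subset: "C1_on S f \<Longrightarrow> T \<subseteq> S \<Longrightarrow> C1_on T f"
  unfolding C1_on_def by (meson continuous_on_subset subsetD)

lemma C1_on_differentiable: "C1_on S f \<Longrightarrow> x \<in> S \<Longrightarrow> f differentiable (at x)"
  unfolding C1_on_def differentiable_def by blast

lemma C1_on_frechet:
  "C1_on S f \<Longrightarrow> x \<in> S \<Longrightarrow> (f has_derivative frechet_derivative f (at x)) (at x)"
  using C1_on_differentiable frechet_derivative_works by blast

lemma C1_on_imp_continuous_on: "C1_on S f \<Longrightarrow> continuous_on S f"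
  by (rule differentiable_imp_continuous_on)
    (auto simp: differentiable_on_def intro: differentiable_at_withinI C1_on_differentiable)

text \<open>In finite dimensions, continuity of the derivative in each fixed direction
  \<open>h\<close> is already continuity in operator norm.\<close>

lemma C1_onI:
  fixes f :: "'a::euclidean_space \<Rightarrow> 'b::real_normed_vector"
  assumes d: "\<And>x. x \<in> S \<Longrightarrow> (f has_derivative F x) (at x)" and c: "\<And>h. continuous_on S (\<lambda>x. F x h)"
  shows "C1_on S f"
proof -
  have eq: "blinfun_apply (Blinfun (F x)) = F x" if "x \<in> S" for x
    using d[OF that] by (intro bounded_linear_Blinfun_apply has_derivative_bounded_linear)
  have "continuous_on S (\<lambda>x. Blinfun (F x))"
  proof (rule continuous_on_blinfun_componentwise)
    fix i :: 'a
    show "continuous_on S (\<lambda>x. blinfun_apply (Blinfun (F x)) i)"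
      using c[of i] by (rule continuous_on_eq) (simp add: eq)
  qed
  then show ?thesis unfolding C1_on_def
    using d by (intro exI[of _ "\<lambda>x. Blinfun (F x)"]) (auto simp: eq)
qed

lemma C1_on_continuous_frechet:
  assumes "C1_on S f" shows "continuous_on S (\<lambda>x. frechet_derivative f (at x) h)"
proof -
  obtain F where F: "\<And>x. x \<in> S \<Longrightarrow> (f has_derivative blinfun_apply (F x)) (at x)" "continuous_on S F"
    using assms unfolding C1_on_def by blast
  have "continuous_on S (\<lambda>x. blinfun_apply (F x) h)"
    using F(2) by (intro continuous_intros)
  then show ?thesis
    by (rule continuous_on_eq) (simp add: frechet_derivative_at[OF F(1), symmetric])
qed

lemma C1_on_const [intro, simp]: "C1_on S (\<lambda>x. c)"
  unfolding C1_on_def by (rule exI[of _ "\<lambda>x. 0"]) (auto simp: zero_blinfun.rep_eq)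

lemma C1_on_bounded_linear: "bounded_linear f \<Longrightarrow> C1_on S f"
  unfolding C1_on_def
  by (rule exI[of _ "\<lambda>x. Blinfun f"])
    (auto simp: bounded_linear_Blinfun_apply intro: bounded_linear_imp_has_derivative)

lemma C1_on_ident [intro, simp]: "C1_on S (\<lambda>x. x)"
  by (rule C1_on_bounded_linear[OF bounded_linear_ident])

lemma C1_on_add:
  assumes "C1_on S f" "C1_on S g" shows "C1_on S (\<lambda>x. f x + g x)"
proof -
  obtain F where f: "\<And>x. x \<in> S \<Longrightarrow> (f has_derivative blinfun_apply (F x)) (at x)" "continuous_on S F"
    using assms(1) unfolding C1_on_def by blast
  obtain G where g: "\<And>x. x \<in> S \<Longrightarrow> (g has_derivative blinfun_apply (G x)) (at x)" "continuous_on S G"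
    using assms(2) unfolding C1_on_def by blast
  show ?thesis unfolding C1_on_def
    by (rule exI[of _ "\<lambda>x. F x + G x"])
      (auto simp: plus_blinfun.rep_eq intro!: has_derivative_add f g continuous_on_add)
qed

lemma C1_on_bilinear:
  fixes f :: "'a::euclidean_space \<Rightarrow> 'b::real_normed_vector"
    and g :: "'a \<Rightarrow> 'c::real_normed_vector" and B :: "'b \<Rightarrow> 'c \<Rightarrow> 'd::real_normed_vector"
  assumes B: "bounded_bilinear B" and fg: "C1_on S f" "C1_on S g"
  shows "C1_on S (\<lambda>x. B (f x) (g x))"
proof -
  interpret bounded_bilinear B by fact
  obtain F where f: "\<And>x. x \<in> S \<Longrightarrow> (f has_derivative blinfun_apply (F x)) (at x)" "continuous_on S F"
    using fg(1) unfolding C1_on_def by blast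
  obtain G where g: "\<And>x. x \<in> S \<Longrightarrow> (g has_derivative blinfun_apply (G x)) (at x)" "continuous_on S G"
    using fg(2) unfolding C1_on_def by blast
  show ?thesis
  proof (rule C1_onI)
    fix x assume "x \<in> S"
    then show "((\<lambda>x. B (f x) (g x)) has_derivative
        (\<lambda>h. B (f x) (blinfun_apply (G x) h) + B (blinfun_apply (F x) h) (g x))) (at x)"
      by (intro FDERIV f g)
  next
    fix h
    show "continuous_on S (\<lambda>x. B (f x) (blinfun_apply (G x) h) + B (blinfun_apply (F x) h) (g x))"
      using f(2) g(2) C1_on_imp_continuous_on[OF fg(1)] C1_on_imp_continuous_on[OF fg(2)]
      by (intro continuous_on_add continuous_on continuous_intros)
  qed
qed

lemmas C1_on_scaleR = C1_on_bilinear[OF bounded_bilinear_scaleR]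
lemmas C1_on_mult = C1_on_bilinear[OF bounded_bilinear_mult]
lemmas C1_on_inner = C1_on_bilinear[OF bounded_bilinear_inner]

lemma C1_on_minus:
  fixes f :: "'a::euclidean_space \<Rightarrow> 'b::real_normed_vector"
  assumes "C1_on S f" shows "C1_on S (\<lambda>x. - f x)"
  using C1_on_scaleR[OF C1_on_const[of S "-1"] assms] by simp

lemma C1_on_diff:
  fixes f :: "'a::euclidean_space \<Rightarrow> 'b::real_normed_vector"
  assumes "C1_on S f" "C1_on S g" shows "C1_on S (\<lambda>x. f x - g x)"
  using C1_on_add[OF assms(1) C1_on_minus[OF assms(2)]] by simp

lemma C1_on_sum:
  "(\<And>i. i \<in> I \<Longrightarrow> C1_on S (f i)) \<Longrightarrow> C1_on S (\<lambda>x. \<Sum>i\<in>I. f i x)"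
  by (induction I rule: infinite_finite_induct) (auto intro: C1_on_add)

lemma C1_on_compose:
  fixes f :: "'a::euclidean_space \<Rightarrow> 'b::euclidean_space" and g :: "'b \<Rightarrow> 'c::real_normed_vector"
  assumes fg: "C1_on S f" "C1_on T g" and ST: "f ` S \<subseteq> T"
  shows "C1_on S (\<lambda>x. g (f x))"
proof -
  obtain F where f: "\<And>x. x \<in> S \<Longrightarrow> (f has_derivative blinfun_apply (F x)) (at x)" "continuous_on S F"
    using fg(1) unfolding C1_on_def by blast
  obtain G where g: "\<And>x. x \<in> T \<Longrightarrow> (g has_derivative blinfun_apply (G x)) (at x)" "continuous_on T G"
    using fg(2) unfolding C1_on_def by blast
  show ?thesis
  proof (rule C1_onI)
    fix x assume x: "x \<in> S"
    then have "(g has_derivative blinfun_apply (G (f x))) (at (f x))" using ST g(1) by blast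
    from diff_chain_at[OF f(1)[OF x] this]
    show "((\<lambda>x. g (f x)) has_derivative (\<lambda>h. blinfun_apply (G (f x)) (blinfun_apply (F x) h))) (at x)"
      by (simp add: o_def)
  next
    fix h
    have "continuous_on S (\<lambda>x. G (f x))"
      using continuous_on_compose2[OF g(2) C1_on_imp_continuous_on[OF fg(1)] ST] .
    then show "continuous_on S (\<lambda>x. blinfun_apply (G (f x)) (blinfun_apply (F x) h))"
      using f(2) by (intro continuous_intros)
  qed
qed

lemma C1_on_vec_nth: "C1_on S f \<Longrightarrow> C1_on S (\<lambda>x. f x $ i)" for f :: "'a::euclidean_space \<Rightarrow> real^'n"
  by (rule C1_on_compose[OF _ C1_on_bounded_linear[OF bounded_linear_vec_nth] subset_UNIV])

lemma C1_on_vec_lambda: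
  fixes f :: "'n::finite \<Rightarrow> 'a::euclidean_space \<Rightarrow> real"
  assumes "\<And>i. C1_on S (f i)" shows "C1_on S (\<lambda>x. \<chi> i. f i x)"
proof -
  have "C1_on S (\<lambda>x. \<Sum>i\<in>UNIV. f i x *\<^sub>R (axis i 1 :: real^'n))"
    by (intro C1_on_sum C1_on_scaleR assms C1_on_const)
  moreover have "(\<Sum>i\<in>UNIV. f i x *\<^sub>R (axis i 1 :: real^'n)) = (\<chi> i. f i x)" for x
    using basis_expansion[of "\<chi> i. f i x"] by (simp add: scalar_mult_eq_scaleR)
  ultimately show ?thesis by simp
qed

lemma C1_on_cong:
  assumes "C1_on S f" "open S" "\<And>x. x \<in> S \<Longrightarrow> g x = f x" shows "C1_on S g"
proof -
  obtain F where f: "\<And>x. x \<in> S \<Longrightarrow> (f has_derivative blinfun_apply (F x)) (at x)" "continuous_on S F"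
    using assms(1) unfolding C1_on_def by blast
  have "(g has_derivative blinfun_apply (F x)) (at x)" if "x \<in> S" for x
    using f(1)[OF that] assms(2) that by (rule has_derivative_transform_within_open) (simp add: assms(3))
  then show ?thesis unfolding C1_on_def using f(2) by blast
qed

lemma C1_on_Un:
  fixes f :: "'a::euclidean_space \<Rightarrow> 'b::real_normed_vector"
  assumes "C1_on S f" "C1_on T f" "open S" "open T" shows "C1_on (S \<union> T) f"
proof (rule C1_onI)
  show "(f has_derivative frechet_derivative f (at x)) (at x)" if "x \<in> S \<union> T" for x
    using that assms C1_on_frechet by blast
  show "continuous_on (S \<union> T) (\<lambda>x. frechet_derivative f (at x) h)" for h
    using assms by (intro continuous_on_open_Un C1_on_continuous_frechet)
qed

lemma C1_on_real:
  fixes q :: "real \<Rightarrow> real"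
  assumes "\<And>t. (q has_real_derivative q' t) (at t)" "continuous_on UNIV q'"
  shows "C1_on UNIV q"
proof (rule C1_onI)
  show "(q has_derivative (*) (q' t)) (at t)" for t
    using assms(1) by (simp add: has_field_derivative_def)
  show "continuous_on UNIV (\<lambda>t. q' t * h)" for h by (intro continuous_intros assms)
qed

lemma jacobian_det_eqI: "(f has_derivative f') (at x) \<Longrightarrow> jacobian_det f x = det (matrix f')"
  unfolding jacobian_det_def by (simp only: frechet_derivative_at[symmetric])

lemma continuous_on_det:
  fixes A :: "'a::topological_space \<Rightarrow> real^'n^'n"
  assumes "\<And>i j. continuous_on S (\<lambda>x. A x $ i $ j)"
  shows "continuous_on S (\<lambda>x. det (A x))"
  unfolding det_def by (intro continuous_intros assms)

lemma continuous_on_jacobian_det: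
  assumes "C1_on S f" shows "continuous_on S (jacobian_det f)"
  unfolding jacobian_det_def
proof (rule continuous_on_det)
  fix i j
  have "continuous_on S (\<lambda>x. frechet_derivative f (at x) (axis j 1) $ i)"
    by (intro continuous_intros C1_on_continuous_frechet assms)
  then show "continuous_on S (\<lambda>x. matrix (frechet_derivative f (at x)) $ i $ j)"
    by (simp add: matrix_def)
qed

lemma jacobian_det_compose:
  assumes "f differentiable (at x)" "g differentiable (at (f x))"
  shows "jacobian_det (\<lambda>x. g (f x)) x = jacobian_det g (f x) * jacobian_det f x"
proof -
  let ?F = "frechet_derivative f (at x)" and ?G = "frechet_derivative g (at (f x))"
  have f: "(f has_derivative ?F) (at x)" and g: "(g has_derivative ?G) (at (f x))"
    using assms frechet_derivative_works by auto
  have "jacobian_det (\<lambda>x. g (f x)) x = det (matrix (?G \<circ> ?F))"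
    using diff_chain_at[OF f g] by (intro jacobian_det_eqI) (simp add: o_def)
  also have "\<dots> = det (matrix ?G ** matrix ?F)"
    using has_derivative_linear[OF f] has_derivative_linear[OF g] by (simp add: matrix_compose)
  finally show ?thesis by (simp add: det_mul jacobian_det_def)
qed

lemma jacobian_det_cong:
  assumes "open S" "x \<in> S" "\<And>x. x \<in> S \<Longrightarrow> f x = g x"
  shows "jacobian_det f x = jacobian_det g x"
proof -
  have "(f has_derivative D) (at x) \<longleftrightarrow> (g has_derivative D) (at x)" for D
    using assms has_derivative_transform_within_open[of f D x UNIV S g]
      has_derivative_transform_within_open[of g D x UNIV S f] by auto
  then show ?thesis unfolding jacobian_det_def frechet_derivative_def by simp
qed

section \<open>Integrals of Jacobian determinants\<close>

lemma has_real_derivative_max_0_square: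
  "((\<lambda>t::real. (max 0 t)\<^sup>2) has_real_derivative 2 * max 0 t) (at t)"
proof -
  consider "t < 0" | "t = 0" | "t > 0" by linarith
  then show ?thesis
  proof cases
    case 1
    have "((\<lambda>t::real. 0) has_real_derivative 0) (at t)" by simp
    then have "((\<lambda>t::real. (max 0 t)\<^sup>2) has_real_derivative 0) (at t)"
      by (rule DERIV_cong_ev[THEN iffD1, rotated -1])
        (use 1 eventually_nhds_in_open[of "{..<0}" t] in \<open>auto elim!: eventually_mono\<close>)
    then show ?thesis using 1 by simp
  next
    case 2
    have "(\<lambda>h::real. (max 0 h)\<^sup>2 / h) = max 0" by (auto simp: fun_eq_iff max_def power2_eq_square)
    moreover have "(max 0 \<longlongrightarrow> max 0 (0::real)) (at 0)" by (intro tendsto_intros)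
    ultimately show ?thesis using 2 by (simp add: DERIV_def)
  next
    case 3
    have "((\<lambda>t::real. t\<^sup>2) has_real_derivative 2 * t) (at t)" by (auto intro!: derivative_eq_intros)
    then have "((\<lambda>t::real. (max 0 t)\<^sup>2) has_real_derivative 2 * t) (at t)"
      by (rule DERIV_cong_ev[THEN iffD1, rotated -1])
        (use 3 eventually_nhds_in_open[of "{0<..}" t] in \<open>auto elim!: eventually_mono\<close>)
    then show ?thesis using 3 by simp
  qed
qed

lemma C1_on_max_0_square: "C1_on UNIV (\<lambda>t::real. (max 0 t)\<^sup>2)"
  by (rule C1_on_real[OF has_real_derivative_max_0_square]) (intro continuous_intros)

text \<open>A C^1 transition from 0 to 1 that equals \<open>1 - (1 - t\<^sup>2)\<^sup>2\<close> on
  the unit interval. Written with squared positive parts it is differentiated by the chain rule,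
  without gluing pieces.\<close>

definition smooth_step :: "real \<Rightarrow> real" where
  "smooth_step t = 1 - (max 0 (1 - (max 0 t)\<^sup>2))\<^sup>2"

lemma C1_on_smooth_step: "C1_on UNIV smooth_step"
proof -
  have 1: "C1_on UNIV (\<lambda>t::real. 1 - (max 0 t)\<^sup>2)"
    by (intro C1_on_diff C1_on_const C1_on_max_0_square)
  show ?thesis unfolding smooth_step_def
    using C1_on_diff[OF C1_on_const C1_on_compose[OF 1 C1_on_max_0_square subset_UNIV], of 1] .
qed

lemma smooth_step_simps [simp]:
  "t \<le> 0 \<Longrightarrow> smooth_step t = 0" "t \<ge> 1 \<Longrightarrow> smooth_step t = 1"
  using one_le_power[of t 2] by (auto simp: smooth_step_def max.absorb1 max.absorb2)

lemma smooth_step_bounds: "0 \<le> smooth_step t" "smooth_step t \<le> 1"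
proof -
  have "max 0 (1 - (max 0 t)\<^sup>2) \<le> 1" by simp
  then show "0 \<le> smooth_step t" "smooth_step t \<le> 1"
    using power_le_one[of "max 0 (1 - (max 0 t)\<^sup>2)" 2] by (simp_all add: smooth_step_def)
qed

lemma det_scaleR: "det (c *\<^sub>R A) = c ^ CARD('n) * det A" for A :: "real^'n^'n"
proof -
  have "(\<chi> i. c *s A $ i) = c *\<^sub>R A" by (simp add: vec_eq_iff)
  then show ?thesis using det_rows_mul[of "\<lambda>_. c" "\<lambda>i. A $ i"] by simp
qed

lemma set_integral_sum:
  fixes g :: "'i \<Rightarrow> 'a \<Rightarrow> real"
  assumes "\<And>i. i \<in> I \<Longrightarrow> set_integrable M B (g i)"
  shows "(LINT x:B|M. (\<Sum>i\<in>I. g i x)) = (\<Sum>i\<in>I. LINT x:B|M. g i x)"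
  using assms unfolding set_lebesgue_integral_def set_integrable_def
  by (simp add: scaleR_sum_right Bochner_Integration.integral_sum sum_distrib_left)

text \<open>For large \<open>t\<close> the map \<open>x \<mapsto> x + f x / t\<close> is a diffeomorphism of the ball \<open>B\<close>, so the integral of
  \<open>det (t + D f)\<close> over \<open>B\<close> is \<open>t\<^sup>n\<close> times the volume of \<open>B\<close>. Both sides are polynomials in \<open>t\<close>;
  compare them at \<open>t = 0\<close>.\<close>

lemma integral_jacobian_det_compact_support:
  fixes f :: "real^'n::finite \<Rightarrow> real^'n"
  assumes f: "C1_on UNIV f" and supp: "\<And>x. r \<le> norm x \<Longrightarrow> f x = 0" and r: "0 < r"
  shows "integrable lborel (jacobian_det f)" and "(LINT x|lborel. jacobian_det f x) = 0"
proof -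
  \<comment> \<open>The margin 1 keeps the complement of \<open>B\<close> inside the open set
    \<open>norm x > r\<close>, where \<open>f\<close> and therefore its derivative vanish.\<close>
  define B where "B = ball (0::real^'n) (r + 1)"
  define D where "D x = frechet_derivative f (at x)" for x
  define A where "A x = matrix (D x)" for x
  have D: "(f has_derivative D x) (at x)" for x unfolding D_def using C1_on_frechet[OF f] by simp
  have linD: "linear (D x)" for x using D has_derivative_linear by blast
  have contD: "continuous_on S (\<lambda>x. D x h)" for h S
    unfolding D_def using C1_on_continuous_frechet[OF f] continuous_on_subset by blast
  have contA: "continuous_on S (\<lambda>x. A x $ i $ j)" for i j S
    unfolding A_def matrix_def by (simp, intro continuous_intros contD)
  have D0: "D x = (\<lambda>h. 0)" if "norm x > r" for x
  proof -
    have "open {x::real^'n. norm x > r}" by (intro open_Collect_less continuous_intros)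
    then have "(f has_derivative (\<lambda>h. 0)) (at x)"
      using that supp by (intro has_derivative_transform_within_open[of "\<lambda>x. 0" "\<lambda>h. 0" x UNIV "{x. norm x > r}" f]) auto
    then show ?thesis using D has_derivative_unique by blast
  qed
  obtain L where L: "L > 0" "\<And>x h. norm (D x h) \<le> L * norm h"
  proof -
    obtain F where F: "\<And>x. (f has_derivative blinfun_apply (F x)) (at x)" "continuous_on UNIV F"
      using f unfolding C1_on_def by blast
    have "continuous_on (cball 0 (r+1)) (\<lambda>x. norm (F x))"
      using F(2) by (intro continuous_intros) (auto intro: continuous_on_subset)
    then have "bounded ((\<lambda>x. norm (F x)) ` cball 0 (r+1))"
      by (intro compact_imp_bounded compact_continuous_image) auto
    then obtain L where "L > 0" "\<And>x. x \<in> cball 0 (r+1) \<Longrightarrow> norm (F x) \<le> L"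
      by (auto simp: bounded_pos)
    moreover have "D x = blinfun_apply (F x)" for x using D F(1) has_derivative_unique by blast
    ultimately have "norm (D x h) \<le> L * norm h" if "x \<in> cball 0 (r+1)" for x h
      using that norm_blinfun[of "F x" h] by (metis mult_right_mono norm_ge_zero order_trans)
    moreover have "norm (D x h) \<le> L * norm h" if "x \<notin> cball 0 (r+1)" for x h
      using that D0[of x] \<open>L > 0\<close> by auto
    ultimately show thesis using that \<open>L > 0\<close> by blast
  qed
  have lip: "norm (f x - f y) \<le> L * norm (x - y)" for x y
    by (rule differentiable_bound[of UNIV f D]) (auto intro!: D onorm_bound L less_imp_le[OF L(1)])
  have card: "CARD('n) > 0" by simp
  have vol: "(LINT x:B|lborel. det (mat t + A x)) = t ^ CARD('n) * measure lborel B" if t: "t > L" for t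
  proof -
    \<comment> \<open>As \<open>t > L\<close>, the map \<open>s *\<^sub>R f\<close> is a
      contraction. This makes \<open>h\<close> a bijection of the whole space; being the identity
      off \<open>B\<close>, it maps \<open>B\<close> onto \<open>B\<close>.\<close>
    define s where "s = 1 / t"
    have s: "s > 0" "s * L < 1" "t > 0" "t * s = 1" using t L by (auto simp: s_def divide_simps)
    define h where "h x = x + s *\<^sub>R f x" for x
    define h' where "h' x v = v + s *\<^sub>R D x v" for x v
    have h': "(h has_derivative h' x) (at x)" for x
      unfolding h_def h'_def by (intro derivative_intros D)
    have mat: "matrix (h' x) = s *\<^sub>R (mat t + A x)" for x
      using s unfolding h'_def A_def matrix_def mat_def
      by (auto simp: vec_eq_iff axis_def algebra_simps)
    have sf: "norm (s *\<^sub>R f x - s *\<^sub>R f y) \<le> s * L * norm (x - y)" for x y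
      using lip[of x y] s by (simp add: scaleR_diff_right[symmetric] mult.assoc)
    have inj: "inj_on h UNIV"
    proof (rule injI)
      fix x y assume "h x = h y"
      then have "x - y = - (s *\<^sub>R f x - s *\<^sub>R f y)" by (simp add: h_def algebra_simps)
      then have "norm (x - y) \<le> s * L * norm (x - y)" using sf[of x y] by (metis norm_minus_cancel)
      then show "x = y" using s mult_less_cancel_right1[of "norm (x-y)" "s*L"] by force
    qed
    have hB: "h x = x" if "x \<notin> B" for x using that supp by (auto simp: h_def B_def)
    have surj: "\<exists>x. h x = y" for y
    proof -
      \<comment> \<open>A solution of \<open>h x = y\<close> is a fixed point of the contraction
        \<open>\<lambda>x. y - s *\<^sub>R f x\<close>.\<close>
      have "\<exists>!x. x \<in> UNIV \<and> y - s *\<^sub>R f x = x"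
        using s L sf by (intro Banach_fix[where c = "s * L"])
          (auto simp: complete_UNIV dist_norm norm_minus_commute)
      then show ?thesis unfolding h_def by (metis diff_add_cancel)
    qed
    have im: "h ` B = B"
    proof (intro equalityI subsetI)
      fix y assume "y \<in> h ` B"
      then obtain x where x: "x \<in> B" "y = h x" by auto
      show "y \<in> B"
      proof (rule ccontr)
        assume "y \<notin> B"
        then have "h y = h x" using hB x by metis
        then have "y = x" using inj by (simp add: inj_def)
        then show False using x \<open>y \<notin> B\<close> by simp
      qed
    next
      fix y assume y: "y \<in> B"
      obtain x where x: "h x = y" using surj by blast
      then have "x \<in> B" using hB y by metis
      then show "y \<in> h ` B" using x by blast
    qed
    have pos: "det (matrix (h' x)) > 0" for x
    proof -
      \<comment> \<open>\<open>E\<close> joins the determinant 1 of the identity to that of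
        \<open>h' x\<close>. A zero on the way would give a vector with
        \<open>norm v \<le> s * L * norm v\<close>, so the sign stays positive.\<close>
      define E where "E \<tau> = det (mat 1 + \<tau> *\<^sub>R A x)" for \<tau>
      have E0: "E \<tau> \<noteq> 0" if "\<tau> \<in> {0..s}" for \<tau>
      proof
        assume "E \<tau> = 0"
        then obtain v where v: "v \<noteq> 0" "(mat 1 + \<tau> *\<^sub>R A x) *v v = 0"
          unfolding E_def using invertible_det_nz invertible_left_inverse matrix_left_invertible_ker by metis
        have "(mat 1 + \<tau> *\<^sub>R A x) *v v = v + \<tau> *\<^sub>R D x v"
          using matrix_works[OF linear_matrix_vector_mul_eq[THEN iffD2, OF linD], of x v]
          by (simp add: matrix_vector_mult_add_rdistrib scaleR_matrix_vector_assoc[symmetric] A_def)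
        then have "norm v = norm (\<tau> *\<^sub>R D x v)" using v(2) by (metis add_eq_0_iff norm_minus_cancel)
        also have "\<dots> \<le> s * (L * norm v)" using that L(2)[of x v] s
          by (auto intro!: mult_mono)
        finally have "norm v \<le> s * L * norm v" by simp
        then show False using s v(1) mult_less_cancel_right1[of "norm v" "s*L"] by force
      qed
      have "continuous_on {0..s} E"
        unfolding E_def by (intro continuous_on_det) (auto intro!: continuous_intros)
      moreover have "E 0 = 1" by (simp add: E_def)
      ultimately have "E s > 0"
        using IVT2'[of E s 0 0] E0 s by (smt (verit) atLeastAtMost_iff)
      moreover have "matrix (h' x) = mat 1 + s *\<^sub>R A x"
        using s unfolding mat by (auto simp: vec_eq_iff mat_def algebra_simps)
      ultimately show ?thesis by (simp add: E_def)
    qed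
    have J: "det (matrix (h' x)) = s ^ CARD('n) * det (mat t + A x)" for x
      unfolding mat by (simp add: det_scaleR)
    have oB: "open B" by (simp add: B_def)
    have cd: "continuous_on S (\<lambda>x. det (mat t + A x))" for S
      by (intro continuous_on_det) (auto intro!: continuous_intros contA)
    have md: "(\<lambda>x. det (mat t + A x)) \<in> borel_measurable borel"
      by (rule borel_measurable_continuous_onI[OF cd])
    have m: "(\<lambda>x. indicator B x * (\<bar>det (matrix (h' x))\<bar> * 1)) \<in> borel_measurable borel"
      unfolding J using oB by (intro borel_measurable_times borel_measurable_indicator borel_measurable_abs
          borel_measurable_const md) auto
    have "(LINT x|lborel. indicator B x * (\<bar>det (matrix (h' x))\<bar> * 1)) = (LINT y|lborel. indicator (h ` B) y * 1)"
      by (rule change_of_variables_open(2)[where \<phi> = "\<lambda>x. 1"])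
        (use oB h' inj m in \<open>auto intro: inj_on_subset\<close>)
    then have "(LINT x|lborel. indicator B x * (s ^ CARD('n) * det (mat t + A x))) = measure lborel B"
      using pos oB unfolding im by (simp add: J abs_of_pos)
    moreover have "(LINT x|lborel. indicator B x * (s ^ CARD('n) * det (mat t + A x)))
        = s ^ CARD('n) * (LINT x:B|lborel. det (mat t + A x))"
      unfolding set_lebesgue_integral_def by (subst integral_mult_right_zero[symmetric]) (simp add: mult_ac)
    ultimately have "t ^ CARD('n) * s ^ CARD('n) * (LINT x:B|lborel. det (mat t + A x)) = t ^ CARD('n) * measure lborel B"
      by simp
    then show ?thesis using s by (simp add: power_mult_distrib[symmetric])
  qed
  have intB: "set_integrable lborel B g" if "continuous_on UNIV g" for g :: "real^'n \<Rightarrow> real"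
  proof (rule set_integrable_subset)
    show "set_integrable lborel (cball 0 (r+1)) g"
      unfolding set_integrable_def by (rule borel_integrable_compact) (auto intro: continuous_on_subset[OF that])
  qed (auto simp: B_def)
  \<comment> \<open>When the product over the rows is multiplied out, \<open>X\<close> is the set of
    rows that contribute their entry of \<open>mat t\<close>, which is \<open>t\<close> times an
    entry of \<open>mat 1\<close>; the other rows contribute their entry of
    \<open>A x\<close>.\<close>
  define \<delta> where "\<delta> p X = of_int (sign p) * (\<Prod>i\<in>X. (mat 1 :: real^'n^'n) $ i $ p i)" for p X
  define G where "G p X x = (\<Prod>i\<in>UNIV-X. A x $ i $ p i)" for p :: "'n \<Rightarrow> 'n" and X x
  have exp: "det (mat t + A x) = (\<Sum>p | p permutes UNIV. \<Sum>X\<in>Pow UNIV. \<delta> p X * t ^ card X * G p X x)" for t x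
  proof -
    have "(mat t :: real^'n^'n) $ i $ j = t * mat 1 $ i $ j" for i j by (simp add: mat_def)
    then have "(\<Prod>i\<in>UNIV. (mat t + A x) $ i $ p i)
        = (\<Sum>X\<in>Pow UNIV. (\<Prod>i\<in>X. mat 1 $ i $ p i) * t ^ card X * G p X x)" for p
      by (simp add: prod_add prod.distrib G_def mult_ac)
    then show ?thesis unfolding det_def \<delta>_def by (simp add: sum_distrib_left mult.assoc)
  qed
  have contG: "continuous_on UNIV (G p X)" for p X
    unfolding G_def by (intro continuous_intros contA)
  define P where "P = (\<Sum>p | p permutes (UNIV::'n set). \<Sum>X\<in>Pow UNIV. monom (\<delta> p X * (LINT x:B|lborel. G p X x)) (card X))"
  have P: "poly P t = (LINT x:B|lborel. det (mat t + A x))" for t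
  proof -
    have "(LINT x:B|lborel. det (mat t + A x))
        = (\<Sum>p | p permutes UNIV. \<Sum>X\<in>Pow UNIV. (LINT x:B|lborel. \<delta> p X * t ^ card X * G p X x))"
      unfolding exp
      by (subst set_integral_sum, rule intB, intro continuous_intros contG,
          intro sum.cong refl set_integral_sum, rule intB, intro continuous_intros contG)
    then show ?thesis by (simp add: P_def poly_sum poly_monom mult_ac)
  qed
  have "P = monom (measure lborel B) (CARD('n))"
  proof (rule ccontr)
    assume "P \<noteq> monom (measure lborel B) (CARD('n))"
    then have "finite {t. poly (P - monom (measure lborel B) (CARD('n))) t = 0}"
      by (intro poly_roots_finite) simp
    moreover have "{L<..} \<subseteq> {t. poly (P - monom (measure lborel B) (CARD('n))) t = 0}"
      using vol by (auto simp: P poly_monom mult.commute)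
    ultimately have "finite {L<..}" by (rule finite_subset[rotated])
    then show False using infinite_Ioi by blast
  qed
  \<comment> \<open>The dimension is positive, so the monomial vanishes at 0.\<close>
  then have "poly P 0 = 0" using card by (simp add: poly_monom)
  then have 0: "(LINT x:B|lborel. det (A x)) = 0" by (simp add: P)
  have cdet: "continuous_on UNIV (\<lambda>x. det (A x))" by (intro continuous_on_det contA)
  have eq: "jacobian_det f = (\<lambda>x. indicator B x * det (A x))"
  proof
    fix x show "jacobian_det f x = indicator B x * det (A x)"
    proof (cases "x \<in> B")
      case False
      then have "A x = 0" by (auto simp: A_def B_def D0 matrix_def vec_eq_iff)
      moreover have "det (0 :: real^'n^'n) = 0" using det_scaleR[of 0 "0 :: real^'n^'n"] card by (simp add: zero_power)
      ultimately show ?thesis using False by (simp add: jacobian_det_def A_def D_def)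
    qed (simp add: jacobian_det_def A_def D_def)
  qed
  show "integrable lborel (jacobian_det f)"
    using intB[OF cdet] by (simp add: eq set_integrable_def)
  show "(LINT x|lborel. jacobian_det f x) = 0"
    using 0 by (simp add: eq set_lebesgue_integral_def)
qed

lemma set_integrable_continuous_closure:
  fixes g :: "'a::euclidean_space \<Rightarrow> real"
  assumes "bounded S" "S \<in> sets borel" "continuous_on (closure S) g"
  shows "set_integrable lborel S g"
proof (rule set_integrable_subset)
  show "set_integrable lborel (closure S) g"
    unfolding set_integrable_def using assms by (intro borel_integrable_compact) auto
qed (use assms closure_subset in auto)

lemma C1_on_norm_square: "C1_on S (\<lambda>x::'a::euclidean_space. (norm (x - a))\<^sup>2)"
  using C1_on_inner[OF C1_on_diff[OF C1_on_ident C1_on_const[of S a]] C1_on_diff[OF C1_on_ident C1_on_const[of S a]]]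
  by (simp add: power2_norm_eq_inner)

text \<open>Multiply both maps by a compactly supported cutoff \<eta> that is 1 on \<Omega>. The
  Jacobians then have integral 0 over the whole space, and outside \<Omega> they are equal because
  the maps agree on the open complement of \<open>T\<close>. So the integrals over \<Omega> agree as
  well.\<close>

lemma integral_jacobian_det_eq:
  fixes F G :: "real^'n::finite \<Rightarrow> real^'n"
  assumes \<Omega>: "open \<Omega>" "bounded \<Omega>" and FG: "C1_on UNIV F" "C1_on UNIV G"
    and T: "compact T" "T \<subseteq> \<Omega>" and eq: "\<And>x. x \<notin> T \<Longrightarrow> F x = G x"
  shows "(LINT x:\<Omega>|lborel. jacobian_det F x) = (LINT x:\<Omega>|lborel. jacobian_det G x)"
proof -
  obtain r where r: "r > 0" "\<And>x. x \<in> \<Omega> \<Longrightarrow> norm x \<le> r" using \<Omega>(2) by (auto simp: bounded_pos)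
  \<comment> \<open>The argument of \<open>smooth_step\<close> is at least 1 for
    \<open>norm x \<le> r\<close>, and at most 0 for \<open>norm x \<ge> r + 1\<close> because
    \<open>(r + 1)\<^sup>2 \<ge> r\<^sup>2 + 1\<close>.\<close>
  define \<eta> where "\<eta> x = smooth_step (r\<^sup>2 + 1 - (norm x)\<^sup>2)" for x :: "real^'n"
  have \<eta>: "C1_on UNIV \<eta>" unfolding \<eta>_def
    using C1_on_compose[OF C1_on_diff[OF C1_on_const[of _ "r\<^sup>2+1"] C1_on_norm_square[of UNIV 0]] C1_on_smooth_step subset_UNIV] by simp
  have one: "\<eta> x = 1" if "x \<in> \<Omega>" for x using r(2)[OF that] by (simp add: \<eta>_def power_mono)
  have zero: "\<eta> x = 0" if "r + 1 \<le> norm x" for x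
  proof -
    have "(r + 1)\<^sup>2 \<le> (norm x)\<^sup>2" using that r(1) by (intro power_mono) auto
    then show ?thesis using r(1) by (simp add: \<eta>_def power2_sum)
  qed
  have C: "C1_on UNIV (\<lambda>x. \<eta> x *\<^sub>R F x)" "C1_on UNIV (\<lambda>x. \<eta> x *\<^sub>R G x)"
    by (intro C1_on_scaleR \<eta> FG)+
  note I = integral_jacobian_det_compact_support[OF C(1), of "r+1"] integral_jacobian_det_compact_support[OF C(2), of "r+1"]
  have in\<Omega>: "jacobian_det (\<lambda>x. \<eta> x *\<^sub>R F x) x = jacobian_det F x" if "x \<in> \<Omega>" for x and F :: "real^'n \<Rightarrow> real^'n"
    by (rule jacobian_det_cong[OF \<Omega>(1) that]) (simp add: one)
  have out: "jacobian_det (\<lambda>x. \<eta> x *\<^sub>R F x) x = jacobian_det (\<lambda>x. \<eta> x *\<^sub>R G x) x" if "x \<notin> \<Omega>" for x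
    by (rule jacobian_det_cong[of "- T"]) (use T that eq in \<open>auto simp: open_Compl compact_imp_closed\<close>)
  have si: "set_integrable lborel \<Omega> (jacobian_det F)" "set_integrable lborel \<Omega> (jacobian_det G)"
    by (intro set_integrable_continuous_closure \<Omega> borel_open C1_on_subset[OF FG(1)] C1_on_subset[OF FG(2)]
        continuous_on_jacobian_det subset_UNIV)+
  have "(LINT x:\<Omega>|lborel. jacobian_det F x) - (LINT x:\<Omega>|lborel. jacobian_det G x)
      = (LINT x:\<Omega>|lborel. jacobian_det F x - jacobian_det G x)"
    using si by (simp add: set_integral_diff)
  also have "\<dots> = (LINT x|lborel. jacobian_det (\<lambda>x. \<eta> x *\<^sub>R F x) x - jacobian_det (\<lambda>x. \<eta> x *\<^sub>R G x) x)"
    unfolding set_lebesgue_integral_def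
    by (intro Bochner_Integration.integral_cong refl) (auto simp: in\<Omega> out indicator_def)
  also have "\<dots> = 0" using I zero r(1) by (simp add: Bochner_Integration.integral_diff)
  finally show ?thesis by simp
qed

text \<open>These test functions increase to the indicator of a box, and as products of functions of one
  variable each they are themselves Jacobian determinants.\<close>

definition box_tent :: "nat \<Rightarrow> real^'n \<Rightarrow> real^'n \<Rightarrow> real^'n \<Rightarrow> real" where
  "box_tent m l u y = (\<Prod>i\<in>UNIV. min 1 (real m * max 0 (min (y $ i - l $ i) (u $ i - y $ i))))"

lemma continuous_on_box_tent: "continuous_on S (box_tent m l u)"
  unfolding box_tent_def by (intro continuous_intros)

lemma borel_measurable_box_tent [measurable]: "box_tent m l u \<in> borel_measurable borel"
  by (rule borel_measurable_continuous_onI[OF continuous_on_box_tent])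

lemma box_tent_bounds: "0 \<le> box_tent m l u y" "box_tent m l u y \<le> indicator (box l u) y"
proof -
  show "0 \<le> box_tent m l u y" unfolding box_tent_def by (intro prod_nonneg) auto
  show "box_tent m l u y \<le> indicator (box l u) y"
  proof (cases "y \<in> box l u")
    case True
    then show ?thesis unfolding box_tent_def by (simp, intro prod_le_1) auto
  next
    case False
    then obtain i where "\<not> (l $ i < y $ i \<and> y $ i < u $ i)" by (auto simp: mem_box_cart)
    then have "min (y $ i - l $ i) (u $ i - y $ i) \<le> 0" by linarith
    then have "min 1 (real m * max 0 (min (y $ i - l $ i) (u $ i - y $ i))) = 0" by (simp add: max.absorb1)
    then have "box_tent m l u y = 0" unfolding box_tent_def by (intro prod_zero) auto
    then show ?thesis by simp
  qed
qed

lemma box_tent_eq_0: "y \<notin> box l u \<Longrightarrow> box_tent m l u y = 0"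
  using box_tent_bounds[of m l u y] by simp

lemma box_tent_tendsto: "(\<lambda>m. box_tent m l u y) \<longlonglongrightarrow> indicator (box l u) y"
proof (cases "y \<in> box l u")
  case True
  have "(\<lambda>m. box_tent m l u y) \<longlonglongrightarrow> (\<Prod>i\<in>(UNIV::'a set). 1)"
    unfolding box_tent_def
  proof (intro tendsto_prod)
    fix i
    define e where "e = min (y $ i - l $ i) (u $ i - y $ i)"
    have e: "e > 0" using True by (auto simp: e_def mem_box_cart)
    obtain N where N: "real N * e \<ge> 1" using e reals_Archimedean3[of e] by (metis less_imp_le)
    have "eventually (\<lambda>m. min 1 (real m * max 0 e) = 1) sequentially"
      using eventually_ge_at_top[of N]
    proof eventually_elim
      case (elim m)
      then have "real N * e \<le> real m * e" using e by (intro mult_right_mono) auto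
      then have "1 \<le> real m * e" using N by linarith
      then show ?case using e by simp
    qed
    then show "(\<lambda>m. min 1 (real m * max 0 (min (y $ i - l $ i) (u $ i - y $ i)))) \<longlonglongrightarrow> 1"
      unfolding e_def by (rule tendsto_eventually)
  qed
  then show ?thesis using True by simp
qed (simp add: box_tent_eq_0)

text \<open>Take an antiderivative of each one-variable factor as a component of \<Psi>; the
  derivative of \<Psi> is then diagonal.\<close>

lemma box_tent_is_jacobian_det:
  "\<exists>\<Psi>. C1_on UNIV \<Psi> \<and> (\<forall>y. jacobian_det \<Psi> y = box_tent m l u y)" for l :: "real^'n"
proof -
  define b where "b i t = min 1 (real m * max 0 (min (t - l $ i) (u $ i - t)))" for i t
  have cb: "continuous_on UNIV (b i)" for i unfolding b_def by (intro continuous_intros)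
  have "\<exists>B. \<forall>t. (B has_real_derivative b i t) (at t)" for i
  proof -
    obtain B where "\<And>x. - \<infinity> < ereal x \<Longrightarrow> ereal x < \<infinity> \<Longrightarrow> (B has_vector_derivative b i x) (at x)"
      using einterval_antiderivative[of "- \<infinity>" \<infinity> "b i"] cb by (auto simp: continuous_on_eq_continuous_at)
    then show ?thesis by (auto simp: has_real_derivative_iff_has_vector_derivative)
  qed
  then obtain B where B: "\<And>i t. (B i has_real_derivative b i t) (at t)" by metis
  let ?\<Psi> = "\<lambda>y::real^'n. \<chi> i. B i (y $ i)"
  have C: "C1_on UNIV ?\<Psi>"
    by (intro C1_on_vec_lambda C1_on_compose[OF C1_on_vec_nth[OF C1_on_ident] C1_on_real[OF B cb]] subset_UNIV)
  have "jacobian_det ?\<Psi> y = box_tent m l u y" for y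
  proof -
    have "(?\<Psi> has_derivative (\<lambda>h. \<chi> i. b i (y $ i) * h $ i)) (at y)"
    proof (subst has_derivative_componentwise_within, intro ballI)
      fix j :: "real^'n" assume "j \<in> Basis"
      then obtain i where j: "j = axis i 1" by (auto simp: Basis_vec_def)
      have 1: "((\<lambda>y::real^'n. y $ i) has_derivative (\<lambda>h. h $ i)) (at y)"
        by (rule bounded_linear_imp_has_derivative[OF bounded_linear_vec_nth])
      have "(B i has_derivative (*) (b i (y $ i))) (at (y $ i))"
        using B by (simp add: has_field_derivative_def)
      from diff_chain_at[OF 1 this]
      show "((\<lambda>y. ?\<Psi> y \<bullet> j) has_derivative (\<lambda>h. (\<chi> i. b i (y $ i) * h $ i) \<bullet> j)) (at y)"
        by (simp add: j cart_eq_inner_axis[symmetric] o_def)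
    qed
    then have "jacobian_det ?\<Psi> y = det (matrix (\<lambda>h. \<chi> i. b i (y $ i) * h $ i))"
      by (rule jacobian_det_eqI)
    also have "\<dots> = (\<Prod>i\<in>UNIV. matrix (\<lambda>h. \<chi> i. b i (y $ i) * h $ i) $ i $ i)"
      by (rule det_diagonal) (simp add: matrix_def axis_def)
    finally show ?thesis by (simp add: matrix_def axis_def box_tent_def b_def)
  qed
  with C show ?thesis by blast
qed

text \<open>By the chain rule the integrands are the Jacobians of \<Psi> composed with
  \<open>F\<close> and with \<open>G\<close>, and these compositions still agree outside
  \<open>T\<close>.\<close>

lemma integral_box_tent_jacobian_det_eq:
  fixes F G :: "real^'n::finite \<Rightarrow> real^'n"
  assumes \<Omega>: "open \<Omega>" "bounded \<Omega>" and FG: "C1_on UNIV F" "C1_on UNIV G"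
    and T: "compact T" "T \<subseteq> \<Omega>" and eq: "\<And>x. x \<notin> T \<Longrightarrow> F x = G x"
  shows "(LINT x:\<Omega>|lborel. box_tent m l u (F x) * jacobian_det F x)
       = (LINT x:\<Omega>|lborel. box_tent m l u (G x) * jacobian_det G x)"
proof -
  obtain \<Psi> :: "real^'n \<Rightarrow> real^'n" where \<Psi>: "C1_on UNIV \<Psi>" "\<And>y. jacobian_det \<Psi> y = box_tent m l u y"
    using box_tent_is_jacobian_det by blast
  have *: "box_tent m l u (F x) * jacobian_det F x = jacobian_det (\<lambda>x. \<Psi> (F x)) x" if "C1_on UNIV F" for F x
    using that \<Psi> by (subst jacobian_det_compose) (auto intro: C1_on_differentiable)
  show ?thesis unfolding *[OF FG(1)] *[OF FG(2)]
    by (rule integral_jacobian_det_eq[OF \<Omega> _ _ T]) (auto intro!: C1_on_compose[OF _ \<Psi>(1)] FG simp: eq)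
qed

text \<open>The value 1 is attained on an open \<open>W\<close> around \<open>C\<close> and not
  merely on \<open>C\<close>, so that a map glued with \<eta> also has the right derivative at the
  points of \<open>C\<close>.\<close>

lemma C1_cutoff:
  fixes C :: "'a::euclidean_space set"
  assumes C: "compact C" "C \<subseteq> \<Omega>" "open \<Omega>"
  obtains \<eta> W T where "C1_on UNIV \<eta>" "\<And>x. 0 \<le> \<eta> x" "\<And>x. \<eta> x \<le> (1::real)" "open W" "C \<subseteq> W"
    "\<And>x. x \<in> W \<Longrightarrow> \<eta> x = 1" "compact T" "T \<subseteq> \<Omega>" "\<And>x. x \<notin> T \<Longrightarrow> \<eta> x = 0"
proof -
  obtain e where e: "e > 0" "(\<Union>x\<in>C. ball x e) \<subseteq> \<Omega>"
    using compact_subset_open_imp_ball_epsilon_subset[OF C(1,3,2)] by blast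
  \<comment> \<open>Twice this radius is still less than \<open>e\<close>, so the closed balls
    carrying the cutoff stay in \<Omega>.\<close>
  define r where "r = e / 3"
  have r: "r > 0" using e by (simp add: r_def)
  obtain P where P: "P \<subseteq> C" "finite P" "C \<subseteq> (\<Union>p\<in>P. ball p r)"
    using compactE_image[OF C(1), of C "\<lambda>p. ball p r"] r by force
  \<comment> \<open>The quotient is at least 1 on the ball of radius \<open>r\<close> about
    \<open>p\<close> and at most 0 outside the one of radius \<open>2 * r\<close>.\<close>
  define b where "b p x = smooth_step ((4 * r\<^sup>2 - (norm (x - p))\<^sup>2) * (1 / (3 * r\<^sup>2)))" for p x :: 'a
  define \<eta> where "\<eta> x = smooth_step (\<Sum>p\<in>P. b p x)" for x
  have b: "C1_on UNIV (b p)" for p unfolding b_def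
    by (rule C1_on_compose[OF _ C1_on_smooth_step subset_UNIV])
      (intro C1_on_mult C1_on_diff C1_on_const C1_on_norm_square)
  have b1: "b p x = 1" if "x \<in> ball p r" for p x
  proof -
    have "norm (x - p) \<le> r" using that by (simp add: dist_norm norm_minus_commute)
    then have "(norm (x - p))\<^sup>2 \<le> r\<^sup>2" by (intro power_mono) auto
    then have "3 * r\<^sup>2 * (1 / (3 * r\<^sup>2)) \<le> (4 * r\<^sup>2 - (norm (x - p))\<^sup>2) * (1 / (3 * r\<^sup>2))"
      by (intro mult_right_mono) auto
    then show ?thesis using r unfolding b_def by (intro smooth_step_simps) simp
  qed
  have b0: "b p x = 0" if "x \<notin> cball p (2*r)" for p x
  proof -
    have "(2 * r)\<^sup>2 \<le> (norm (x - p))\<^sup>2" using that r by (intro power_mono) (auto simp: dist_norm norm_minus_commute)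
    then show ?thesis using r unfolding b_def
      by (intro smooth_step_simps) (simp add: power_mult_distrib divide_nonpos_pos)
  qed
  have b_nonneg: "0 \<le> b p x" for p x by (simp add: b_def smooth_step_bounds)
  show thesis
  proof (rule that[of \<eta> "\<Union>p\<in>P. ball p r" "\<Union>p\<in>P. cball p (2*r)"])
    show "C1_on UNIV \<eta>" unfolding \<eta>_def
      by (intro C1_on_compose[OF _ C1_on_smooth_step] C1_on_sum b subset_UNIV)
    show "\<eta> x = 1" if x: "x \<in> (\<Union>p\<in>P. ball p r)" for x
    proof -
      obtain p where p: "p \<in> P" "x \<in> ball p r" using x by blast
      have "b p x \<le> (\<Sum>p\<in>P. b p x)" using P(2) p(1) b_nonneg by (intro member_le_sum) auto
      then show ?thesis unfolding \<eta>_def using b1[OF p(2)] by simp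
    qed
    show "compact (\<Union>p\<in>P. cball p (2*r))" using P by (intro compact_UN) auto
    show "(\<Union>p\<in>P. cball p (2*r)) \<subseteq> \<Omega>"
    proof
      fix x assume "x \<in> (\<Union>p\<in>P. cball p (2*r))"
      then obtain p where "p \<in> C" "x \<in> ball p e" using P r by (force simp: r_def)
      then show "x \<in> \<Omega>" using e by blast
    qed
    show "\<eta> x = 0" if "x \<notin> (\<Union>p\<in>P. cball p (2*r))" for x
      unfolding \<eta>_def using that b0 by (intro smooth_step_simps(1)) (auto intro!: sum_nonpos)
  qed (use P in \<open>auto simp: \<eta>_def smooth_step_bounds\<close>)
qed

text \<open>A map \<open>w\<close> on the whole space is glued from \<open>u\<close> in the interior
  and \<open>g\<close> near the boundary. It differs from \<open>g\<close> only inside a compact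
  subset of \<Omega>, so both give the same integral. It differs from \<open>u\<close> only at
  points whose whole segment from \<open>g x\<close> to \<open>u x\<close> avoids the support of the
  test function, so neither integrand sees the difference.\<close>

lemma integral_box_tent_homotopy:
  fixes u g :: "real^'n::finite \<Rightarrow> real^'n"
  assumes \<Omega>: "open \<Omega>" "bounded \<Omega>" and u: "continuous_on (closure \<Omega>) u" "C1_on \<Omega> u" and g: "C1_on UNIV g"
    and y: "\<And>x. x \<in> frontier \<Omega> \<Longrightarrow> y \<notin> closed_segment (g x) (u x)"
  obtains \<epsilon> where "\<epsilon> > 0" "\<And>m l r. box l r \<subseteq> ball y \<epsilon> \<Longrightarrow>
      (LINT x:\<Omega>|lborel. box_tent m l r (u x) * jacobian_det u x)
        = (LINT x:\<Omega>|lborel. box_tent m l r (g x) * jacobian_det g x)"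
proof -
  let ?H = "\<lambda>p. (1 - fst p) *\<^sub>R g (snd p) + fst p *\<^sub>R u (snd p)"
  have cg: "continuous_on S g" for S using C1_on_imp_continuous_on[OF g] continuous_on_subset by blast
  have cH: "continuous_on ({0..1} \<times> closure \<Omega>) ?H"
    by (intro continuous_intros continuous_on_compose2[OF u(1)] continuous_on_compose2[OF cg[of UNIV]]) auto
  have cpt: "compact (frontier \<Omega>)" "compact (closure \<Omega>)" using \<Omega> by (auto simp: compact_frontier_bounded)
  have fr: "frontier \<Omega> = closure \<Omega> - \<Omega>" using \<Omega> by (simp add: frontier_def interior_open)
  have "compact (?H ` ({0..1} \<times> frontier \<Omega>))"
    by (intro compact_continuous_image compact_Times cpt continuous_on_subset[OF cH]) (auto simp: fr)
  moreover have "y \<notin> ?H ` ({0..1} \<times> frontier \<Omega>)"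
    using y by (force simp: closed_segment_def)
  ultimately obtain e where e: "e > 0" "ball y e \<inter> ?H ` ({0..1} \<times> frontier \<Omega>) = {}"
    using compact_imp_closed[of "?H ` ({0..1} \<times> frontier \<Omega>)"] open_contains_ball[of "- (?H ` ({0..1} \<times> frontier \<Omega>))"]
    unfolding closed_def disjoint_eq_subset_Compl by blast
  \<comment> \<open>Pairs of a time and a point at which the straight homotopy comes within
    \<open>e / 2\<close> of \<open>y\<close>. Non-strict inequalities make \<open>Z\<close>, and
    hence its projection \<open>C\<close>, compact; on the frontier the homotopy keeps distance
    \<open>e\<close>, so \<open>C\<close> lies inside \<Omega>.\<close>
  define Z where "Z = {p \<in> {0..1} \<times> closure \<Omega>. dist y (?H p) \<le> e / 2}"
  define C where "C = snd ` Z"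
  have "closed Z" unfolding Z_def
  proof -
    have "{p \<in> {0..1} \<times> closure \<Omega>. dist y (?H p) \<le> e / 2} = ({0..1} \<times> closure \<Omega>) \<inter> (\<lambda>p. dist y (?H p)) -` {..e/2}" by auto
    also have "closed \<dots>" by (intro continuous_closed_preimage continuous_intros cH closed_Times) auto
    finally show "closed {p \<in> {0..1} \<times> closure \<Omega>. dist y (?H p) \<le> e / 2}" .
  qed
  moreover have "Z \<subseteq> {0..1} \<times> closure \<Omega>" by (auto simp: Z_def)
  ultimately have "compact Z"
    using compact_Int_closed[OF compact_Times[OF compact_Icc cpt(2)], of Z 0 1] by (simp add: Int_absorb1)
  then have C: "compact C" unfolding C_def by (intro compact_continuous_image continuous_intros)
  have C\<Omega>: "C \<subseteq> \<Omega>"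
  proof
    fix x assume "x \<in> C"
    then obtain t where t: "t \<in> {0..1}" "x \<in> closure \<Omega>" "dist y (?H (t, x)) \<le> e / 2" by (auto simp: C_def Z_def)
    show "x \<in> \<Omega>"
    proof (rule ccontr)
      assume "x \<notin> \<Omega>"
      then have "?H (t, x) \<in> ?H ` ({0..1} \<times> frontier \<Omega>)" using t by (intro imageI) (auto simp: fr)
      moreover have "?H (t, x) \<in> ball y e" using t e(1) by simp
      ultimately show False using e(2) by blast
    qed
  qed
  obtain \<eta> W T where \<eta>: "C1_on UNIV \<eta>" "\<And>x. 0 \<le> \<eta> x" "\<And>x. \<eta> x \<le> (1::real)" "open W" "C \<subseteq> W"
    "\<And>x. x \<in> W \<Longrightarrow> \<eta> x = 1" "compact T" "T \<subseteq> \<Omega>" "\<And>x. x \<notin> T \<Longrightarrow> \<eta> x = 0"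
    using C1_cutoff[OF C C\<Omega> \<Omega>(1)] by blast
  \<comment> \<open>\<open>u\<close> is controlled only inside \<Omega>, so the formula falls back
    on \<open>g\<close> outside \<open>T\<close>. The two descriptions overlap on open sets that
    cover the space.\<close>
  define w where "w x = (if x \<in> T then (1 - \<eta> x) *\<^sub>R g x + \<eta> x *\<^sub>R u x else g x)" for x
  have w\<Omega>: "w x = (1 - \<eta> x) *\<^sub>R g x + \<eta> x *\<^sub>R u x" if "x \<in> \<Omega>" for x
    using \<eta>(9) by (auto simp: w_def)
  have "C1_on \<Omega> (\<lambda>x. (1 - \<eta> x) *\<^sub>R g x + \<eta> x *\<^sub>R u x)"
    by (intro C1_on_add C1_on_scaleR C1_on_diff C1_on_const u(2) C1_on_subset[OF \<eta>(1)] C1_on_subset[OF g] subset_UNIV)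
  then have "C1_on \<Omega> w" by (rule C1_on_cong[OF _ \<Omega>(1)]) (simp add: w\<Omega>)
  moreover have "C1_on (- T) w"
    by (rule C1_on_cong[OF C1_on_subset[OF g subset_UNIV]]) (use \<eta>(7) in \<open>auto simp: w_def open_Compl compact_imp_closed\<close>)
  ultimately have "C1_on (\<Omega> \<union> - T) w" using \<Omega>(1) \<eta>(7) by (intro C1_on_Un) (auto simp: open_Compl compact_imp_closed)
  moreover have "\<Omega> \<union> - T = UNIV" using \<eta>(8) by auto
  ultimately have w: "C1_on UNIV w" by simp
  show thesis
  proof (rule that[of "e/2"])
    show "e/2 > 0" using e by simp
    fix m l r assume B: "box l r \<subseteq> ball y (e/2)"
    \<comment> \<open>Used with \<open>t = 1\<close> for \<open>u\<close> and with
      \<open>t = \<eta> x\<close> for \<open>w\<close>.\<close>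
    have zero: "box_tent m l r ((1 - t) *\<^sub>R g x + t *\<^sub>R u x) = 0" if "x \<in> \<Omega>" "x \<notin> C" "t \<in> {0..1}" for x t
    proof (rule box_tent_eq_0, rule notI)
      assume "(1 - t) *\<^sub>R g x + t *\<^sub>R u x \<in> box l r"
      then have "(t, x) \<in> Z" using B that closure_subset[of \<Omega>] by (force simp: Z_def)
      then show False using that by (force simp: C_def)
    qed
    have "(LINT x:\<Omega>|lborel. box_tent m l r (u x) * jacobian_det u x) = (LINT x:\<Omega>|lborel. box_tent m l r (w x) * jacobian_det w x)"
    proof (rule set_lebesgue_integral_cong)
      show "\<Omega> \<in> sets lborel" using \<Omega> by simp
      show "\<forall>x. x \<in> \<Omega> \<longrightarrow> box_tent m l r (u x) * jacobian_det u x = box_tent m l r (w x) * jacobian_det w x"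
      proof (intro allI impI)
        fix x assume x: "x \<in> \<Omega>"
        show "box_tent m l r (u x) * jacobian_det u x = box_tent m l r (w x) * jacobian_det w x"
        proof (cases "x \<in> C")
          case True
          have "jacobian_det u x = jacobian_det w x"
            by (rule jacobian_det_cong[of "W \<inter> \<Omega>"]) (use \<eta> \<Omega> x True in \<open>auto simp: w\<Omega>\<close>)
          then show ?thesis using \<eta> True x by (auto simp: w\<Omega>)
        next
          case False
          then show ?thesis using zero[OF x False, of 1] zero[OF x False, of "\<eta> x"] \<eta>(2,3) x by (simp add: w\<Omega>)
        qed
      qed
    qed
    also have "\<dots> = (LINT x:\<Omega>|lborel. box_tent m l r (g x) * jacobian_det g x)"
      by (rule integral_box_tent_jacobian_det_eq[OF \<Omega> w g \<eta>(7,8)]) (simp add: w_def)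
    finally show "(LINT x:\<Omega>|lborel. box_tent m l r (u x) * jacobian_det u x) = (LINT x:\<Omega>|lborel. box_tent m l r (g x) * jacobian_det g x)" .
  qed
qed

section \<open>Regular values\<close>

text \<open>The inverse function theorem, with the neighbourhood shrunk to where the Jacobian keeps
  its sign. The signs serve the count of preimages; the differentiable inverse serves to pull back
  null sets.\<close>

lemma C1_local_diffeomorphism:
  fixes g :: "real^'n::finite \<Rightarrow> real^'n"
  assumes U: "open U" "C1_on U g" and x: "x \<in> U" "jacobian_det g x \<noteq> 0"
  obtains V h where "open V" "V \<subseteq> U" "x \<in> V" "inj_on g V" "open (g ` V)"
    "\<And>z. z \<in> V \<Longrightarrow> sgn (jacobian_det g z) = sgn (jacobian_det g x)"
    "\<And>z. z \<in> V \<Longrightarrow> h (g z) = z" "h differentiable_on (g ` V)"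
proof -
  obtain F where F: "\<And>x. x \<in> U \<Longrightarrow> (g has_derivative blinfun_apply (F x)) (at x)" "continuous_on U F"
    using U(2) unfolding C1_on_def by blast
  have lin: "linear (blinfun_apply (F x))" by (rule bounded_linear.linear[OF blinfun.bounded_linear_right])
  have "det (matrix (blinfun_apply (F x))) \<noteq> 0" using jacobian_det_eqI[OF F(1)[OF x(1)]] x(2) by simp
  then have "inj (blinfun_apply (F x))" using det_nz_iff_inj[OF lin] by simp
  then obtain G where G: "linear G" "G \<circ> blinfun_apply (F x) = id"
    using linear_injective_left_inverse[OF lin] by blast
  have inv: "Blinfun G o\<^sub>L F x = id_blinfun"
    using G by (intro blinfun_eqI)
      (simp add: bounded_linear_Blinfun_apply linear_conv_bounded_linear[symmetric] fun_eq_iff)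
  obtain U' V' h h' where h: "open U'" "U' \<subseteq> U" "x \<in> U'" "open V'" "g x \<in> V'" "homeomorphism U' V' g h"
    "\<And>y. y \<in> V' \<Longrightarrow> (h has_derivative (h' y)) (at y)"
    by (rule inverse_function_theorem[OF U(1) F x(1) inv]) blast+
  define V where "V = U' \<inter> (\<lambda>z. jacobian_det g x * jacobian_det g z) -` {0<..}"
  have cont: "continuous_on U' (jacobian_det g)"
    by (intro continuous_on_jacobian_det C1_on_subset[OF U(2) h(2)])
  have V: "open V" unfolding V_def
    by (intro continuous_open_preimage continuous_intros cont h(1))
  have hg: "h (g z) = z" if "z \<in> U'" for z using h(6) that by (simp add: homeomorphism_def)
  have inj: "inj_on g V" using hg by (intro inj_on_inverseI[of V h]) (auto simp: V_def)
  have sub: "g ` V \<subseteq> V'" using h(6) by (auto simp: V_def homeomorphism_def)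
  show thesis
  proof (rule that[OF V _ _ inj])
    show "V \<subseteq> U" using h(2) by (auto simp: V_def)
    show "x \<in> V" using h(3) x(2) by (auto simp: V_def zero_less_mult_iff)
    show "open (g ` V)"
      using C1_on_imp_continuous_on[OF C1_on_subset[OF U(2) \<open>V \<subseteq> U\<close>]] V inj by (rule invariance_of_domain)
    show "sgn (jacobian_det g z) = sgn (jacobian_det g x)" if "z \<in> V" for z
      using that by (auto simp: V_def zero_less_mult_iff)
    show "h (g z) = z" if "z \<in> V" for z using that hg by (simp add: V_def)
    show "h differentiable_on (g ` V)"
      using h(7) sub by (meson differentiable_at_withinI differentiable_def differentiable_on_def subsetD)
  qed
qed

text \<open>Near each of its points the set lies in the image of a piece of \<open>N\<close> under a
  differentiable local inverse, and negligibility may be checked locally. With \<open>N\<close> the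
  image of the boundary, this shows that the points lying over it do not contribute to Jacobian
  integrals.\<close>

lemma negligible_noncritical_preimage:
  fixes w :: "real^'n::finite \<Rightarrow> real^'n"
  assumes \<Omega>: "open \<Omega>" "C1_on \<Omega> w" and N: "negligible N"
  shows "negligible {x \<in> \<Omega>. w x \<in> N \<and> jacobian_det w x \<noteq> 0}" (is "negligible ?Z")
proof (subst locally_negligible_alt, intro ballI)
  fix x assume x: "x \<in> ?Z"
  have x': "x \<in> \<Omega>" "jacobian_det w x \<noteq> 0" using x by auto
  obtain V h where V: "open V" "V \<subseteq> \<Omega>" "x \<in> V" "inj_on w V" "open (w ` V)"
    "\<And>z. z \<in> V \<Longrightarrow> sgn (jacobian_det w z) = sgn (jacobian_det w x)"
    "\<And>z. z \<in> V \<Longrightarrow> h (w z) = z" "h differentiable_on (w ` V)"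
    by (rule C1_local_diffeomorphism[OF \<Omega> x']) blast
  have "negligible (h ` (N \<inter> w ` V))"
    using N V(8) by (intro negligible_differentiable_image_negligible)
      (auto intro: negligible_subset differentiable_on_subset)
  moreover have "?Z \<inter> V \<subseteq> h ` (N \<inter> w ` V)" using V(7) by force
  ultimately have "negligible (?Z \<inter> V)" by (rule negligible_subset)
  then show "\<exists>U. openin (top_of_set ?Z) U \<and> x \<in> U \<and> negligible U"
    using x V(1,3) by (intro exI[of _ "?Z \<inter> V"]) (auto simp: openin_open)
qed

text \<open>Over a small ball about a regular value the preimage is a finite stack of disjoint
  sheets, each mapped injectively and with constant sign of the Jacobian. Every value in the ball is
  taken once on each sheet, and the integral is obtained by changing variables sheet by
  sheet.\<close>

lemma regular_value_local_count:
  fixes g :: "real^'n::finite \<Rightarrow> real^'n"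
  assumes \<Omega>: "open \<Omega>" "bounded \<Omega>" and g: "C1_on UNIV g" and fr: "y \<notin> g ` frontier \<Omega>"
    and reg: "\<And>x. x \<in> \<Omega> \<Longrightarrow> g x = y \<Longrightarrow> jacobian_det g x \<noteq> 0"
  defines "k \<equiv> (\<Sum>x | x \<in> \<Omega> \<and> g x = y. sgn (jacobian_det g x))"
  obtains \<epsilon> where "\<epsilon> > 0" "finite {x \<in> \<Omega>. g x = y}"
    "\<And>y'. y' \<in> ball y \<epsilon> \<Longrightarrow> (\<Sum>x | x \<in> \<Omega> \<and> g x = y'. sgn (jacobian_det g x)) = k"
    "\<And>y' x. y' \<in> ball y \<epsilon> \<Longrightarrow> x \<in> \<Omega> \<Longrightarrow> g x = y' \<Longrightarrow> jacobian_det g x \<noteq> 0"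
    "\<And>\<phi>. integrable lborel \<phi> \<Longrightarrow> \<phi> \<in> borel_measurable borel \<Longrightarrow> (\<And>z. z \<notin> ball y \<epsilon> \<Longrightarrow> \<phi> z = 0) \<Longrightarrow>
       (LINT x:\<Omega>|lborel. \<phi> (g x) * jacobian_det g x) = k * (LINT z|lborel. \<phi> z)"
proof -
  define S where "S = {x \<in> \<Omega>. g x = y}"
  have fr\<Omega>: "frontier \<Omega> = closure \<Omega> - \<Omega>" using \<Omega> by (simp add: frontier_def interior_open)
  have cg: "continuous_on A g" for A using C1_on_imp_continuous_on[OF g] continuous_on_subset by blast
  have cptK: "compact (closure \<Omega>)" using \<Omega> by simp
  have "\<exists>V. open V \<and> V \<subseteq> \<Omega> \<and> x \<in> V \<and> inj_on g V \<and> open (g ` V)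
    \<and> (\<forall>z\<in>V. sgn (jacobian_det g z) = sgn (jacobian_det g x))" if "x \<in> S" for x
  proof -
    have x: "x \<in> \<Omega>" "jacobian_det g x \<noteq> 0" using that reg by (auto simp: S_def)
    show ?thesis
      by (rule C1_local_diffeomorphism[OF \<Omega>(1) C1_on_subset[OF g subset_UNIV] x]) blast
  qed
  then obtain V where V: "\<And>x. x \<in> S \<Longrightarrow> open (V x) \<and> V x \<subseteq> \<Omega> \<and> x \<in> V x \<and> inj_on g (V x)
    \<and> (\<forall>z\<in>V x. sgn (jacobian_det g z) = sgn (jacobian_det g x))" by metis
  have finS: "finite S"
  proof -
    \<comment> \<open>No point of the frontier is mapped to \<open>y\<close>, so the fibre is closed
      in the compact closure.\<close>
    have "S = closure \<Omega> \<inter> g -` {y}" using fr closure_subset by (auto simp: S_def fr\<Omega>)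
    then have "compact S"
      using compact_Int_closed[OF cptK continuous_closed_preimage[OF cg, of "closure \<Omega>" "{y}"]] by simp
    then obtain S' where S': "S' \<subseteq> S" "finite S'" "S \<subseteq> (\<Union>x\<in>S'. V x)"
      using compactE_image[of S S V] V by blast
    \<comment> \<open>Injectivity of \<open>g\<close> on \<open>V z\<close> leaves room for only one
      point of the fibre there.\<close>
    have "S \<subseteq> S'"
    proof
      fix x assume x: "x \<in> S"
      then obtain z where z: "z \<in> S'" "x \<in> V z" using S' by blast
      then have "x = z" using V[of z] S'(1) x by (auto simp: S_def inj_on_def)
      then show "x \<in> S'" using z by simp
    qed
    then show ?thesis using S'(2) finite_subset by blast
  qed
  have "\<exists>d>0. \<forall>x\<in>S. x \<noteq> a \<longrightarrow> d \<le> dist a x" for a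
    using finite_set_avoid[OF finS] by blast
  then obtain \<delta> where \<delta>: "\<And>a. \<delta> a > 0" "\<And>a x. x \<in> S \<Longrightarrow> x \<noteq> a \<Longrightarrow> \<delta> a \<le> dist a x" by metis
  \<comment> \<open>Half the distance to the other points of the fibre keeps the sheets
    disjoint.\<close>
  define V' where "V' x = V x \<inter> ball x (\<delta> x / 2)" for x
  have V': "open (V' x)" "V' x \<subseteq> \<Omega>" "x \<in> V' x" "inj_on g (V' x)"
    "\<And>z. z \<in> V' x \<Longrightarrow> sgn (jacobian_det g z) = sgn (jacobian_det g x)" if "x \<in> S" for x
  proof -
    show "inj_on g (V' x)" by (rule inj_on_subset[of g "V x"]) (use V[OF that] in \<open>unfold V'_def, blast+\<close>)
    show "open (V' x)" unfolding V'_def using V[OF that] by (intro open_Int open_ball) blast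
    show "V' x \<subseteq> \<Omega>" unfolding V'_def using V[OF that] by blast
    show "x \<in> V' x" unfolding V'_def using conjunct1[OF conjunct2[OF conjunct2[OF V[OF that]]]] \<delta>(1)[of x] by simp
    show "sgn (jacobian_det g z) = sgn (jacobian_det g x)" if "z \<in> V' x" for z
      using V[OF \<open>x \<in> S\<close>] \<open>z \<in> V' x\<close> unfolding V'_def by blast
  qed
  have gV': "open (g ` V' x)" if "x \<in> S" for x
    using invariance_of_domain[OF cg V'(1,4)] that by blast
  have disj: "x = x'" if x: "x \<in> S" "x' \<in> S" "z \<in> V' x" "z \<in> V' x'" for x x' z
  proof (rule ccontr)
    assume ne: "x \<noteq> x'"
    have "dist x x' < \<delta> x / 2 + \<delta> x' / 2"
      using x(3,4) dist_triangle2[of x x' z] by (auto simp: V'_def)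
    moreover have "\<delta> x \<le> dist x x'" "\<delta> x' \<le> dist x x'"
      using \<delta>(2)[of x' x] \<delta>(2)[of x x'] x ne by (auto simp: dist_commute)
    ultimately show False by linarith
  qed
  \<comment> \<open>What the sheets leave over is compact and misses \<open>y\<close>, so a ball
    about \<open>y\<close> misses its image: no preimages appear away from the sheets.\<close>
  define K' where "K' = closure \<Omega> - (\<Union>x\<in>S. V' x)"
  have "compact K'" unfolding K'_def using cptK V'(1) by (intro compact_diff open_UN) auto
  then have "closed (g ` K')" using compact_continuous_image[OF cg] compact_imp_closed by blast
  moreover have ynot: "y \<notin> g ` K'"
    using fr V'(3) by (auto simp: K'_def fr\<Omega> S_def)
  moreover have "open (\<Inter>x\<in>S. g ` V' x)" using finS gV' by (intro open_INT) auto
  ultimately have "open ((\<Inter>x\<in>S. g ` V' x) - g ` K')" by blast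
  moreover have "y \<in> (\<Inter>x\<in>S. g ` V' x) - g ` K'" using V'(3) ynot by (force simp: S_def)
  ultimately obtain \<epsilon> where \<epsilon>: "\<epsilon> > 0" "ball y \<epsilon> \<subseteq> (\<Inter>x\<in>S. g ` V' x) - g ` K'"
    by (rule openE) (rule that)
  have loc: "\<exists>x\<in>S. z \<in> V' x" if "z \<in> \<Omega>" "g z \<in> ball y \<epsilon>" for z
  proof (rule ccontr)
    assume "\<not> ?thesis"
    then have "z \<in> K'" unfolding K'_def using that(1) closure_subset[of \<Omega>] by blast
    then show False using that(2) \<epsilon>(2) by blast
  qed
  show thesis
  proof (rule that[OF \<epsilon>(1)])
    show "finite {x \<in> \<Omega>. g x = y}" using finS by (simp add: S_def)
    fix y' assume y': "y' \<in> ball y \<epsilon>"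
    define \<zeta> where "\<zeta> x = the_inv_into (V' x) g y'" for x
    have \<zeta>: "\<zeta> x \<in> V' x" "g (\<zeta> x) = y'" if "x \<in> S" for x
    proof -
      have "y' \<in> g ` V' x" using \<epsilon>(2) y' that by blast
      then show "\<zeta> x \<in> V' x" "g (\<zeta> x) = y'" unfolding \<zeta>_def
        using V'(4)[OF that] by (auto intro: the_inv_into_into f_the_inv_into_f)
    qed
    have im: "{x \<in> \<Omega>. g x = y'} = \<zeta> ` S"
    proof (intro equalityI subsetI)
      fix z assume z: "z \<in> {x \<in> \<Omega>. g x = y'}"
      then obtain x where x: "x \<in> S" "z \<in> V' x" using loc y' by blast
      then have "z = \<zeta> x" using \<zeta>[OF x(1)] V'(4)[OF x(1)] z by (auto simp: inj_on_def)
      then show "z \<in> \<zeta> ` S" using x by blast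
    qed (use \<zeta> V'(2) in blast)
    have "inj_on \<zeta> S" proof (rule inj_onI)
      fix x x' assume "x \<in> S" "x' \<in> S" "\<zeta> x = \<zeta> x'"
      then show "x = x'" using disj[of x x' "\<zeta> x"] \<zeta>(1)[of x] \<zeta>(1)[of x'] by simp
    qed
    then show "(\<Sum>x | x \<in> \<Omega> \<and> g x = y'. sgn (jacobian_det g x)) = k"
      unfolding k_def im S_def[symmetric] by (auto simp: sum.reindex intro!: sum.cong V'(5) \<zeta>(1))
    show "jacobian_det g x \<noteq> 0" if "x \<in> \<Omega>" "g x = y'" for x
    proof -
      obtain s where s: "s \<in> S" "x \<in> V' s" using loc \<open>x \<in> \<Omega>\<close> \<open>g x = y'\<close> y' by blast
      then have "sgn (jacobian_det g x) \<noteq> 0" using V'(5)[OF s] reg by (auto simp: S_def sgn_zero_iff)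
      then show ?thesis by auto
    qed
  next
    fix \<phi> :: "real^'n \<Rightarrow> real"
    assume \<phi>: "integrable lborel \<phi>" "\<phi> \<in> borel_measurable borel" "\<And>z. z \<notin> ball y \<epsilon> \<Longrightarrow> \<phi> z = 0"
    have mJ: "jacobian_det g \<in> borel_measurable borel" "g \<in> borel_measurable borel"
      using continuous_on_jacobian_det[OF g] cg by (auto intro: borel_measurable_continuous_onI)
    have cov: "integrable lborel (\<lambda>z. indicator (V' x) z * (\<bar>jacobian_det g z\<bar> * \<phi> (g z)))"
      "(LINT z|lborel. indicator (V' x) z * (\<bar>jacobian_det g z\<bar> * \<phi> (g z))) = (LINT z|lborel. \<phi> z)" if x: "x \<in> S" for x
    proof -
      have e: "(\<lambda>z. indicator (g ` V' x) z * \<phi> z) = \<phi>"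
      proof
        fix z
        have "z \<in> g ` V' x \<or> \<phi> z = 0" using \<epsilon>(2) x \<phi>(3)[of z] by blast
        then show "indicator (g ` V' x) z * \<phi> z = \<phi> z" by (elim disjE) simp_all
      qed
      have [measurable]: "V' x \<in> sets borel" using V'(1)[OF x] by (rule borel_open)
      note [measurable] = mJ \<phi>(2)
      have "(\<lambda>z. indicator (V' x) z * (\<bar>jacobian_det g z\<bar> * \<phi> (g z))) \<in> borel_measurable borel"
        by measurable
      then have m: "(\<lambda>z. indicator (V' x) z * (\<bar>det (matrix (frechet_derivative g (at z)))\<bar> * \<phi> (g z))) \<in> borel_measurable borel"
        by (simp only: jacobian_det_def)
      note c = change_of_variables_open[where g = g and g' = "\<lambda>z. frechet_derivative g (at z)", OF V'(1)[OF x] C1_on_frechet[OF g UNIV_I] V'(4)[OF x] \<phi>(2) m]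
      show "integrable lborel (\<lambda>z. indicator (V' x) z * (\<bar>jacobian_det g z\<bar> * \<phi> (g z)))"
        using c(1) \<phi>(1) unfolding e jacobian_det_def by simp
      show "(LINT z|lborel. indicator (V' x) z * (\<bar>jacobian_det g z\<bar> * \<phi> (g z))) = (LINT z|lborel. \<phi> z)"
        using c(2) unfolding e jacobian_det_def .
    qed
    \<comment> \<open>At most one summand is nonzero, and there the constant sign times the absolute
      value restores the Jacobian.\<close>
    have pt: "indicator \<Omega> z * (\<phi> (g z) * jacobian_det g z)
      = (\<Sum>x\<in>S. sgn (jacobian_det g x) * (indicator (V' x) z * (\<bar>jacobian_det g z\<bar> * \<phi> (g z))))" for z
    proof (cases "z \<in> \<Omega> \<and> g z \<in> ball y \<epsilon>")
      case True
      then obtain x where x: "x \<in> S" "z \<in> V' x" using loc by blast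
      have "(\<Sum>x\<in>S. sgn (jacobian_det g x) * (indicator (V' x) z * (\<bar>jacobian_det g z\<bar> * \<phi> (g z))))
          = (\<Sum>x'\<in>{x}. sgn (jacobian_det g x') * (indicator (V' x') z * (\<bar>jacobian_det g z\<bar> * \<phi> (g z))))"
        using finS x disj by (intro sum.mono_neutral_right) (auto simp: indicator_def)
      also have "\<dots> = \<phi> (g z) * (sgn (jacobian_det g z) * \<bar>jacobian_det g z\<bar>)"
        using x V'(5)[OF x] by simp
      finally show ?thesis using True by (simp add: sgn_mult_abs)
    next
      case False
      then have z: "z \<notin> \<Omega> \<or> \<phi> (g z) = 0" using \<phi>(3) by blast
      have "sgn (jacobian_det g x) * (indicator (V' x) z * (\<bar>jacobian_det g z\<bar> * \<phi> (g z))) = 0" if "x \<in> S" for x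
        using z V'(2)[OF that] by (auto simp: indicator_def)
      then have "(\<Sum>x\<in>S. sgn (jacobian_det g x) * (indicator (V' x) z * (\<bar>jacobian_det g z\<bar> * \<phi> (g z)))) = 0"
        by (intro sum.neutral ballI)
      moreover have "indicator \<Omega> z * (\<phi> (g z) * jacobian_det g z) = 0" using z by auto
      ultimately show ?thesis by simp
    qed
    have "(LINT x:\<Omega>|lborel. \<phi> (g x) * jacobian_det g x)
        = (\<Sum>x\<in>S. sgn (jacobian_det g x) * (LINT z|lborel. indicator (V' x) z * (\<bar>jacobian_det g z\<bar> * \<phi> (g z))))"
      unfolding set_lebesgue_integral_def real_scaleR_def pt
      by (subst Bochner_Integration.integral_sum, rule integrable_mult_right, erule cov(1),
          intro sum.cong refl integral_mult_right_zero)
    also have "\<dots> = k * (LINT z|lborel. \<phi> z)"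
      using cov(2) by (simp add: k_def S_def sum_distrib_right)
    finally show "(LINT x:\<Omega>|lborel. \<phi> (g x) * jacobian_det g x) = k * (LINT z|lborel. \<phi> z)" .
  qed
qed

section \<open>Polynomial approximants with a prescribed regular value\<close>

lemma real_polynomial_function_gradient:
  fixes f :: "'a::euclidean_space \<Rightarrow> real"
  assumes "real_polynomial_function f"
  shows "\<exists>G. C1_on UNIV G \<and> (\<forall>x. (f has_derivative (\<lambda>h. G x \<bullet> h)) (at x))"
  using assms
proof (induction rule: real_polynomial_function.induct)
  case (linear f)
  have "adjoint f 1 \<bullet> h = f h" for h
    using adjoint_works[OF bounded_linear.linear[OF linear], of h 1] by (simp add: inner_commute)
  then show ?case using bounded_linear_imp_has_derivative[OF linear]
    by (intro exI[of _ "\<lambda>x. adjoint f 1"]) simp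
next
  case (const c)
  show ?case by (intro exI[of _ "\<lambda>x. 0"]) simp
next
  case (add f g)
  then obtain F G where "C1_on UNIV F" "\<And>x. (f has_derivative (\<lambda>h. F x \<bullet> h)) (at x)"
    "C1_on UNIV G" "\<And>x. (g has_derivative (\<lambda>h. G x \<bullet> h)) (at x)" by blast
  then show ?case
    by (intro exI[of _ "\<lambda>x. F x + G x"]) (auto simp: inner_add_left intro!: C1_on_add has_derivative_add)
next
  case (mult f g)
  then obtain F G where F: "C1_on UNIV F" "\<And>x. (f has_derivative (\<lambda>h. F x \<bullet> h)) (at x)"
    and G: "C1_on UNIV G" "\<And>x. (g has_derivative (\<lambda>h. G x \<bullet> h)) (at x)" by blast
  have f: "C1_on UNIV f" and g: "C1_on UNIV g"
    using F G C1_on_imp_continuous_on by (auto intro!: C1_onI continuous_intros)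
  have "((\<lambda>x. f x * g x) has_derivative (\<lambda>h. (f x *\<^sub>R G x + g x *\<^sub>R F x) \<bullet> h)) (at x)" for x
  proof -
    have "((\<lambda>x. f x * g x) has_derivative (\<lambda>h. f x * (G x \<bullet> h) + F x \<bullet> h * g x)) (at x)"
      by (rule has_derivative_mult[OF F(2) G(2)])
    then show ?thesis by (simp add: inner_add_left mult.commute)
  qed
  moreover have "C1_on UNIV (\<lambda>x. f x *\<^sub>R G x + g x *\<^sub>R F x)"
    by (intro C1_on_add C1_on_scaleR f g F G)
  ultimately show ?case by blast
qed

lemma polynomial_function_C2_map:
  fixes g :: "real^'n::finite \<Rightarrow> real^'n"
  assumes "polynomial_function g" shows "C2_map g"
proof -
  have "real_polynomial_function (\<lambda>x. g x $ i)" for i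
    using assms bounded_linear_vec_nth[of i] unfolding polynomial_function_def o_def by blast
  then have "\<exists>G. C1_on UNIV G \<and> (\<forall>x. ((\<lambda>x. g x $ i) has_derivative (\<lambda>h. G x \<bullet> h)) (at x))" for i
    by (rule real_polynomial_function_gradient)
  then obtain G where "\<forall>i. C1_on UNIV (G i) \<and> (\<forall>x. ((\<lambda>x. g x $ i) has_derivative (\<lambda>h. G i x \<bullet> h)) (at x))"
    using choice[of "\<lambda>i G. C1_on UNIV G \<and> (\<forall>x. ((\<lambda>x. g x $ i) has_derivative (\<lambda>h. G x \<bullet> h)) (at x))"] by blast
  then have G: "\<And>i. C1_on UNIV (G i)" "\<And>i x. ((\<lambda>x. g x $ i) has_derivative (\<lambda>h. G i x \<bullet> h)) (at x)"
    by blast+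
  \<comment> \<open>\<open>L i\<close> turns the gradient of the \<open>i\<close>-th component into
    its share of the derivative of \<open>g\<close>. It is linear in the gradient, so the
    operator-valued derivative inherits C^1 regularity from the gradients.\<close>
  define L where "L i a = Blinfun (\<lambda>h. (a \<bullet> h) *\<^sub>R (axis i 1 :: real^'n))" for i and a :: "real^'n"
  have L: "blinfun_apply (L i a) h = (a \<bullet> h) *\<^sub>R axis i 1" for i a h
    unfolding L_def by (subst bounded_linear_Blinfun_apply)
      (auto intro: bounded_linear_compose[OF bounded_linear_scaleR_left bounded_linear_inner_right])
  have "linear (L i)" for i
    by (rule linearI) (auto intro!: blinfun_eqI simp: L plus_blinfun.rep_eq scaleR_blinfun.rep_eq inner_add_left scaleR_left_distrib)
  then have bL: "bounded_linear (L i)" for i by (simp add: linear_linear)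
  let ?g' = "\<lambda>x. \<Sum>i\<in>UNIV. L i (G i x)"
  have "(g has_derivative blinfun_apply (?g' x)) (at x)" for x
  proof -
    have "((\<lambda>x. \<Sum>i\<in>UNIV. g x $ i *\<^sub>R axis i 1) has_derivative (\<lambda>h. \<Sum>i\<in>UNIV. (G i x \<bullet> h) *\<^sub>R (axis i 1 :: real^'n))) (at x)"
      by (intro has_derivative_sum has_derivative_scaleR_left G)
    moreover have "(\<Sum>i\<in>UNIV. g x $ i *\<^sub>R axis i 1) = g x" for x
      using basis_expansion[of "g x"] by (simp add: scalar_mult_eq_scaleR)
    moreover have "(\<lambda>h. \<Sum>i\<in>UNIV. (G i x \<bullet> h) *\<^sub>R (axis i 1 :: real^'n)) = blinfun_apply (?g' x)"
      by (simp add: blinfun.sum_left L fun_eq_iff)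
    ultimately show ?thesis by simp
  qed
  moreover have "C1_map ?g'" unfolding C1_map_eq_C1_on
    by (intro C1_on_sum C1_on_compose[OF G(1) C1_on_bounded_linear[OF bL] subset_UNIV])
  ultimately show ?thesis unfolding C2_map_def by (intro exI[of _ ?g'] conjI allI)
qed

lemma C2_map_imp_C1_on: "C2_map g \<Longrightarrow> C1_on S g"
proof -
  assume "C2_map g"
  then obtain g' where g': "\<And>x. (g has_derivative blinfun_apply (g' x)) (at x)" "C1_map g'"
    unfolding C2_map_def by blast
  then have "C1_on UNIV g"
    unfolding C1_on_def using C1_on_imp_continuous_on[of UNIV g'] by (auto simp: C1_map_eq_C1_on)
  then show "C1_on S g" by (rule C1_on_subset) simp
qed

text \<open>Stone-Weierstrass gives a polynomial map; by Sard's theorem it has regular values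
  \<open>y1\<close> arbitrarily close to \<open>y\<close>.\<close>

lemma regular_C2_approximation:
  fixes f :: "real^'n::finite \<Rightarrow> real^'n"
  assumes \<Omega>: "bounded \<Omega>" and f: "continuous_on (closure \<Omega>) f" and \<rho>: "\<rho> > 0"
  obtains g where "C2_map g" "\<And>x. x \<in> closure \<Omega> \<Longrightarrow> dist (g x) (f x) < \<rho>"
    "\<And>x. g x = y \<Longrightarrow> jacobian_det g x \<noteq> 0"
proof -
  obtain p where p: "polynomial_function p" "\<And>x. x \<in> closure \<Omega> \<Longrightarrow> norm (f x - p x) < \<rho> / 2"
    using Stone_Weierstrass_polynomial_function[of "closure \<Omega>" f "\<rho>/2"] \<Omega> f \<rho> by auto
  have C1: "C1_on UNIV p" by (rule C2_map_imp_C1_on[OF polynomial_function_C2_map[OF p(1)]])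
  have neg: "negligible (p ` {x. jacobian_det p x = 0})"
    by (rule negligible_critical_values[where g' = "\<lambda>x. frechet_derivative p (at x)"])
      (auto simp: jacobian_det_def intro: C1_on_frechet[OF C1])
  have "\<not> negligible (ball y (\<rho>/2))" using \<rho> by (intro open_not_negligible) auto
  then have "\<not> ball y (\<rho>/2) \<subseteq> p ` {x. jacobian_det p x = 0}" using negligible_subset[OF neg] by blast
  then obtain y1 where "y1 \<in> ball y (\<rho>/2)" and y1: "y1 \<notin> p ` {x. jacobian_det p x = 0}" by blast
  then have dy1: "dist y y1 < \<rho>/2" by simp
  \<comment> \<open>The translation moves the regular value \<open>y1\<close> of \<open>p\<close> to
    \<open>y\<close> without changing the derivative.\<close>
  define g where "g x = p x + (y - y1)" for x
  have J: "jacobian_det g x = jacobian_det p x" for x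
  proof -
    have "(g has_derivative frechet_derivative p (at x)) (at x)"
      unfolding g_def by (rule has_derivative_add_const[OF C1_on_frechet[OF C1 UNIV_I]])
    from jacobian_det_eqI[OF this] show ?thesis by (simp add: jacobian_det_def)
  qed
  show thesis
  proof (rule that)
    show "C2_map g" unfolding g_def
      by (intro polynomial_function_C2_map polynomial_function_add p polynomial_function_const)
    show "dist (g x) (f x) < \<rho>" if "x \<in> closure \<Omega>" for x
    proof -
      have "dist (g x) (f x) \<le> norm (p x - f x) + norm (y - y1)"
        unfolding g_def dist_norm by (metis add_diff_eq diff_add_eq norm_triangle_ineq)
      then show ?thesis using p(2)[OF that] dy1 by (simp add: dist_norm norm_minus_commute)
    qed
    show "jacobian_det g x \<noteq> 0" if gx: "g x = y" for x
    proof -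
      have "p x = y1" using gx by (simp add: g_def algebra_simps)
      then show ?thesis using y1 unfolding J by blast
    qed
  qed
qed

lemma set_sets_borel_preimage:
  fixes u :: "'a::topological_space \<Rightarrow> 'b::topological_space"
  assumes "open \<Omega>" "continuous_on \<Omega> u" "E \<in> sets borel"
  shows "{x \<in> \<Omega>. u x \<in> E} \<in> sets borel"
proof -
  have "u -` E \<inter> space (restrict_space borel \<Omega>) \<in> sets (restrict_space borel \<Omega>)"
    using borel_measurable_continuous_on_restrict[OF assms(2)] assms(3) by (rule measurable_sets)
  moreover have "u -` E \<inter> space (restrict_space borel \<Omega>) = {x \<in> \<Omega>. u x \<in> E}" by (auto simp: space_restrict_space)
  ultimately show ?thesis using assms(1) by (simp add: sets_restrict_space_iff)
qed

section \<open>The degree as an integral\<close>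

text \<open>Only the boundary values tie \<open>u\<close> to \<open>f\<close>, as the degree does
  not depend on more. Integrability of the Jacobian is required because the derivative of
  \<open>u\<close> may be unbounded near the boundary.\<close>

locale boundary_extension =
  fixes \<Omega> :: "(real^'n::finite) set" and f u :: "real^'n \<Rightarrow> real^'n"
  assumes open_\<Omega>: "open \<Omega>" and bounded_\<Omega>: "bounded \<Omega>"
    and continuous_f: "continuous_on (closure \<Omega>) f" and continuous_u: "continuous_on (closure \<Omega>) u"
    and C1_u: "C1_on \<Omega> u" and boundary: "\<And>x. x \<in> frontier \<Omega> \<Longrightarrow> u x = f x"
    and integrable_u: "set_integrable lborel \<Omega> (jacobian_det u)"
begin

text \<open>The integral of the Jacobian over \<open>preim E\<close>, as a function of
  \<open>E\<close>, is the push-forward under \<open>u\<close> of a signed measure. Off the image of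
  the frontier its density is the degree.\<close>

definition preim :: "(real^'n) set \<Rightarrow> (real^'n) set" where "preim E = {x \<in> \<Omega>. u x \<in> E}"

lemma continuous_u': "continuous_on \<Omega> u"
  using continuous_u closure_subset continuous_on_subset by blast

lemma sets_preim: assumes "E \<in> sets borel" shows "preim E \<in> sets borel"
  unfolding preim_def using set_sets_borel_preimage[OF open_\<Omega> continuous_u' assms] .

lemma integrable_preim: "E \<in> sets borel \<Longrightarrow> set_integrable lborel (preim E) (jacobian_det u)"
  using integrable_u
  by (rule set_integrable_subset) (use sets_preim in simp, auto simp: preim_def)

text \<open>The homotopy to \<open>g\<close> turns tent integrals of \<open>u\<close> into those of
  \<open>g\<close>, which count preimages because \<open>y\<close> is a regular value. Letting the
  tents increase to the box, with the integrable Jacobian of \<open>u\<close> as majorant, gives a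
  statement about \<open>u\<close> on boxes.\<close>

lemma approximant_count:
  assumes g: "degree_approximant f \<Omega> y g" and y: "y \<notin> f ` frontier \<Omega>"
  obtains \<epsilon> where "\<epsilon> > 0" "\<And>l r. box l r \<subseteq> ball y \<epsilon> \<Longrightarrow>
    (LINT x:preim (box l r)|lborel. jacobian_det u x)
      = (\<Sum>x | x \<in> \<Omega> \<and> g x = y. sgn (jacobian_det g x)) * measure lborel (box l r)"
proof -
  let ?k = "\<Sum>x | x \<in> \<Omega> \<and> g x = y. sgn (jacobian_det g x)"
  have C1: "C1_on UNIV g" using g C2_map_imp_C1_on by (auto simp: degree_approximant_def)
  have reg: "\<And>x. x \<in> \<Omega> \<Longrightarrow> g x = y \<Longrightarrow> jacobian_det g x \<noteq> 0" using g by (auto simp: degree_approximant_def)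
  have close: "dist (g x) (u x) < dist y (u x)" if "x \<in> frontier \<Omega>" for x
    using g that boundary[OF that] by (auto simp: degree_approximant_def frontier_def)
  have fr: "y \<notin> g ` frontier \<Omega>" using close by fastforce
  \<comment> \<open>A point of the segment is at most as far from \<open>u x\<close> as
    \<open>g x\<close> is, and \<open>y\<close> is farther away.\<close>
  have seg: "y \<notin> closed_segment (g x) (u x)" if "x \<in> frontier \<Omega>" for x
    using close[OF that] segment_bound(2)[of y "g x" "u x"] by (auto simp: dist_norm norm_minus_commute)
  obtain \<epsilon>1 where \<epsilon>1: "\<epsilon>1 > 0" "\<And>m l r. box l r \<subseteq> ball y \<epsilon>1 \<Longrightarrow>
      (LINT x:\<Omega>|lborel. box_tent m l r (u x) * jacobian_det u x)
        = (LINT x:\<Omega>|lborel. box_tent m l r (g x) * jacobian_det g x)"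
    by (rule integral_box_tent_homotopy[OF open_\<Omega> bounded_\<Omega> continuous_u C1_u C1 seg]) blast+
  obtain \<epsilon>2 where \<epsilon>2: "\<epsilon>2 > 0"
    "\<And>\<phi>. integrable lborel \<phi> \<Longrightarrow> \<phi> \<in> borel_measurable borel \<Longrightarrow> (\<And>z. z \<notin> ball y \<epsilon>2 \<Longrightarrow> \<phi> z = 0) \<Longrightarrow>
       (LINT x:\<Omega>|lborel. \<phi> (g x) * jacobian_det g x) = ?k * (LINT z|lborel. \<phi> z)"
    by (rule regular_value_local_count[OF open_\<Omega> bounded_\<Omega> C1 fr reg]) blast+
  show thesis
  proof (rule that[of "min \<epsilon>1 \<epsilon>2"])
    show "min \<epsilon>1 \<epsilon>2 > 0" using \<epsilon>1 \<epsilon>2 by simp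
    fix l r assume B: "box l r \<subseteq> ball y (min \<epsilon>1 \<epsilon>2)"
    have B1: "box l r \<subseteq> ball y \<epsilon>1" and B2: "box l r \<subseteq> ball y \<epsilon>2" using B by auto
    have fin: "emeasure lborel (box l r) < \<infinity>" by (rule emeasure_bounded_finite) (rule bounded_box)
    have iB: "integrable lborel (indicator (box l r) :: real^'n \<Rightarrow> real)" using fin by simp
    have nb: "norm (box_tent m l r z) \<le> indicator (box l r) z" for m z using box_tent_bounds[of m l r z] by simp
    have i_tent: "integrable lborel (box_tent m l r)" for m
      by (rule Bochner_Integration.integrable_bound[OF iB]) (use nb in auto)
    have eq: "(LINT x:\<Omega>|lborel. box_tent m l r (u x) * jacobian_det u x) = ?k * (LINT z|lborel. box_tent m l r z)" for m
    proof -
      have "box_tent m l r z = 0" if "z \<notin> ball y \<epsilon>2" for z using B2 that by (intro box_tent_eq_0) blast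
      then show ?thesis using \<epsilon>1(2)[OF B1] \<epsilon>2(2)[OF i_tent borel_measurable_box_tent] by simp
    qed
    have lim1: "(\<lambda>m. LINT z|lborel. box_tent m l r z) \<longlonglongrightarrow> (LINT z|lborel. indicator (box l r) z)"
      by (rule integral_dominated_convergence[where w = "indicator (box l r)"])
        (use nb box_tent_tendsto[of l r] iB in \<open>auto intro!: AE_I2\<close>)
    have mT: "(\<lambda>x. indicator \<Omega> x * (box_tent m l r (u x) * jacobian_det u x)) \<in> borel_measurable borel" for m
    proof -
      have "continuous_on \<Omega> (\<lambda>x. box_tent m l r (u x) * jacobian_det u x)"
        by (intro continuous_intros continuous_on_compose2[OF continuous_on_box_tent[of UNIV] continuous_u'] continuous_on_jacobian_det C1_u subset_UNIV)
      from borel_measurable_continuous_on_indicator[OF borel_open[OF open_\<Omega>] this] show ?thesis by simp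
    qed
    have mP: "(\<lambda>x. indicator (preim (box l r)) x * jacobian_det u x) \<in> borel_measurable borel"
      using integrable_preim[of "box l r"] by (simp add: set_integrable_def borel_measurable_integrable)
    have "(\<lambda>m. LINT x:\<Omega>|lborel. box_tent m l r (u x) * jacobian_det u x) \<longlonglongrightarrow> (LINT x:preim (box l r)|lborel. jacobian_det u x)"
      unfolding set_lebesgue_integral_def real_scaleR_def
    proof (rule integral_dominated_convergence[where w = "\<lambda>x. indicator \<Omega> x * \<bar>jacobian_det u x\<bar>"])
      show "integrable lborel (\<lambda>x. indicator \<Omega> x * \<bar>jacobian_det u x\<bar>)"
        using set_integrable_abs[OF integrable_u] by (simp add: set_integrable_def)
      show "AE x in lborel. (\<lambda>m. indicator \<Omega> x * (box_tent m l r (u x) * jacobian_det u x))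
          \<longlonglongrightarrow> indicator (preim (box l r)) x * jacobian_det u x"
      proof (rule AE_I2)
        fix x
        have "(\<lambda>m. indicator \<Omega> x * (box_tent m l r (u x) * jacobian_det u x))
            \<longlonglongrightarrow> indicator \<Omega> x * (indicator (box l r) (u x) * jacobian_det u x)"
          by (intro tendsto_intros box_tent_tendsto)
        moreover have "indicator \<Omega> x * (indicator (box l r) (u x) * jacobian_det u x) = indicator (preim (box l r)) x * jacobian_det u x"
          by (auto simp: preim_def indicator_def)
        ultimately show "(\<lambda>m. indicator \<Omega> x * (box_tent m l r (u x) * jacobian_det u x))
          \<longlonglongrightarrow> indicator (preim (box l r)) x * jacobian_det u x" by simp
      qed
      show "AE x in lborel. norm (indicator \<Omega> x * (box_tent m l r (u x) * jacobian_det u x)) \<le> indicator \<Omega> x * \<bar>jacobian_det u x\<bar>" for m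
      proof (rule AE_I2)
        fix x
        have "\<bar>box_tent m l r (u x)\<bar> \<le> 1" using nb[of m "u x"] by (metis indicator_le_1 order_trans real_norm_def)
        then show "norm (indicator \<Omega> x * (box_tent m l r (u x) * jacobian_det u x)) \<le> indicator \<Omega> x * \<bar>jacobian_det u x\<bar>"
          by (cases "x \<in> \<Omega>") (simp_all add: abs_mult mult_left_le_one_le)
      qed
    qed (use mT mP in simp_all)
    moreover have "(\<lambda>m. LINT x:\<Omega>|lborel. box_tent m l r (u x) * jacobian_det u x) \<longlonglongrightarrow> ?k * measure lborel (box l r)"
      unfolding eq using tendsto_mult_left[OF lim1, of ?k] by simp
    ultimately show "(LINT x:preim (box l r)|lborel. jacobian_det u x) = ?k * measure lborel (box l r)"
      by (rule LIMSEQ_unique)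
  qed
qed

text \<open>Both counts, times the volume of the same small box, equal one integral that involves
  only \<open>u\<close>; the box has positive volume.\<close>

lemma approximants_agree:
  assumes g: "degree_approximant f \<Omega> y g" "degree_approximant f \<Omega> y h" and y: "y \<notin> f ` frontier \<Omega>"
  shows "(\<Sum>x | x \<in> \<Omega> \<and> g x = y. sgn (jacobian_det g x)) = (\<Sum>x | x \<in> \<Omega> \<and> h x = y. sgn (jacobian_det h x))"
proof -
  obtain \<epsilon>1 where 1: "\<epsilon>1 > 0" "\<And>l r. box l r \<subseteq> ball y \<epsilon>1 \<Longrightarrow> (LINT x:preim (box l r)|lborel. jacobian_det u x)
      = (\<Sum>x | x \<in> \<Omega> \<and> g x = y. sgn (jacobian_det g x)) * measure lborel (box l r)"
    by (rule approximant_count[OF g(1) y]) blast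
  obtain \<epsilon>2 where 2: "\<epsilon>2 > 0" "\<And>l r. box l r \<subseteq> ball y \<epsilon>2 \<Longrightarrow> (LINT x:preim (box l r)|lborel. jacobian_det u x)
      = (\<Sum>x | x \<in> \<Omega> \<and> h x = y. sgn (jacobian_det h x)) * measure lborel (box l r)"
    by (rule approximant_count[OF g(2) y]) blast
  have "y \<in> ball y (min \<epsilon>1 \<epsilon>2)" using 1(1) 2(1) by simp
  then obtain a b where ab: "box a b \<subseteq> ball y (min \<epsilon>1 \<epsilon>2)" "\<And>i. i \<in> Basis \<Longrightarrow> a \<bullet> i < b \<bullet> i"
    using open_contains_box[OF open_ball] by metis
  have "measure lborel (box a b) = (\<Prod>i\<in>Basis. (b - a) \<bullet> i)"
    using ab(2) by (intro measure_lborel_box) (simp add: less_imp_le)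
  then have "measure lborel (box a b) > 0" using ab(2) by (auto intro!: prod_pos simp: inner_diff_left)
  moreover have "box a b \<subseteq> ball y \<epsilon>1" "box a b \<subseteq> ball y \<epsilon>2" using ab(1) by auto
  ultimately show ?thesis using 1(2)[of a b] 2(2)[of a b] by simp
qed

text \<open>A sum of signs is an integer, hence a witness for the definite description; the
  agreement of all approximants makes it the only one.\<close>

lemma brouwer_degree_eq:
  assumes g: "degree_approximant f \<Omega> y g" and y: "y \<notin> f ` frontier \<Omega>"
  shows "real_of_int (brouwer_degree f \<Omega> y) = (\<Sum>x | x \<in> \<Omega> \<and> g x = y. sgn (jacobian_det g x))"
proof -
  have "(\<Sum>x | x \<in> \<Omega> \<and> g x = y. sgn (jacobian_det g x)) \<in> \<int>"
    by (intro Ints_sum) (simp add: sgn_if)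
  then obtain k :: int where k: "(\<Sum>x | x \<in> \<Omega> \<and> g x = y. sgn (jacobian_det g x)) = of_int k"
    by (rule Ints_cases)
  have "brouwer_degree f \<Omega> y = (THE k. \<forall>g. degree_approximant f \<Omega> y g \<longrightarrow>
      of_int k = (\<Sum>x\<in>{x\<in>\<Omega>. g x = y}. sgn (jacobian_det g x)))"
    using y by (simp add: brouwer_degree_def)
  also have "\<dots> = k"
  proof (rule the_equality)
    show "\<forall>g. degree_approximant f \<Omega> y g \<longrightarrow> of_int k = (\<Sum>x\<in>{x\<in>\<Omega>. g x = y}. sgn (jacobian_det g x))"
      using approximants_agree[OF g _ y] k by auto
    fix k' :: int
    assume "\<forall>g. degree_approximant f \<Omega> y g \<longrightarrow> of_int k' = (\<Sum>x\<in>{x\<in>\<Omega>. g x = y}. sgn (jacobian_det g x))"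
    then have "real_of_int k' = of_int k" using g k by auto
    then show "k' = k" by simp
  qed
  finally show ?thesis using k by simp
qed

section \<open>The push-forward of the Jacobian near a value off the boundary image\<close>

lemma integral_preim_Diff:
  assumes "A \<in> sets borel" "B \<in> sets borel" "B \<subseteq> A"
  shows "(LINT x:preim (A - B)|lborel. jacobian_det u x)
       = (LINT x:preim A|lborel. jacobian_det u x) - (LINT x:preim B|lborel. jacobian_det u x)"
proof -
  have "(\<lambda>x. indicator (preim (A - B)) x *\<^sub>R jacobian_det u x)
      = (\<lambda>x. indicator (preim A) x *\<^sub>R jacobian_det u x - indicator (preim B) x *\<^sub>R jacobian_det u x)"
    using assms(3) by (auto simp: preim_def indicator_def fun_eq_iff)
  then show ?thesis
    using integrable_preim[OF assms(1)] integrable_preim[OF assms(2)]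
    unfolding set_lebesgue_integral_def set_integrable_def by (simp add: Bochner_Integration.integral_diff)
qed

lemma integral_preim_UN:
  assumes A: "disjoint_family A" "range A \<subseteq> sets borel"
  shows "(\<lambda>i::nat. LINT x:preim (A i)|lborel. jacobian_det u x) sums (LINT x:preim (\<Union>i. A i)|lborel. jacobian_det u x)"
proof -
  have m: "A i \<in> sets borel" for i using A(2) by auto
  have U: "preim (\<Union>i. A i) = (\<Union>n. preim (\<Union>i<n. A i))" by (auto simp: preim_def)
  have psum: "(\<Sum>i<n. LINT x:preim (A i)|lborel. jacobian_det u x) = (LINT x:preim (\<Union>i<n. A i)|lborel. jacobian_det u x)" for n
  proof (induction n)
    case 0
    then show ?case by (simp add: preim_def set_lebesgue_integral_def)
  next
    case (Suc n)
    have d: "(\<Union>i<Suc n. A i) - A n = (\<Union>i<n. A i)"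
    proof -
      have "A i \<inter> A n = {}" if "i < n" for i using A(1) that by (simp add: disjoint_family_on_def)
      then show ?thesis unfolding lessThan_Suc by blast
    qed
    have "(LINT x:preim ((\<Union>i<Suc n. A i) - A n)|lborel. jacobian_det u x)
        = (LINT x:preim (\<Union>i<Suc n. A i)|lborel. jacobian_det u x) - (LINT x:preim (A n)|lborel. jacobian_det u x)"
      using m by (intro integral_preim_Diff) auto
    then show ?case using Suc unfolding d by simp
  qed
  have "(\<lambda>n. LINT x:preim (\<Union>i<n. A i)|lborel. jacobian_det u x) \<longlonglongrightarrow> (LINT x:(\<Union>n. preim (\<Union>i<n. A i))|lborel. jacobian_det u x)"
  proof (rule set_integral_cont_up)
    show "preim (\<Union>i<n. A i) \<in> sets lborel" for n
      using sets_preim[of "\<Union>i<n. A i"] m by (simp add: sets.finite_UN)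
    show "incseq (\<lambda>n. preim (\<Union>i<n. A i))" by (rule incseq_SucI) (auto simp: preim_def less_Suc_eq)
    show "set_integrable lborel (\<Union>n. preim (\<Union>i<n. A i)) (jacobian_det u)"
      unfolding U[symmetric] using m by (intro integrable_preim) auto
  qed
  then show ?thesis unfolding sums_def psum U .
qed

text \<open>One approximant \<open>g\<close> serves for all values near \<open>y\<close>, and its
  count is locally constant. The identity known for small boxes extends to Borel sets since boxes
  are closed under intersection and generate them.\<close>

lemma brouwer_degree_local:
  assumes y: "y \<notin> f ` frontier \<Omega>"
  obtains k :: int and r where "r > 0" "ball y r \<inter> f ` frontier \<Omega> = {}"
    "\<And>y'. y' \<in> ball y r \<Longrightarrow> brouwer_degree f \<Omega> y' = k"
    "\<And>E. E \<in> sets borel \<Longrightarrow> E \<subseteq> ball y r \<Longrightarrow> (LINT x:preim E|lborel. jacobian_det u x) = k * measure lborel E"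
proof -
  have "compact (frontier \<Omega>)" using bounded_\<Omega> by (simp add: compact_frontier_bounded)
  then have "compact (f ` frontier \<Omega>)"
    by (intro compact_continuous_image continuous_on_subset[OF continuous_f]) (auto simp: frontier_def)
  then have "open (- (f ` frontier \<Omega>))" by (simp add: open_Compl compact_imp_closed)
  then obtain e where e: "e > 0" "ball y e \<subseteq> - (f ` frontier \<Omega>)" using y by (auto elim!: openE)
  \<comment> \<open>Half of the distance \<open>e\<close> to the image of the frontier is spent on
    approximating \<open>f\<close>, the other half on moving \<open>y\<close>.\<close>
  define \<rho> where "\<rho> = e / 2"
  obtain g where g: "C2_map g" "\<And>x. x \<in> closure \<Omega> \<Longrightarrow> dist (g x) (f x) < \<rho>"
    "\<And>x. g x = y \<Longrightarrow> jacobian_det g x \<noteq> 0"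
    by (rule regular_C2_approximation[OF bounded_\<Omega> continuous_f, of \<rho> y]) (use e in \<open>auto simp: \<rho>_def\<close>)
  have far: "e \<le> dist y (f z)" if "z \<in> frontier \<Omega>" for z
  proof (rule ccontr)
    assume "\<not> e \<le> dist y (f z)"
    then have "f z \<in> ball y e" by simp
    then show False using e(2) that by blast
  qed
  have appr: "degree_approximant f \<Omega> y' g"
    if "y' \<in> ball y \<rho>" and reg: "\<And>x. x \<in> \<Omega> \<Longrightarrow> g x = y' \<Longrightarrow> jacobian_det g x \<noteq> 0" for y'
    unfolding degree_approximant_def
  proof (intro conjI ballI impI)
    fix x z assume x: "x \<in> closure \<Omega>" and z: "z \<in> frontier \<Omega>"
    have "dist y y' < \<rho>" using that(1) by simp
    then have "\<rho> < dist y' (f z)"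
      using far[OF z] dist_triangle[of y "f z" y'] unfolding \<rho>_def by linarith
    then show "dist (g x) (f x) < dist y' (f z)" using g(2)[OF x] by linarith
  qed (use g reg in auto)
  have gfr: "y \<notin> g ` frontier \<Omega>"
  proof
    assume "y \<in> g ` frontier \<Omega>"
    then obtain z where z: "z \<in> frontier \<Omega>" "y = g z" by blast
    then show False using far[OF z(1)] g(2)[of z] e(1) by (auto simp: \<rho>_def frontier_def)
  qed
  let ?k = "\<Sum>x | x \<in> \<Omega> \<and> g x = y. sgn (jacobian_det g x)"
  obtain \<epsilon>1 where \<epsilon>1: "\<epsilon>1 > 0"
    "\<And>y'. y' \<in> ball y \<epsilon>1 \<Longrightarrow> (\<Sum>x | x \<in> \<Omega> \<and> g x = y'. sgn (jacobian_det g x)) = ?k"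
    "\<And>y' x. y' \<in> ball y \<epsilon>1 \<Longrightarrow> x \<in> \<Omega> \<Longrightarrow> g x = y' \<Longrightarrow> jacobian_det g x \<noteq> 0"
    by (rule regular_value_local_count[OF open_\<Omega> bounded_\<Omega> C2_map_imp_C1_on[OF g(1)] gfr g(3)]) blast+
  have y\<rho>: "y \<in> ball y \<rho>" using e by (simp add: \<rho>_def)
  have apy: "degree_approximant f \<Omega> y g" using y\<rho> g(3) by (rule appr)
  obtain \<epsilon>2 where \<epsilon>2: "\<epsilon>2 > 0" "\<And>l r. box l r \<subseteq> ball y \<epsilon>2 \<Longrightarrow>
      (LINT x:preim (box l r)|lborel. jacobian_det u x) = ?k * measure lborel (box l r)"
    by (rule approximant_count[OF apy y]) (rule that)
  let ?K = "brouwer_degree f \<Omega> y"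
  have K: "real_of_int ?K = ?k" by (rule brouwer_degree_eq[OF apy y])
  define \<epsilon> where "\<epsilon> = Min {\<epsilon>1, \<epsilon>2, \<rho>}"
  have \<epsilon>: "\<epsilon> > 0" "\<epsilon> \<le> \<epsilon>1" "\<epsilon> \<le> \<epsilon>2" "\<epsilon> \<le> \<rho>" using \<epsilon>1(1) \<epsilon>2(1) e(1) by (auto simp: \<epsilon>_def \<rho>_def)
  have y\<epsilon>: "y \<in> ball y \<epsilon>" using \<epsilon>(1) by simp
  obtain a b where ab: "y \<in> box a b" "box a b \<subseteq> ball y \<epsilon>"
    by (rule open_contains_box[OF open_ball y\<epsilon>]) blast
  obtain r where r: "r > 0" "ball y r \<subseteq> box a b"
    by (rule openE[OF open_box ab(1)]) (rule that)
  \<comment> \<open>Intersecting with one fixed box keeps all volumes finite and reduces complements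
    to subtraction from the value on that box.\<close>
  define P where "P E \<longleftrightarrow> (LINT x:preim (E \<inter> box a b)|lborel. jacobian_det u x) = ?k * measure lborel (E \<inter> box a b)" for E
  have P: "P E" if "E \<in> sets borel" for E
  proof -
    let ?G = "range (\<lambda>(a, b). box a b :: (real^'n) set)"
    have mb: "E \<in> sigma_sets UNIV ?G \<Longrightarrow> E \<in> sets borel" for E by (simp add: borel_eq_box)
    have fin: "emeasure lborel (E \<inter> box a b) < \<infinity>" for E
      by (rule emeasure_bounded_finite) (auto intro: bounded_subset[OF bounded_box])
    have "Int_stable ?G" by (auto simp: Int_stable_def box_Int_box)
    moreover have "?G \<subseteq> Pow UNIV" by simp
    moreover have "E \<in> sigma_sets UNIV ?G" using that by (simp add: borel_eq_box)
    ultimately show "P E"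
    proof (induction rule: sigma_sets_induct_disjoint)
      case (basic A)
      then obtain c d where A: "A = box c d" by auto
      obtain c' d' where I: "A \<inter> box a b = box c' d'" unfolding A box_Int_box by blast
      have "box c' d' \<subseteq> box a b" using I by blast
      then have "box c' d' \<subseteq> ball y \<epsilon>2" using ab(2) subset_ball[OF \<epsilon>(3), of y] by (meson order_trans)
      then show ?case unfolding P_def I by (rule \<epsilon>2(2))
    next
      case empty
      then show ?case by (simp add: P_def preim_def set_lebesgue_integral_def)
    next
      case (compl A)
      note mA = mb[OF compl(1)]
      have "P UNIV" using \<epsilon>2(2)[of a b] ab(2) \<epsilon>(3) unfolding P_def by (simp add: subset_ball order_trans)
      moreover have "(UNIV - A) \<inter> box a b = (UNIV \<inter> box a b) - (A \<inter> box a b)" by blast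
      moreover have "measure lborel ((UNIV \<inter> box a b) - (A \<inter> box a b)) = measure lborel (UNIV \<inter> box a b) - measure lborel (A \<inter> box a b)"
        using mA fin[of UNIV] fin[of A] by (intro measure_Diff) auto
      moreover have "(LINT x:preim ((UNIV \<inter> box a b) - (A \<inter> box a b))|lborel. jacobian_det u x)
         = (LINT x:preim (UNIV \<inter> box a b)|lborel. jacobian_det u x) - (LINT x:preim (A \<inter> box a b)|lborel. jacobian_det u x)"
        using mA by (intro integral_preim_Diff) auto
      ultimately show ?case using compl(2) unfolding P_def by (simp add: right_diff_distrib)
    next
      case (union A)
      have mA: "A i \<in> sets borel" for i using union(2) mb by auto
      have dj: "disjoint_family (\<lambda>i. A i \<inter> box a b)" using union(1) by (auto simp: disjoint_family_on_def)
      have eq: "(\<Union>i. A i) \<inter> box a b = (\<Union>i. A i \<inter> box a b)" by blast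
      have "(\<lambda>i. LINT x:preim (A i \<inter> box a b)|lborel. jacobian_det u x) sums (LINT x:preim (\<Union>i. A i \<inter> box a b)|lborel. jacobian_det u x)"
        using mA by (intro integral_preim_UN dj) auto
      moreover have "(\<lambda>i. measure lborel (A i \<inter> box a b)) sums measure lborel (\<Union>i. A i \<inter> box a b)"
        using mA fin[of "\<Union>i. A i"] dj unfolding eq by (intro measure_UNION) auto
      then have "(\<lambda>i. ?k * measure lborel (A i \<inter> box a b)) sums (?k * measure lborel (\<Union>i. A i \<inter> box a b))"
        by (rule sums_mult)
      ultimately show ?case using union(3) unfolding P_def eq by (simp add: sums_unique2)
    qed
  qed
  have "ball y r \<subseteq> ball y \<epsilon>" using r(2) ab(2) by (rule order_trans)
  then have sub: "ball y r \<subseteq> ball y \<epsilon>1" "ball y r \<subseteq> ball y \<rho>"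
    using subset_ball[OF \<epsilon>(2), of y] subset_ball[OF \<epsilon>(4), of y] by (simp_all only: order_trans)
  have sub_e: "ball y \<rho> \<subseteq> ball y e" using e(1) by (intro subset_ball) (simp add: \<rho>_def)
  show thesis
  proof (rule that[of r ?K])
    show "r > 0" by fact
    show "ball y r \<inter> f ` frontier \<Omega> = {}" using sub(2) sub_e e(2) by blast
    fix y' assume y': "y' \<in> ball y r"
    then have y1: "y' \<in> ball y \<epsilon>1" "y' \<in> ball y \<rho>" using sub by blast+
    have ny: "y' \<notin> f ` frontier \<Omega>" using y1(2) sub_e e(2) by blast
    have "real_of_int (brouwer_degree f \<Omega> y') = ?k"
      using brouwer_degree_eq[OF appr[OF y1(2) \<epsilon>1(3)[OF y1(1)]] ny] \<epsilon>1(2)[OF y1(1)] by simp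
    then show "brouwer_degree f \<Omega> y' = ?K" using K by simp
  next
    fix E :: "(real^'n) set" assume E: "E \<in> sets borel" "E \<subseteq> ball y r"
    have Eab: "E \<inter> box a b = E" using r(2) E(2) by blast
    show "(LINT x:preim E|lborel. jacobian_det u x) = ?K * measure lborel E"
      using P[OF E(1)] unfolding P_def K Eab .
  qed
qed

end

text \<open>Equality on sets extends to simple functions by linearity. \<open>F\<close> and
  \<open>G\<close> may change sign, so the passage to \<open>h\<close> uses dominated rather than
  monotone convergence.\<close>

lemma integral_eq_of_sets:
  fixes F :: "'a \<Rightarrow> real" and G :: "'b \<Rightarrow> real" and h :: "'b \<Rightarrow> real"
  assumes F: "integrable M F" and G: "integrable N G" and u[measurable]: "u \<in> measurable M N"
    and eq: "\<And>E. E \<in> sets N \<Longrightarrow> (LINT x|M. indicator E (u x) * F x) = (LINT y|N. indicator E y * G y)"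
    and h[measurable]: "h \<in> borel_measurable N" and B: "\<And>y. \<bar>h y\<bar> \<le> B"
  shows "(LINT x|M. h (u x) * F x) = (LINT y|N. h y * G y)"
proof -
  have [measurable]: "F \<in> borel_measurable M" "G \<in> borel_measurable N" using F G by auto
  obtain s where s: "\<And>i. simple_function N (s i)" "\<And>y. y \<in> space N \<Longrightarrow> (\<lambda>i. s i y) \<longlonglongrightarrow> h y"
    "\<And>i y. y \<in> space N \<Longrightarrow> dist (s i y) 0 \<le> 2 * dist (h y) 0"
    using borel_measurable_implies_sequence_metric[OF h, of 0] by blast
  have ms[measurable]: "s i \<in> borel_measurable N" for i using s(1) by (rule borel_measurable_simple_function)
  \<comment> \<open>The approximating simple functions are bounded by twice \<open>h\<close>, whence
    the factor 2.\<close>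
  have sB: "\<bar>s i y\<bar> \<le> 2 * B" if "y \<in> space N" for i y using s(3)[OF that, of i] B[of y] by simp
  have us: "u x \<in> space N" if "x \<in> space M" for x using u that by (rule measurable_space)
  have simple: "(LINT x|M. s i (u x) * F x) = (LINT y|N. s i y * G y)" for i
  proof -
    let ?R = "s i ` space N" and ?E = "\<lambda>v. s i -` {v} \<inter> space N"
    have rep: "s i y = (\<Sum>v\<in>?R. v * indicator (?E v) y)" if "y \<in> space N" for y
      by (subst simple_function_indicator_representation_banach[OF s(1) that, of i]) (intro sum.cong refl, simp)
    have mE: "?E v \<in> sets N" for v using s(1)[of i] by (rule simple_functionD)
    have iF: "integrable M (\<lambda>x. v * (indicator (?E v) (u x) * F x))" for v
      using mE[of v] by (intro integrable_mult_right Bochner_Integration.integrable_bound[OF F])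
        (auto simp: indicator_def intro!: AE_I2)
    have iG: "integrable N (\<lambda>y. v * (indicator (?E v) y * G y))" for v
      using mE[of v] by (intro integrable_mult_right Bochner_Integration.integrable_bound[OF G])
        (auto simp: indicator_def intro!: AE_I2)
    have "(LINT x|M. s i (u x) * F x) = (LINT x|M. (\<Sum>v\<in>?R. v * (indicator (?E v) (u x) * F x)))"
      by (intro Bochner_Integration.integral_cong refl, subst rep[OF us], assumption)
        (simp only: sum_distrib_right mult.assoc)
    also have "\<dots> = (\<Sum>v\<in>?R. v * (LINT x|M. indicator (?E v) (u x) * F x))"
      by (subst Bochner_Integration.integral_sum, rule iF, simp only: integral_mult_right_zero)
    also have "\<dots> = (\<Sum>v\<in>?R. v * (LINT y|N. indicator (?E v) y * G y))"
      by (simp only: eq[OF mE])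
    also have "\<dots> = (LINT y|N. (\<Sum>v\<in>?R. v * (indicator (?E v) y * G y)))"
      by (subst Bochner_Integration.integral_sum, rule iG, simp only: integral_mult_right_zero)
    also have "\<dots> = (LINT y|N. s i y * G y)"
      by (intro Bochner_Integration.integral_cong refl, subst rep, assumption)
        (simp only: sum_distrib_right mult.assoc)
    finally show ?thesis .
  qed
  have "(\<lambda>i. LINT x|M. s i (u x) * F x) \<longlonglongrightarrow> (LINT x|M. h (u x) * F x)"
    by (rule integral_dominated_convergence[where w = "\<lambda>x. (2 * B) * \<bar>F x\<bar>"])
      (use F s(2) us sB in \<open>auto intro!: AE_I2 tendsto_intros mult_right_mono simp: abs_mult\<close>)
  moreover have "(\<lambda>i. LINT y|N. s i y * G y) \<longlonglongrightarrow> (LINT y|N. h y * G y)"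
    by (rule integral_dominated_convergence[where w = "\<lambda>y. (2 * B) * \<bar>G y\<bar>"])
      (use G s(2) sB in \<open>auto intro!: AE_I2 tendsto_intros mult_right_mono simp: abs_mult\<close>)
  ultimately show ?thesis unfolding simple by (rule LIMSEQ_unique)
qed

lemma nn_integral_disjoint_UN:
  assumes [measurable]: "f \<in> borel_measurable M" "\<And>i::nat. C i \<in> sets M" and d: "disjoint_family C"
  shows "(\<integral>\<^sup>+x\<in>(\<Union>i. C i). f x \<partial>M) = (\<Sum>i. \<integral>\<^sup>+x\<in>C i. f x \<partial>M)"
proof -
  have "(\<Sum>i. emeasure (density M f) (C i)) = emeasure (density M f) (\<Union>i. C i)"
    using d by (intro suminf_emeasure) auto
  then show ?thesis by (simp add: emeasure_density)
qed

section \<open>The degree as an integrable density\<close>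

context boundary_extension
begin

lemma closed_image_frontier: "closed (f ` frontier \<Omega>)"
proof -
  have "frontier \<Omega> \<subseteq> closure \<Omega>" by (auto simp: frontier_def)
  then show ?thesis
    using compact_frontier_bounded[OF bounded_\<Omega>]
    by (intro compact_imp_closed compact_continuous_image continuous_on_subset[OF continuous_f])
qed

lemma brouwer_degree_image_frontier: "y \<in> f ` frontier \<Omega> \<Longrightarrow> brouwer_degree f \<Omega> y = 0"
  by (simp add: brouwer_degree_def)

lemma borel_measurable_brouwer_degree [measurable]:
  "(\<lambda>y. real_of_int (brouwer_degree f \<Omega> y)) \<in> borel_measurable borel"
proof -
  let ?O = "- (f ` frontier \<Omega>)"
  have O: "open ?O" using closed_image_frontier by (rule open_Compl)
  have "continuous (at y) (\<lambda>y. real_of_int (brouwer_degree f \<Omega> y))" if y: "y \<in> ?O" for y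
  proof -
    obtain k :: int and r where k: "r > 0" "\<And>y'. y' \<in> ball y r \<Longrightarrow> brouwer_degree f \<Omega> y' = k"
      by (rule brouwer_degree_local[of y]) (use y in \<open>blast+\<close>)
    have "eventually (\<lambda>z. z \<in> ball y r) (nhds y)" using k(1) by (intro eventually_nhds_in_open) auto
    then have "eventually (\<lambda>z. real_of_int (brouwer_degree f \<Omega> z) = real_of_int (brouwer_degree f \<Omega> y)) (at y)"
      unfolding eventually_at_filter using k by (auto elim!: eventually_mono)
    then show ?thesis unfolding continuous_at by (rule tendsto_eventually)
  qed
  then have "continuous_on ?O (\<lambda>y. real_of_int (brouwer_degree f \<Omega> y))"
    using O by (simp add: continuous_on_eq_continuous_at)
  from borel_measurable_continuous_on_indicator[OF borel_open[OF O] this]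
  have "(\<lambda>y. indicator ?O y * real_of_int (brouwer_degree f \<Omega> y)) \<in> borel_measurable borel" by simp
  moreover have "(\<lambda>y. indicator ?O y * real_of_int (brouwer_degree f \<Omega> y)) = (\<lambda>y. real_of_int (brouwer_degree f \<Omega> y))"
    using brouwer_degree_image_frontier by (auto simp: fun_eq_iff indicator_def)
  ultimately show ?thesis by simp
qed

text \<open>By Lindelof countably many balls of local constancy cover the complement of the image of
  the frontier; making them disjoint allows summation over the pieces.\<close>

lemma brouwer_degree_cover:
  obtains C :: "nat \<Rightarrow> (real^'n) set" and k :: "nat \<Rightarrow> int"
  where "disjoint_family C" "\<And>i. C i \<in> sets borel" "(\<Union>i. C i) = - (f ` frontier \<Omega>)"
    "\<And>i y. y \<in> C i \<Longrightarrow> brouwer_degree f \<Omega> y = k i"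
    "\<And>i E. E \<in> sets borel \<Longrightarrow> E \<subseteq> C i \<Longrightarrow> (LINT x:preim E|lborel. jacobian_det u x) = k i * measure lborel E"
    "\<And>i. emeasure lborel (C i) < \<infinity>"
proof -
  define Q where "Q k S \<longleftrightarrow> (\<forall>y\<in>S. brouwer_degree f \<Omega> y = k) \<and>
    (\<forall>E. E \<in> sets borel \<longrightarrow> E \<subseteq> S \<longrightarrow> (LINT x:preim E|lborel. jacobian_det u x) = real_of_int k * measure lborel E)
    \<and> emeasure lborel S < \<infinity>" for k S
  define F where "F = {S. open S \<and> S \<inter> f ` frontier \<Omega> = {} \<and> (\<exists>k. Q k S)}"
  have Q0: "Q 0 {}" by (auto simp: Q_def preim_def set_lebesgue_integral_def)
  have cov: "\<Union>F = - (f ` frontier \<Omega>)"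
  proof (intro equalityI subsetI)
    fix y assume "y \<in> - (f ` frontier \<Omega>)"
    then have y: "y \<notin> f ` frontier \<Omega>" by blast
    obtain k :: int and r where k: "r > 0" "ball y r \<inter> f ` frontier \<Omega> = {}"
      "\<And>y'. y' \<in> ball y r \<Longrightarrow> brouwer_degree f \<Omega> y' = k"
      "\<And>E. E \<in> sets borel \<Longrightarrow> E \<subseteq> ball y r \<Longrightarrow> (LINT x:preim E|lborel. jacobian_det u x) = k * measure lborel E"
      by (rule brouwer_degree_local[OF y]) (rule that)
    have "Q k (ball y r)" unfolding Q_def using k(3,4) emeasure_bounded_finite[OF bounded_ball] by blast
    then have "ball y r \<in> F" using k(2) by (auto simp: F_def)
    then show "y \<in> \<Union>F" using k(1) by (meson UnionI centre_in_ball)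
  qed (auto simp: F_def)
  obtain F' where F': "F' \<subseteq> F" "countable F'" "\<Union>F' = \<Union>F"
    by (rule Lindelof[of F]) (auto simp: F_def)
  \<comment> \<open>The empty set is added so that the enumerated family is nonempty, as
    \<open>range_from_nat_into\<close> requires.\<close>
  define B where "B = from_nat_into (insert {} F')"
  have rB: "range B = insert {} F'" unfolding B_def using F'(2) by (intro range_from_nat_into) auto
  have "\<exists>k. Q k (B i)" for i
  proof -
    have "B i \<in> insert {} F'" using rB by blast
    then show ?thesis using F'(1) Q0 by (auto simp: F_def)
  qed
  then obtain k where k: "\<And>i. Q (k i) (B i)" by metis
  have Bb: "B i \<in> sets borel" for i
  proof -
    have "B i \<in> insert {} F'" using rB by blast
    then show ?thesis using F'(1) by (auto simp: F_def)
  qed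
  have sub: "disjointed B i \<subseteq> B i" for i by (rule disjointed_subset)
  have Db: "disjointed B i \<in> sets borel" for i
    using sets.range_disjointed_sets[of B borel] Bb by (auto simp: image_subset_iff)
  show thesis
  proof (rule that[of "disjointed B" k])
    show "disjoint_family (disjointed B)" by (rule disjoint_family_disjointed)
    show "disjointed B i \<in> sets borel" for i by (rule Db)
    show "(\<Union>i. disjointed B i) = - (f ` frontier \<Omega>)"
      unfolding UN_disjointed_eq using rB F'(3) cov by simp
    show "brouwer_degree f \<Omega> y = k i" if "y \<in> disjointed B i" for i y
      using k[of i] sub[of i] that unfolding Q_def by blast
    show "(LINT x:preim E|lborel. jacobian_det u x) = k i * measure lborel E"
      if "E \<in> sets borel" "E \<subseteq> disjointed B i" for i E
      using k[of i] sub[of i] that unfolding Q_def by (meson order_trans)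
    show "emeasure lborel (disjointed B i) < \<infinity>" for i
    proof -
      have "emeasure lborel (disjointed B i) \<le> emeasure lborel (B i)" using sub Bb by (intro emeasure_mono) auto
      also have "\<dots> < \<infinity>" using k[of i] unfolding Q_def by blast
      finally show ?thesis .
    qed
  qed
qed

text \<open>On a piece of constant degree, the absolute degree times the volume is the absolute
  value of a Jacobian integral over the preimage of the piece. The preimages are disjoint, so the
  integrals of the absolute Jacobian over them add up to at most the one over \<Omega>.\<close>

lemma brouwer_degree_L1:
  shows "integrable lborel (\<lambda>y. real_of_int (brouwer_degree f \<Omega> y))"
    and "(LINT y|lborel. \<bar>real_of_int (brouwer_degree f \<Omega> y)\<bar>) \<le> (LINT x:\<Omega>|lborel. \<bar>jacobian_det u x\<bar>)"
proof -
  let ?d = "\<lambda>y. real_of_int (brouwer_degree f \<Omega> y)" and ?J = "jacobian_det u"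
  obtain C k where C: "disjoint_family C" "\<And>i::nat. C i \<in> sets borel" "(\<Union>i. C i) = - (f ` frontier \<Omega>)"
    "\<And>i y. y \<in> C i \<Longrightarrow> brouwer_degree f \<Omega> y = k i"
    "\<And>i E. E \<in> sets borel \<Longrightarrow> E \<subseteq> C i \<Longrightarrow> (LINT x:preim E|lborel. ?J x) = k i * measure lborel E"
    "\<And>i. emeasure lborel (C i) < \<infinity>"
    by (rule brouwer_degree_cover) (rule that)
  define J where "J x = indicator \<Omega> x * \<bar>?J x\<bar>" for x
  have iJ: "integrable lborel J"
    using set_integrable_abs[OF integrable_u] by (simp add: J_def[abs_def] set_integrable_def)
  have J0: "J x \<ge> 0" for x by (simp add: J_def)
  have [measurable]: "J \<in> borel_measurable borel" using borel_measurable_integrable[OF iJ] by simp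
  have mC[measurable]: "C i \<in> sets lborel" and mP[measurable]: "preim (C i) \<in> sets lborel" for i
    using C(2) sets_preim by auto
  have dP: "disjoint_family (\<lambda>i. preim (C i))" using C(1) by (auto simp: disjoint_family_on_def preim_def)
  \<comment> \<open>The pieces leave out only the image of the frontier, where the degree is 0 by
    convention.\<close>
  have "(\<integral>\<^sup>+y. ennreal \<bar>?d y\<bar> \<partial>lborel) = (\<integral>\<^sup>+y\<in>(\<Union>i. C i). ennreal \<bar>?d y\<bar> \<partial>lborel)"
    unfolding C(3) using brouwer_degree_image_frontier by (intro nn_integral_cong) (auto simp: indicator_def)
  also have "\<dots> = (\<Sum>i. \<integral>\<^sup>+y\<in>C i. ennreal \<bar>?d y\<bar> \<partial>lborel)"
    by (rule nn_integral_disjoint_UN) (use C(1) mC in auto)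
  also have "\<dots> \<le> (\<Sum>i. \<integral>\<^sup>+x\<in>preim (C i). ennreal (J x) \<partial>lborel)"
  proof (intro suminf_le summableI)
    fix i
    have "(\<integral>\<^sup>+y\<in>C i. ennreal \<bar>?d y\<bar> \<partial>lborel) = (\<integral>\<^sup>+y. ennreal \<bar>real_of_int (k i)\<bar> * indicator (C i) y \<partial>lborel)"
      using C(4) by (intro nn_integral_cong) (auto simp: indicator_def)
    also have "\<dots> = ennreal \<bar>real_of_int (k i)\<bar> * emeasure lborel (C i)"
      using mC by (intro nn_integral_cmult_indicator)
    also have "\<dots> = ennreal \<bar>real_of_int (k i) * measure lborel (C i)\<bar>"
      using C(6)[of i] by (simp add: emeasure_eq_ennreal_measure abs_mult ennreal_mult)
    also have "real_of_int (k i) * measure lborel (C i) = (LINT x:preim (C i)|lborel. ?J x)"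
      using C(5)[OF C(2) order_refl, of i] by simp
    also have "ennreal \<bar>LINT x:preim (C i)|lborel. ?J x\<bar> \<le> (\<integral>\<^sup>+x. ennreal (norm (indicator (preim (C i)) x *\<^sub>R ?J x)) \<partial>lborel)"
      using integral_norm_bound_ennreal[OF integrable_preim[OF C(2), unfolded set_integrable_def]]
      unfolding set_lebesgue_integral_def by simp
    also have "\<dots> = (\<integral>\<^sup>+x\<in>preim (C i). ennreal (J x) \<partial>lborel)"
      by (intro nn_integral_cong) (auto simp: indicator_def J_def preim_def)
    finally show "(\<integral>\<^sup>+y\<in>C i. ennreal \<bar>?d y\<bar> \<partial>lborel) \<le> (\<integral>\<^sup>+x\<in>preim (C i). ennreal (J x) \<partial>lborel)" .
  qed
  also have "\<dots> = (\<integral>\<^sup>+x\<in>(\<Union>i. preim (C i)). ennreal (J x) \<partial>lborel)"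
    by (rule nn_integral_disjoint_UN[symmetric]) (use dP mP in auto)
  also have "\<dots> \<le> (\<integral>\<^sup>+x. ennreal (J x) \<partial>lborel)"
    by (intro nn_integral_mono) (auto simp: indicator_def)
  also have "\<dots> = ennreal (LINT x|lborel. J x)"
    using iJ J0 by (intro nn_integral_eq_integral) auto
  finally have le: "(\<integral>\<^sup>+y. ennreal \<bar>?d y\<bar> \<partial>lborel) \<le> ennreal (LINT x|lborel. J x)" .
  show int: "integrable lborel ?d"
    using le by (intro integrableI_bounded) (auto intro: le_less_trans)
  have "ennreal (LINT y|lborel. \<bar>?d y\<bar>) \<le> ennreal (LINT x|lborel. J x)"
    using le int by (subst nn_integral_eq_integral[symmetric]) auto
  then have "(LINT y|lborel. \<bar>?d y\<bar>) \<le> (LINT x|lborel. J x)"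
    by (rule ennreal_le_iff[THEN iffD1, rotated]) (simp add: J0)
  then show "(LINT y|lborel. \<bar>?d y\<bar>) \<le> (LINT x:\<Omega>|lborel. \<bar>?J x\<bar>)"
    by (simp add: J_def set_lebesgue_integral_def)
qed

text \<open>On the image of the frontier the degree is 0 by convention, whereas \<open>u\<close> may
  carry points with nonzero Jacobian into it. That set is therefore removed on the right.\<close>

lemma integral_brouwer_degree_set:
  assumes E: "E \<in> sets borel"
  shows "(LINT y:E|lborel. real_of_int (brouwer_degree f \<Omega> y)) = (LINT x:preim (E - f ` frontier \<Omega>)|lborel. jacobian_det u x)"
proof -
  let ?d = "\<lambda>y. real_of_int (brouwer_degree f \<Omega> y)" and ?J = "jacobian_det u"
  obtain C k where C: "disjoint_family C" "\<And>i::nat. C i \<in> sets borel" "(\<Union>i. C i) = - (f ` frontier \<Omega>)"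
    "\<And>i y. y \<in> C i \<Longrightarrow> brouwer_degree f \<Omega> y = k i"
    "\<And>i E. E \<in> sets borel \<Longrightarrow> E \<subseteq> C i \<Longrightarrow> (LINT x:preim E|lborel. ?J x) = k i * measure lborel E"
    "\<And>i. emeasure lborel (C i) < \<infinity>"
    by (rule brouwer_degree_cover) (rule that)
  have eq: "E - f ` frontier \<Omega> = (\<Union>i. E \<inter> C i)" using C(3) by blast
  have dj: "disjoint_family (\<lambda>i. E \<inter> C i)" using C(1) by (auto simp: disjoint_family_on_def)
  have mE: "E \<inter> C i \<in> sets borel" for i using E C(2) by auto
  have di: "set_integrable lborel A ?d" if "A \<in> sets borel" for A
    unfolding set_integrable_def
    by (rule integrable_mult_indicator[OF _ brouwer_degree_L1(1)]) (use that in simp)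
  have "(LINT y:E|lborel. ?d y) = (LINT y:(\<Union>i. E \<inter> C i)|lborel. ?d y)"
    unfolding eq[symmetric] set_lebesgue_integral_def using brouwer_degree_image_frontier
    by (intro Bochner_Integration.integral_cong) (auto simp: indicator_def)
  also have "\<dots> = (\<Sum>i. LINT y:E \<inter> C i|lborel. ?d y)"
  proof (rule lebesgue_integral_countable_add)
    show "set_integrable lborel (\<Union>i. E \<inter> C i) ?d"
      by (intro di sets.countable_UN) (use mE in blast)
  qed (use mE dj in \<open>auto simp: disjoint_family_on_def\<close>)
  also have "(\<lambda>i. LINT y:E \<inter> C i|lborel. ?d y) = (\<lambda>i. LINT x:preim (E \<inter> C i)|lborel. ?J x)"
  proof
    fix i
    have fin: "emeasure lborel (E \<inter> C i) < \<infinity>"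
      using C(6)[of i] emeasure_mono[of "E \<inter> C i" "C i" lborel] C(2)[of i] by (auto intro: le_less_trans)
    have "(LINT y:E \<inter> C i|lborel. ?d y) = (LINT y|lborel. indicator (E \<inter> C i) y * real_of_int (k i))"
      unfolding set_lebesgue_integral_def using C(4) by (intro Bochner_Integration.integral_cong) (auto simp: indicator_def)
    also have "\<dots> = k i * measure lborel (E \<inter> C i)" using fin mE[of i] by simp
    also have "\<dots> = (LINT x:preim (E \<inter> C i)|lborel. ?J x)" using C(5)[OF mE[of i] Int_lower2] by simp
    finally show "(LINT y:E \<inter> C i|lborel. ?d y) = (LINT x:preim (E \<inter> C i)|lborel. ?J x)" .
  qed
  also have "(\<Sum>i. LINT x:preim (E \<inter> C i)|lborel. ?J x) = (LINT x:preim (\<Union>i. E \<inter> C i)|lborel. ?J x)"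
    using integral_preim_UN[OF dj] mE by (intro sums_unique[symmetric]) auto
  finally show ?thesis unfolding eq .
qed

text \<open>A change of variables with the degree as multiplicity. The hypothesis
  \<open>null\<close> lets the integral on the right run over all of \<Omega>: almost every point
  lying over the image of the frontier is critical for \<open>u\<close>.\<close>

lemma integral_brouwer_degree:
  assumes h: "h \<in> borel_measurable borel" and B: "\<And>y. \<bar>h y\<bar> \<le> B" and null: "negligible (f ` frontier \<Omega>)"
  shows "(LINT y|lborel. h y * real_of_int (brouwer_degree f \<Omega> y)) = (LINT x:\<Omega>|lborel. h (u x) * jacobian_det u x)"
proof -
  let ?N = "f ` frontier \<Omega>" and ?J = "jacobian_det u"
  \<comment> \<open>\<open>u\<close> is arbitrary outside \<Omega>; extended by 0 it is Borel on the
    whole space, and the density \<open>F\<close> below vanishes there.\<close>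
  define w where "w x = indicator \<Omega> x *\<^sub>R u x" for x
  have mw: "w \<in> borel_measurable borel"
    unfolding w_def by (rule borel_measurable_continuous_on_indicator[OF borel_open[OF open_\<Omega>] continuous_u'])
  have cN: "?N \<in> sets borel" using closed_image_frontier by (rule borel_closed)
  define F where "F x = indicator (preim (- ?N)) x * ?J x" for x
  have iF: "integrable lborel F"
    using integrable_preim[of "- ?N"] cN by (simp add: F_def[abs_def] set_integrable_def)
  have "(LINT x|lborel. h (w x) * F x) = (LINT y|lborel. h y * real_of_int (brouwer_degree f \<Omega> y))"
  proof (rule integral_eq_of_sets[OF iF brouwer_degree_L1(1) _ _ _ B])
    show "w \<in> lborel \<rightarrow>\<^sub>M lborel" "h \<in> borel_measurable lborel" using mw h by auto
    fix E :: "(real^'n) set" assume "E \<in> sets lborel"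
    then have E: "E \<in> sets borel" by simp
    have "(LINT x|lborel. indicator E (w x) * F x) = (LINT x:preim (E - ?N)|lborel. ?J x)"
      unfolding set_lebesgue_integral_def F_def w_def
      by (intro Bochner_Integration.integral_cong) (auto simp: indicator_def preim_def)
    then show "(LINT x|lborel. indicator E (w x) * F x) = (LINT y|lborel. indicator E y * real_of_int (brouwer_degree f \<Omega> y))"
      using integral_brouwer_degree_set[OF E] by (simp add: set_lebesgue_integral_def)
  qed
  moreover have "(LINT x|lborel. h (w x) * F x) = (LINT x:\<Omega>|lborel. h (u x) * ?J x)"
    unfolding set_lebesgue_integral_def
  proof (rule integral_cong_AE)
    have mJ: "(\<lambda>x. indicator \<Omega> x * ?J x) \<in> borel_measurable borel"
      using borel_measurable_continuous_on_indicator[OF borel_open[OF open_\<Omega>] continuous_on_jacobian_det[OF C1_u]] by simp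
    have mhw: "(\<lambda>x. h (w x)) \<in> borel_measurable borel" by (rule measurable_compose[OF mw h])
    have mF: "F \<in> borel_measurable borel" using borel_measurable_integrable[OF iF] by simp
    show "(\<lambda>x. h (w x) * F x) \<in> borel_measurable lborel" using mhw mF by simp
    have "(\<lambda>x. h (w x) * (indicator \<Omega> x * ?J x)) \<in> borel_measurable borel" using mhw mJ by simp
    moreover have "(\<lambda>x. h (w x) * (indicator \<Omega> x * ?J x)) = (\<lambda>x. indicator \<Omega> x *\<^sub>R (h (u x) * ?J x))"
      by (auto simp: fun_eq_iff w_def indicator_def)
    ultimately show "(\<lambda>x. indicator \<Omega> x *\<^sub>R (h (u x) * ?J x)) \<in> borel_measurable lborel" by simp
    have "negligible {x \<in> \<Omega>. u x \<in> ?N \<and> ?J x \<noteq> 0}"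
      by (rule negligible_noncritical_preimage[OF open_\<Omega> C1_u null])
    then have "AE x in lebesgue. x \<notin> {x \<in> \<Omega>. u x \<in> ?N \<and> ?J x \<noteq> 0}"
      unfolding negligible_iff_null_sets by (rule AE_not_in)
    then have "AE x in lebesgue. h (w x) * F x = indicator \<Omega> x *\<^sub>R (h (u x) * ?J x)"
      by eventually_elim (auto simp: F_def w_def preim_def indicator_def)
    then show "AE x in lborel. h (w x) * F x = indicator \<Omega> x *\<^sub>R (h (u x) * ?J x)"
      by (simp add: AE_completion_iff)
  qed
  ultimately show ?thesis by simp
qed

text \<open>A small ball about \<open>y\<close> has empty preimage under \<open>u\<close>, so its
  positive volume times the degree is 0. This gives the degree bounded support.\<close>

lemma brouwer_degree_outside:
  assumes y: "y \<notin> u ` closure \<Omega>"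
  shows "brouwer_degree f \<Omega> y = 0"
proof (cases "y \<in> f ` frontier \<Omega>")
  case False
  obtain k :: int and r where k: "r > 0" "\<And>y'. y' \<in> ball y r \<Longrightarrow> brouwer_degree f \<Omega> y' = k"
    "\<And>E. E \<in> sets borel \<Longrightarrow> E \<subseteq> ball y r \<Longrightarrow> (LINT x:preim E|lborel. jacobian_det u x) = k * measure lborel E"
    by (rule brouwer_degree_local[OF False]) (rule that)
  have "closed (u ` closure \<Omega>)"
    using bounded_\<Omega> by (intro compact_imp_closed compact_continuous_image continuous_u) simp
  then obtain e where e: "e > 0" "ball y e \<subseteq> - u ` closure \<Omega>"
    using y by (meson ComplI open_Compl openE)
  define E where "E = ball y (min r e)"
  have sub: "E \<subseteq> ball y e" "E \<subseteq> ball y r" unfolding E_def by (auto intro!: subset_ball)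
  have "u x \<notin> ball y e" if "x \<in> \<Omega>" for x using e(2) that closure_subset[of \<Omega>] by blast
  then have P: "preim E = {}" unfolding preim_def using sub(1) by blast
  have "E \<in> sets borel" by (simp add: E_def)
  from k(3)[OF this sub(2)] have "k * measure lborel E = 0" unfolding P by (simp add: set_lebesgue_integral_def)
  moreover have "measure lborel E > 0"
    unfolding E_def using k(1) e(1) by (simp add: content_ball_pos)
  ultimately show ?thesis using k(2)[of y] k(1) by simp
qed (rule brouwer_degree_image_frontier)

end

section \<open>Averages at the scale of the distance to the complement\<close>

lemma C1_on_inverse:
  fixes M :: "'a::euclidean_space \<Rightarrow> real"
  assumes M: "C1_on S M" and pos: "\<And>x. x \<in> S \<Longrightarrow> M x \<noteq> 0"
  shows "C1_on S (\<lambda>x. inverse (M x))"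
proof (rule C1_onI)
  fix x assume "x \<in> S"
  then show "((\<lambda>x. inverse (M x)) has_derivative
      (\<lambda>h. - (inverse (M x) * frechet_derivative M (at x) h * inverse (M x)))) (at x)"
    by (intro Deriv.has_derivative_inverse C1_on_frechet[OF M] pos)
next
  show "continuous_on S (\<lambda>x. - (inverse (M x) * frechet_derivative M (at x) h * inverse (M x)))" for h
    using pos by (intro continuous_intros C1_on_imp_continuous_on[OF M] C1_on_continuous_frechet[OF M]) auto
qed

text \<open>The box is a fixed domain for the parameter integrals, as differentiation under the
  integral is used on boxes. The weights introduced below vanish outside \<Omega>, so the part of
  the box beyond \<Omega> contributes nothing.\<close>

locale distance_bump =
  fixes \<Omega> :: "'a::euclidean_space set" and a b :: 'a
  assumes open_\<Omega>: "open \<Omega>" and bounded_\<Omega>: "bounded \<Omega>" and cbox: "closure \<Omega> \<subseteq> cbox a b"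
begin

definition depth :: "'a \<Rightarrow> real" where "depth w = infdist w (- \<Omega>)"

text \<open>The width depends on \<open>w\<close> and not on \<open>x\<close>, so the square of the bump is \<open>C\<^sup>1\<close> in \<open>x\<close> although
  \<open>depth\<close> is only Lipschitz; no regularized distance is needed.\<close>

definition bump :: "'a \<Rightarrow> 'a \<Rightarrow> real" where
  "bump x w = max 0 ((depth w)\<^sup>2 - 4 * (norm (x - w))\<^sup>2)"

definition bump_integral :: "('a \<Rightarrow> real) \<Rightarrow> 'a \<Rightarrow> real" where
  "bump_integral \<phi> x = integral (cbox a b) (\<lambda>w. \<phi> w * (bump x w)\<^sup>2)"

lemma depth_nonneg: "0 \<le> depth w"
  by (simp add: depth_def infdist_nonneg)

lemma depth_triangle: "depth w \<le> depth x + norm (x - w)"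
  using infdist_triangle[of w "- \<Omega>" x] by (simp add: depth_def dist_norm norm_minus_commute)

lemma depth_pos: "x \<in> \<Omega> \<longleftrightarrow> depth x > 0"
proof -
  have "closed (- \<Omega>)" using open_\<Omega> by (simp add: closed_def)
  moreover have "- \<Omega> \<noteq> {}" using bounded_\<Omega> not_bounded_UNIV by (metis double_compl Compl_UNIV_eq)
  ultimately have "x \<in> - \<Omega> \<longleftrightarrow> depth x = 0" unfolding depth_def by (rule in_closed_iff_infdist_zero)
  then show ?thesis using depth_nonneg[of x] by auto
qed

lemma continuous_on_depth [continuous_intros]: "continuous_on S g \<Longrightarrow> continuous_on S (\<lambda>x. depth (g x))"
  unfolding depth_def by (rule continuous_on_infdist)

lemma continuous_on_bump [continuous_intros]:
  "continuous_on S g \<Longrightarrow> continuous_on S h \<Longrightarrow> continuous_on S (\<lambda>x. bump (g x) (h x))"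
  unfolding bump_def by (intro continuous_intros)

lemma bump_nonneg: "0 \<le> bump x w" by (simp add: bump_def)

text \<open>The factor 4 in \<open>bump\<close> means \<open>2 * norm (x - w) < depth w\<close>. As
  \<open>depth\<close> is 1-Lipschitz, this gives \<open>depth w \<le> 2 * depth x\<close>: widths
  measured at \<open>w\<close> are controlled by the depth at \<open>x\<close>.\<close>

lemma bump_pos:
  assumes "bump x w \<noteq> 0"
  shows "norm (x - w) < depth x" "w \<in> \<Omega>" "bump x w \<le> 4 * (depth x)\<^sup>2"
proof -
  have "(2 * norm (x - w))\<^sup>2 < (depth w)\<^sup>2"
    using assms by (auto simp: bump_def max_def power_mult_distrib split: if_splits)
  then have less: "2 * norm (x - w) < depth w" using depth_nonneg by (rule power_less_imp_less_base)
  then show "w \<in> \<Omega>" unfolding depth_pos using norm_ge_zero[of "x - w"] by linarith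
  have two: "depth w \<le> 2 * depth x" using depth_triangle[of w x] less by linarith
  then show "norm (x - w) < depth x" using less by linarith
  have "bump x w \<le> (depth w)\<^sup>2" by (simp add: bump_def)
  also have "\<dots> \<le> (2 * depth x)\<^sup>2" using two depth_nonneg by (intro power_mono)
  finally show "bump x w \<le> 4 * (depth x)\<^sup>2" by (simp add: power_mult_distrib)
qed

text \<open>On this ball the depth is at least 7/8 of that at \<open>x\<close>, and 49/64 - 4/64
  exceeds 1/2.\<close>

lemma bump_ge:
  assumes "norm (x - w) \<le> depth x / 8" shows "(depth x)\<^sup>2 / 2 \<le> bump x w"
proof -
  have "depth x \<le> depth w + norm (x - w)" using depth_triangle[of x w] by (simp add: norm_minus_commute)
  then have "7 / 8 * depth x \<le> depth w" using assms by linarith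
  then have "(7 / 8 * depth x)\<^sup>2 \<le> (depth w)\<^sup>2" using depth_nonneg[of x] by (intro power_mono) auto
  moreover have "(norm (x - w))\<^sup>2 \<le> (depth x / 8)\<^sup>2" using assms by (intro power_mono) auto
  moreover have "(7 / 8 * depth x)\<^sup>2 = 49 / 64 * (depth x)\<^sup>2" "(depth x / 8)\<^sup>2 = (depth x)\<^sup>2 / 64"
    by (simp_all add: power_mult_distrib power_divide)
  ultimately have "(depth x)\<^sup>2 / 2 \<le> (depth w)\<^sup>2 - 4 * (norm (x - w))\<^sup>2"
    using zero_le_power2[of "depth x"] by linarith
  then show ?thesis unfolding bump_def by (rule order_trans[OF _ max.cobounded2])
qed

lemma has_derivative_bump_square:
  "((\<lambda>x. (bump x w)\<^sup>2) has_derivative (\<lambda>h. - 16 * bump x w * ((x - w) \<bullet> h))) (at x)"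
proof -
  have "((\<lambda>x. (depth w)\<^sup>2 - 4 * (norm (x - w))\<^sup>2) has_derivative (\<lambda>h. - 8 * ((x - w) \<bullet> h))) (at x)"
    unfolding power2_norm_eq_inner
    by (rule has_derivative_eq_rhs) (auto intro!: derivative_eq_intros simp: inner_commute)
  from has_derivative_compose[OF this has_real_derivative_max_0_square[unfolded has_field_derivative_def]]
  show ?thesis unfolding bump_def by (simp add: mult.assoc mult.left_commute)
qed

text \<open>The derivative is exposed as an operator-valued integral, so that its norm can be
  estimated under the integral sign.\<close>

lemma bump_integral_derivative:
  assumes \<phi>: "continuous_on UNIV \<phi>"
  obtains F where "\<And>x. (bump_integral \<phi> has_derivative blinfun_apply (F x)) (at x)" "continuous_on UNIV F"
    "\<And>x. F x = integral (cbox a b) (\<lambda>w. (- 16 * \<phi> w * bump x w) *\<^sub>R blinfun_inner_left (x - w))"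
    "\<And>x. (\<lambda>w. (- 16 * \<phi> w * bump x w) *\<^sub>R blinfun_inner_left (x - w)) integrable_on cbox a b"
proof -
  let ?f = "\<lambda>x w. (- 16 * \<phi> w * bump x w) *\<^sub>R blinfun_inner_left (x - w)"
  have c\<phi>: "continuous_on S (\<lambda>p. \<phi> (g p))" if "continuous_on S g" for S and g :: "'c::topological_space \<Rightarrow> 'a"
    using continuous_on_compose2[OF \<phi> that] by auto
  have cf: "continuous_on S (\<lambda>(x, w). ?f x w)" for S
    unfolding case_prod_unfold
    by (intro continuous_intros c\<phi> bounded_linear.continuous_on[OF bounded_linear_blinfun_inner_left])
  have int: "?f x integrable_on cbox a b" for x
    by (intro integrable_continuous continuous_intros c\<phi> bounded_linear.continuous_on[OF bounded_linear_blinfun_inner_left])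
  show thesis
  proof (rule that[of "\<lambda>x. integral (cbox a b) (?f x)"])
    show "(bump_integral \<phi> has_derivative blinfun_apply (integral (cbox a b) (?f x))) (at x)" for x
      unfolding bump_integral_def
    proof (rule leibniz_rule[where U = UNIV])
      fix x w
      have "((\<lambda>x. \<phi> w * (bump x w)\<^sup>2) has_derivative (\<lambda>h. \<phi> w * (- 16 * bump x w * ((x - w) \<bullet> h)))) (at x)"
        by (intro has_derivative_mult_right has_derivative_bump_square)
      moreover have "(\<lambda>h. \<phi> w * (- 16 * bump x w * ((x - w) \<bullet> h))) = blinfun_apply (?f x w)"
        by (simp add: fun_eq_iff blinfun.minus_left blinfun.scaleR_left inner_commute)
      ultimately show "((\<lambda>x. \<phi> w * (bump x w)\<^sup>2) has_derivative blinfun_apply (?f x w)) (at x)" by simp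
      show "(\<lambda>w. \<phi> w * (bump x w)\<^sup>2) integrable_on cbox a b"
        by (intro integrable_continuous continuous_intros c\<phi>)
    qed (use cf in auto)
    show "continuous_on UNIV (\<lambda>x. integral (cbox a b) (?f x))"
      by (rule integral_continuous_on_param) (use cf[of "UNIV \<times> cbox a b"] in simp)
  qed (use int in auto)
qed

lemma C1_on_bump_integral:
  assumes "continuous_on UNIV \<phi>" shows "C1_on S (bump_integral \<phi>)"
proof -
  obtain F where "\<And>x. (bump_integral \<phi> has_derivative blinfun_apply (F x)) (at x)" "continuous_on UNIV F"
    by (rule bump_integral_derivative[OF assms]) (rule that)
  then have "C1_on UNIV (bump_integral \<phi>)" unfolding C1_on_def by blast
  then show ?thesis by (rule C1_on_subset) simp
qed

lemma bump_square_integrable: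
  assumes "continuous_on UNIV \<phi>" shows "(\<lambda>w. \<phi> w * (bump x w)\<^sup>2) integrable_on cbox a b"
  using continuous_on_subset[OF assms] by (intro integrable_continuous continuous_intros) auto

text \<open>The squared bump is at least \<open>depth x ^ 4 / 4\<close> on the ball of radius
  \<open>depth x / 8\<close>; multiplying by the volume of that ball explains the exponent and the
  constant.\<close>

lemma bump_integral_lower:
  assumes x: "x \<in> \<Omega>"
  shows "depth x ^ (DIM('a) + 4) * measure lborel (ball (0::'a) 1) \<le> 4 * 8 ^ DIM('a) * bump_integral (\<lambda>_. 1) x"
proof -
  let ?r = "depth x"
  have r: "?r > 0" using x depth_pos by simp
  let ?B = "ball x (?r / 8)"
  have ge: "?r\<^sup>2 / 2 \<le> bump x w" if "w \<in> ?B" for w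
    using that by (intro bump_ge) (simp add: dist_norm)
  have Bs: "?B \<subseteq> cbox a b"
  proof
    fix w assume "w \<in> ?B"
    moreover have "0 < ?r\<^sup>2 / 2" using r by simp
    ultimately have "bump x w > 0" using ge[of w] by linarith
    then have "w \<in> \<Omega>" by (intro bump_pos(2)[of x w]) simp
    then show "w \<in> cbox a b" using cbox closure_subset by blast
  qed
  have "(?r\<^sup>2 / 2)\<^sup>2 * measure lebesgue ?B = integral (cbox a b) (\<lambda>w. (?r\<^sup>2 / 2)\<^sup>2 * indicator ?B w)"
    using Bs by (simp add: integral_indicator Int_absorb2)
  also have "\<dots> \<le> bump_integral (\<lambda>_. 1) x"
    unfolding bump_integral_def
  proof (rule integral_le)
    show "(\<lambda>w. (?r\<^sup>2 / 2)\<^sup>2 * indicator ?B w) integrable_on cbox a b"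
      using Bs by (intro integrable_on_mult_right) (simp add: integrable_on_indicator Int_absorb2)
    show "(\<lambda>w. 1 * (bump x w)\<^sup>2) integrable_on cbox a b" by (rule bump_square_integrable) simp
    fix w show "(?r\<^sup>2 / 2)\<^sup>2 * indicator ?B w \<le> 1 * (bump x w)\<^sup>2"
      using power_mono[OF ge, of w 2] by (cases "w \<in> ?B") auto
  qed
  finally have "(?r\<^sup>2 / 2)\<^sup>2 * measure lborel ?B \<le> bump_integral (\<lambda>_. 1) x" by simp
  moreover have "measure lborel ?B = (?r / 8) ^ DIM('a) * measure lborel (ball (0::'a) 1)"
    using r by (intro content_ball_conv_unit_ball) simp
  ultimately have "?r ^ 4 / 4 * ((?r / 8) ^ DIM('a) * measure lborel (ball (0::'a) 1)) \<le> bump_integral (\<lambda>_. 1) x"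
    by (simp add: power_divide)
  then have le: "4 * 8 ^ DIM('a) * (?r ^ 4 / 4 * ((?r / 8) ^ DIM('a) * measure lborel (ball (0::'a) 1))) \<le> 4 * 8 ^ DIM('a) * bump_integral (\<lambda>_. 1) x"
    by (intro mult_left_mono) auto
  have eq: "4 * 8 ^ DIM('a) * (?r ^ 4 / 4 * ((?r / 8) ^ DIM('a) * measure lborel (ball (0::'a) 1)))
      = ?r ^ (DIM('a) + 4) * measure lborel (ball (0::'a) 1)"
    by (simp add: power_divide power_add)
  show ?thesis using le unfolding eq .
qed

lemma bump_integral_one_pos: "x \<in> \<Omega> \<Longrightarrow> 0 < bump_integral (\<lambda>_. 1) x"
proof -
  assume x: "x \<in> \<Omega>"
  have "0 < depth x ^ (DIM('a) + 4) * measure lborel (ball (0::'a) 1)"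
    using x by (intro mult_pos_pos zero_less_power content_ball_pos) (auto simp: depth_pos[symmetric])
  then have "0 < 4 * 8 ^ DIM('a) * bump_integral (\<lambda>_. 1) x" using bump_integral_lower[OF x] by linarith
  then show ?thesis by (simp add: zero_less_mult_iff)
qed

lemma bump_integral_bound:
  assumes \<phi>: "continuous_on UNIV \<phi>" and \<delta>: "\<And>w. w \<in> \<Omega> \<Longrightarrow> norm (x - w) \<le> depth x \<Longrightarrow> \<bar>\<phi> w\<bar> \<le> \<delta>"
  shows "\<bar>bump_integral \<phi> x\<bar> \<le> \<delta> * bump_integral (\<lambda>_. 1) x"
proof -
  have "norm (integral (cbox a b) (\<lambda>w. \<phi> w * (bump x w)\<^sup>2)) \<le> integral (cbox a b) (\<lambda>w. \<delta> * (1 * (bump x w)\<^sup>2))"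
  proof (rule integral_norm_bound_integral[OF bump_square_integrable[OF \<phi>]])
    show "(\<lambda>w. \<delta> * (1 * (bump x w)\<^sup>2)) integrable_on cbox a b"
      by (intro integrable_on_mult_right bump_square_integrable) simp
    fix w show "norm (\<phi> w * (bump x w)\<^sup>2) \<le> \<delta> * (1 * (bump x w)\<^sup>2)"
      using \<delta>[of w] bump_pos[of x w] by (cases "bump x w = 0") (auto simp: abs_mult intro!: mult_right_mono)
  qed
  then show ?thesis by (simp add: bump_integral_def)
qed

text \<open>On the support of the bump the operator under the integral has norm at most
  \<open>16 * \<delta> * (4 * (depth x)\<^sup>2) * depth x\<close>, and the support lies in a ball
  of radius \<open>depth x\<close>.\<close>

lemma bump_integral_derivative_bound:
  assumes \<phi>: "continuous_on UNIV \<phi>" and \<delta>: "\<And>w. w \<in> \<Omega> \<Longrightarrow> norm (x - w) \<le> depth x \<Longrightarrow> \<bar>\<phi> w\<bar> \<le> \<delta>"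
    and "0 \<le> \<delta>"
  shows "\<bar>frechet_derivative (bump_integral \<phi>) (at x) h\<bar> \<le> 64 * \<delta> * depth x ^ (DIM('a) + 3) * measure lborel (ball (0::'a) 1) * norm h"
proof -
  let ?r = "depth x" and ?B = "ball x (depth x)"
  let ?f = "\<lambda>w. (- 16 * \<phi> w * bump x w) *\<^sub>R blinfun_inner_left (x - w)"
  obtain F where F: "\<And>x. (bump_integral \<phi> has_derivative blinfun_apply (F x)) (at x)" "continuous_on UNIV F"
    "\<And>x. F x = integral (cbox a b) (\<lambda>w. (- 16 * \<phi> w * bump x w) *\<^sub>R blinfun_inner_left (x - w))"
    "\<And>x. (\<lambda>w. (- 16 * \<phi> w * bump x w) *\<^sub>R blinfun_inner_left (x - w)) integrable_on cbox a b"
    by (rule bump_integral_derivative[OF \<phi>]) (rule that)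
  have n: "norm (blinfun_inner_left v) \<le> norm v" for v :: 'a
    by (rule norm_blinfun_bound) (auto simp: mult.commute Cauchy_Schwarz_ineq2)
  have r: "0 \<le> ?r" by (rule depth_nonneg)
  let ?c = "16 * \<delta> * (4 * ?r\<^sup>2) * ?r"
  have c: "0 \<le> ?c" using \<open>0 \<le> \<delta>\<close> r by simp
  have "norm (F x) \<le> integral (cbox a b) (\<lambda>w. ?c * indicator ?B w)"
    unfolding F(3)
  proof (rule integral_norm_bound_integral[OF F(4)])
    show "(\<lambda>w. ?c * indicator ?B w) integrable_on cbox a b"
      by (intro integrable_on_mult_right) (simp add: integrable_on_indicator fmeasurable.Int fmeasurable_Int_fmeasurable)
    fix w
    show "norm (?f w) \<le> ?c * indicator ?B w"
    proof (cases "bump x w = 0")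
      case True
      then show ?thesis using c by simp
    next
      case False
      note b = bump_pos[OF False]
      have "norm (?f w) = 16 * \<bar>\<phi> w\<bar> * bump x w * norm (blinfun_inner_left (x - w))"
        using bump_nonneg[of x w] by (simp add: abs_mult)
      also have "\<dots> \<le> 16 * \<delta> * (4 * ?r\<^sup>2) * ?r"
        using b \<delta>[of w] n[of "x - w"] bump_nonneg[of x w] \<open>0 \<le> \<delta>\<close> by (intro mult_mono) auto
      finally show ?thesis using b(1) by (simp add: dist_norm)
    qed
  qed
  also have "\<dots> = ?c * measure lebesgue (?B \<inter> cbox a b)"
    by (simp add: integral_indicator fmeasurable_Int_fmeasurable)
  also have "\<dots> \<le> ?c * measure lebesgue ?B"
    using c by (intro mult_left_mono measure_mono_fmeasurable) auto
  also have "measure lebesgue ?B = ?r ^ DIM('a) * measure lborel (ball (0::'a) 1)"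
    using r content_ball_conv_unit_ball[of ?r x] by simp
  finally have nF: "norm (F x) \<le> ?c * (?r ^ DIM('a) * measure lborel (ball (0::'a) 1))" .
  have "frechet_derivative (bump_integral \<phi>) (at x) = blinfun_apply (F x)"
    using frechet_derivative_at[OF F(1)] by simp
  then have "\<bar>frechet_derivative (bump_integral \<phi>) (at x) h\<bar> \<le> norm (F x) * norm h"
    using norm_blinfun[of "F x" h] by simp
  also have "\<dots> \<le> ?c * (?r ^ DIM('a) * measure lborel (ball (0::'a) 1)) * norm h"
    using nF by (rule mult_right_mono) simp
  finally show ?thesis by (simp add: power_add power2_eq_square power3_eq_cube mult_ac)
qed

text \<open>Outside \<Omega> both bump integrals vanish, so the quotient would be meaningless; the
  value \<phi> chosen there makes the boundary values the prescribed ones.\<close>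

definition average :: "('a \<Rightarrow> real) \<Rightarrow> 'a \<Rightarrow> real" where
  "average \<phi> x = (if x \<in> \<Omega> then bump_integral \<phi> x * inverse (bump_integral (\<lambda>_. 1) x) else \<phi> x)"

lemma bump_integral_shift:
  assumes \<phi>: "continuous_on UNIV \<phi>"
  shows "bump_integral (\<lambda>w. \<phi> w - c) x = bump_integral \<phi> x - c * bump_integral (\<lambda>_. 1) x"
proof -
  have "bump_integral (\<lambda>w. \<phi> w - c) x = integral (cbox a b) (\<lambda>w. \<phi> w * (bump x w)\<^sup>2 - c * (1 * (bump x w)\<^sup>2))"
    unfolding bump_integral_def by (simp add: algebra_simps)
  also have "\<dots> = bump_integral \<phi> x - c * bump_integral (\<lambda>_. 1) x"
    unfolding bump_integral_def by (subst Henstock_Kurzweil_Integration.integral_diff)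
      (auto intro!: integrable_on_mult_right bump_square_integrable[OF \<phi>] bump_square_integrable[of "\<lambda>_. 1", simplified])
  finally show ?thesis .
qed

text \<open>The weights are normalised, so a constant may be subtracted before averaging. Taking a
  value of \<phi> for \<open>c\<close> leaves only its oscillation at the scale of the
  depth.\<close>

lemma average_shift:
  assumes "continuous_on UNIV \<phi>" "x \<in> \<Omega>"
  shows "average \<phi> x = c + bump_integral (\<lambda>w. \<phi> w - c) x * inverse (bump_integral (\<lambda>_. 1) x)"
  using bump_integral_one_pos[OF assms(2)] assms(2) by (simp add: average_def bump_integral_shift[OF assms(1)] field_simps)

lemma C1_on_average:
  assumes "continuous_on UNIV \<phi>" shows "C1_on \<Omega> (average \<phi>)"
proof -
  have "bump_integral (\<lambda>_. 1) x \<noteq> 0" if "x \<in> \<Omega>" for x using bump_integral_one_pos[OF that] by simp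
  then have "C1_on \<Omega> (\<lambda>x. bump_integral \<phi> x * inverse (bump_integral (\<lambda>_. 1) x))"
    by (intro C1_on_mult C1_on_inverse C1_on_bump_integral assms continuous_on_const)
  then show ?thesis by (rule C1_on_cong[OF _ open_\<Omega>]) (simp add: average_def)
qed

text \<open>After \<phi> is shifted by its value at \<open>x\<close>, both terms of the quotient
  rule obey the same bound, giving the factor 128 = 2 * 64. The lower bound for the denominator
  contributes \<open>4 * 8 ^ DIM('a)\<close>.\<close>

lemma average_derivative_bound:
  assumes \<phi>: "continuous_on UNIV \<phi>" and x: "x \<in> \<Omega>" and \<delta>: "\<And>w. w \<in> \<Omega> \<Longrightarrow> norm (x - w) \<le> depth x \<Longrightarrow> \<bar>\<phi> w - \<phi> x\<bar> \<le> \<delta>"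
  shows "\<bar>frechet_derivative (average \<phi>) (at x) h\<bar> \<le> 512 * 8 ^ DIM('a) * \<delta> / depth x * norm h"
proof -
  let ?\<psi> = "\<lambda>w. \<phi> w - \<phi> x" and ?M = "bump_integral (\<lambda>_. 1)" and ?r = "depth x" and ?\<beta> = "measure lborel (ball (0::'a) 1)"
  have r: "?r > 0" using x depth_pos by simp
  have \<delta>0: "0 \<le> \<delta>" using \<delta>[OF x] r by simp
  have c\<psi>: "continuous_on UNIV ?\<psi>" using \<phi> by (intro continuous_intros)
  have M: "?M x > 0" by (rule bump_integral_one_pos[OF x])
  let ?P = "frechet_derivative (bump_integral ?\<psi>) (at x)" and ?Q = "frechet_derivative ?M (at x)"
  have dP: "(bump_integral ?\<psi> has_derivative ?P) (at x)" and dQ: "(?M has_derivative ?Q) (at x)"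
    by (intro C1_on_frechet[OF C1_on_bump_integral[where S = UNIV]] c\<psi> continuous_on_const UNIV_I)+
  have "((\<lambda>y. \<phi> x + bump_integral ?\<psi> y * inverse (?M y)) has_derivative
      (\<lambda>h. bump_integral ?\<psi> x * - (inverse (?M x) * ?Q h * inverse (?M x)) + ?P h * inverse (?M x))) (at x)"
    using M by (intro has_derivative_add_const[THEN has_derivative_eq_rhs] derivative_eq_intros)
      (auto intro!: derivative_eq_intros dP dQ)
  then have "(average \<phi> has_derivative
      (\<lambda>h. bump_integral ?\<psi> x * - (inverse (?M x) * ?Q h * inverse (?M x)) + ?P h * inverse (?M x))) (at x)"
    by (rule has_derivative_transform_within_open[OF _ open_\<Omega> x]) (simp add: average_shift[OF \<phi>, where c = "\<phi> x"])
  from fun_cong[OF frechet_derivative_at[OF this], of h]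
  have eq: "frechet_derivative (average \<phi>) (at x) h = bump_integral ?\<psi> x * - (inverse (?M x) * ?Q h * inverse (?M x)) + ?P h * inverse (?M x)"
    by (rule sym)
  let ?C = "64 * ?r ^ (DIM('a) + 3) * ?\<beta> * norm h"
  have C0: "0 \<le> ?C" using r by simp
  have 1: "\<bar>?P h\<bar> \<le> \<delta> * ?C"
    using bump_integral_derivative_bound[of ?\<psi> x \<delta> h, OF c\<psi> \<delta> \<delta>0] by (simp add: mult_ac)
  have 2: "\<bar>?Q h\<bar> \<le> ?C"
    using bump_integral_derivative_bound[of "\<lambda>_. 1" x 1 h] by (simp add: mult_ac)
  have 3: "\<bar>bump_integral ?\<psi> x\<bar> \<le> \<delta> * ?M x" by (rule bump_integral_bound[OF c\<psi> \<delta>])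
  have "\<bar>frechet_derivative (average \<phi>) (at x) h\<bar> \<le> \<bar>bump_integral ?\<psi> x\<bar> * (inverse (?M x) * \<bar>?Q h\<bar> * inverse (?M x)) + \<bar>?P h\<bar> * inverse (?M x)"
    unfolding eq using M by (intro order_trans[OF abs_triangle_ineq]) (simp add: abs_mult)
  also have "\<dots> \<le> (\<delta> * ?M x) * (inverse (?M x) * ?C * inverse (?M x)) + (\<delta> * ?C) * inverse (?M x)"
    using 1 2 3 M \<delta>0 C0 by (intro add_mono mult_mono) auto
  also have "\<dots> = 2 * \<delta> * ?C / ?M x" using M by (simp add: field_simps)
  also have "\<dots> = 128 * \<delta> * norm h / ?r * (?r ^ (DIM('a) + 4) * ?\<beta>) / ?M x"
    using r by (simp add: power_add field_simps eval_nat_numeral)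
  also have "\<dots> \<le> 128 * \<delta> * norm h / ?r * (4 * 8 ^ DIM('a) * ?M x) / ?M x"
    using bump_integral_lower[OF x] M r \<delta>0 by (intro divide_right_mono mult_left_mono) auto
  also have "\<dots> = 512 * 8 ^ DIM('a) * \<delta> / ?r * norm h" using M by (simp add: field_simps)
  finally show ?thesis .
qed

lemma continuous_on_average:
  assumes \<phi>: "continuous_on UNIV \<phi>" shows "continuous_on (closure \<Omega>) (average \<phi>)"
  unfolding continuous_on_eq_continuous_within
proof
  fix z assume z: "z \<in> closure \<Omega>"
  show "continuous (at z within closure \<Omega>) (average \<phi>)"
  proof (cases "z \<in> \<Omega>")
    case True
    then have "isCont (average \<phi>) z"
      using C1_on_imp_continuous_on[OF C1_on_average[OF \<phi>]] open_\<Omega> by (simp add: continuous_on_eq_continuous_at)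
    then show ?thesis by (rule continuous_at_imp_continuous_within)
  next
    case False
    show ?thesis unfolding continuous_within_eps_delta
    proof (intro allI impI)
      fix e :: real assume e: "e > 0"
      have "isCont \<phi> z" using \<phi> by (simp add: continuous_on_eq_continuous_at)
      then obtain d where d: "d > 0" "\<And>w. dist w z < d \<Longrightarrow> dist (\<phi> w) (\<phi> z) < e / 2"
        using e unfolding continuous_at_eps_delta by (meson half_gt_zero)
      \<comment> \<open>Since \<Omega> does not contain \<open>z\<close>, the depth at
        \<open>x\<close> is at most \<open>dist x z\<close>, so all points averaged at
        \<open>x\<close> lie within twice that distance of \<open>z\<close>; hence the radius
        \<open>d / 2\<close>.\<close>
      show "\<exists>d>0. \<forall>x\<in>closure \<Omega>. dist x z < d \<longrightarrow> dist (average \<phi> x) (average \<phi> z) < e"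
      proof (intro exI[of _ "d/2"] conjI ballI impI)
        fix x assume x: "x \<in> closure \<Omega>" "dist x z < d / 2"
        have az: "average \<phi> z = \<phi> z" using False by (simp add: average_def)
        show "dist (average \<phi> x) (average \<phi> z) < e"
        proof (cases "x \<in> \<Omega>")
          case True
          have dx: "depth x \<le> dist x z" unfolding depth_def using False by (intro infdist_le) simp
          have "\<bar>bump_integral (\<lambda>w. \<phi> w - \<phi> z) x\<bar> \<le> e / 2 * bump_integral (\<lambda>_. 1) x"
          proof (rule bump_integral_bound)
            show "continuous_on UNIV (\<lambda>w. \<phi> w - \<phi> z)" using \<phi> by (intro continuous_intros)
            fix w assume "norm (x - w) \<le> depth x"
            then have "dist w z < d"
              using dx x(2) dist_triangle[of w z x] by (simp add: dist_norm norm_minus_commute)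
            from d(2)[OF this] show "\<bar>\<phi> w - \<phi> z\<bar> \<le> e / 2" by (simp add: dist_real_def)
          qed
          then have "\<bar>bump_integral (\<lambda>w. \<phi> w - \<phi> z) x * inverse (bump_integral (\<lambda>_. 1) x)\<bar> \<le> e / 2"
            using bump_integral_one_pos[OF True] by (simp add: abs_mult field_simps)
          then show ?thesis using average_shift[OF \<phi> True, of "\<phi> z"] e az by (simp add: dist_real_def)
        next
          case False
          then have "average \<phi> x = \<phi> x" by (simp add: average_def)
          moreover have "dist (\<phi> x) (\<phi> z) < e / 2" using x(2) d by (intro d(2)) linarith
          ultimately show ?thesis using e az by simp
        qed
      qed (use d in simp)
    qed
  qed
qed

end

section \<open>Box dimension of the boundary\<close>

text \<open>Any exponent strictly above the upper limit bounds the covering numbers for all small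
  radii. The infimum of naturals is attained once some finite cover exists, and compactness of the
  closure provides one.\<close>

lemma box_dim_covering:
  fixes K :: "'a::euclidean_space set"
  assumes K: "bounded K" and d: "box_dim K = ereal d" "d < d'"
  shows "eventually (\<lambda>\<epsilon>. \<exists>A. finite A \<and> K \<subseteq> (\<Union>a\<in>A. ball a \<epsilon>) \<and> real (card A) \<le> \<epsilon> powr - d') (at_right (0::real))"
proof -
  have "Limsup (at_right (0::real)) (\<lambda>\<epsilon>. ereal (ln (real (covering_number \<epsilon> K)) / ln (1 / \<epsilon>))) < ereal d'"
    using d by (simp add: box_dim_def)
  then have "eventually (\<lambda>\<epsilon>. ereal (ln (real (covering_number \<epsilon> K)) / ln (1 / \<epsilon>)) < ereal d') (at_right 0)"
    by (rule Limsup_lessD)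
  moreover have "eventually (\<lambda>\<epsilon>::real. \<epsilon> \<in> {0<..<1}) (at_right 0)"
    by (rule eventually_at_right_real) simp
  ultimately show ?thesis
  proof eventually_elim
    case (elim \<epsilon>)
    let ?S = "{card A |A. finite A \<and> K \<subseteq> (\<Union>a\<in>A. ball a \<epsilon>)}"
    have "compact (closure K)" using K by simp
    then obtain A0 where "A0 \<subseteq> closure K" "finite A0" "closure K \<subseteq> (\<Union>a\<in>A0. ball a \<epsilon>)"
      using compactE_image[of "closure K" "closure K" "\<lambda>a. ball a \<epsilon>"] elim(2) by force
    then have "finite A0 \<and> K \<subseteq> (\<Union>a\<in>A0. ball a \<epsilon>)" using closure_subset by blast
    then have "?S \<noteq> {}" by blast
    then have "covering_number \<epsilon> K \<in> ?S" unfolding covering_number_def by (rule Inf_nat_def1)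
    then obtain A where A: "finite A" "K \<subseteq> (\<Union>a\<in>A. ball a \<epsilon>)" "card A = covering_number \<epsilon> K" by auto
    have "real (card A) \<le> \<epsilon> powr - d'"
    proof (cases "card A = 0")
      \<comment> \<open>For an empty cover the logarithm has only its default value, but the claim
        is then trivial.\<close>
      case False
      have l: "0 < ln (1 / \<epsilon>)" using elim(2) by simp
      have "ln (real (card A)) / ln (1 / \<epsilon>) < d'" using elim(1) A(3) by simp
      then have "ln (real (card A)) < d' * ln (1 / \<epsilon>)" using l by (simp add: divide_less_eq)
      then have "ln (real (card A)) < ln (\<epsilon> powr - d')" using elim(2) by (simp add: ln_div ln_powr)
      then have "real (card A) < \<epsilon> powr - d'"
        using False elim(2) by (subst (asm) ln_less_cancel_iff) auto
      then show ?thesis by simp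
    qed simp
    then show ?case using A by blast
  qed
qed

context distance_bump
begin

text \<open>A segment from a point of the collar to a point outside \<Omega> at distance less than
  \<epsilon> meets the frontier. Doubling the radii of the balls that cover the frontier thus covers
  the collar.\<close>

lemma collar_measure:
  fixes d d' :: real
  assumes d: "box_dim (frontier \<Omega>) = ereal d" "d < d'"
  shows "eventually (\<lambda>\<epsilon>. measure lborel {x \<in> \<Omega>. depth x < \<epsilon>}
    \<le> 2 ^ DIM('a) * measure lborel (ball (0::'a) 1) * \<epsilon> powr (real DIM('a) - d')) (at_right 0)"
proof -
  have b: "bounded (frontier \<Omega>)" by (rule compact_imp_bounded[OF compact_frontier_bounded[OF bounded_\<Omega>]])
  have "eventually (\<lambda>\<epsilon>::real. \<epsilon> \<in> {0<..<1}) (at_right 0)"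
    by (rule eventually_at_right_real) simp
  with box_dim_covering[OF b d] show ?thesis
  proof eventually_elim
    case (elim \<epsilon>)
    then obtain A where A: "finite A" "frontier \<Omega> \<subseteq> (\<Union>a\<in>A. ball a \<epsilon>)" "real (card A) \<le> \<epsilon> powr - d'" by blast
    have sub: "{x \<in> \<Omega>. depth x < \<epsilon>} \<subseteq> (\<Union>a\<in>A. ball a (2 * \<epsilon>))"
    proof
      fix x assume "x \<in> {x \<in> \<Omega>. depth x < \<epsilon>}"
      then have x: "x \<in> \<Omega>" "depth x < \<epsilon>" by auto
      have "- \<Omega> \<noteq> {}" using bounded_\<Omega> not_bounded_UNIV by (metis double_compl Compl_UNIV_eq)
      then obtain z where z: "z \<notin> \<Omega>" "dist x z < \<epsilon>"
        using x(2) infdist_notempty[of "- \<Omega>" x] cInf_less_iff[of "(dist x) ` (- \<Omega>)" \<epsilon>]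
        unfolding depth_def by (auto simp: image_image)
      have "closed_segment x z \<inter> frontier \<Omega> \<noteq> {}"
        using x(1) z(1) by (intro connected_Int_frontier connected_segment) auto
      then obtain p where p: "p \<in> closed_segment x z" "p \<in> frontier \<Omega>" by blast
      have "dist x p \<le> dist x z" using segment_bound(1)[OF p(1)] by (simp add: dist_norm norm_minus_commute)
      moreover obtain a where "a \<in> A" "dist a p < \<epsilon>" using A(2) p(2) by auto
      ultimately show "x \<in> (\<Union>a\<in>A. ball a (2 * \<epsilon>))"
        using z(2) dist_triangle[of a x p] by (intro UN_I[of a]) (auto simp: dist_commute)
    qed
    have fin: "(\<Union>a\<in>A. ball a (2 * \<epsilon>)) \<in> fmeasurable lborel"
      using A(1) by (intro fmeasurable.finite_UN fmeasurableI emeasure_bounded_finite bounded_ball) auto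
    have "open {x \<in> \<Omega>. depth x < \<epsilon>}"
      using open_\<Omega> by (intro open_Collect_conj open_Collect_less continuous_intros) (auto intro: continuous_intros)
    then have "measure lborel {x \<in> \<Omega>. depth x < \<epsilon>} \<le> measure lborel (\<Union>a\<in>A. ball a (2 * \<epsilon>))"
      using fin by (intro measure_mono_fmeasurable[OF sub]) auto
    also have "\<dots> \<le> (\<Sum>a\<in>A. measure lborel (ball a (2 * \<epsilon>)))"
      using A(1) by (intro measure_UNION_le) auto
    also have "\<dots> = real (card A) * ((2 * \<epsilon>) ^ DIM('a) * measure lborel (ball (0::'a) 1))"
      using elim(2) content_ball_conv_unit_ball[of "2 * \<epsilon>" "a::'a" for a] by simp
    also have "\<dots> \<le> \<epsilon> powr - d' * ((2 * \<epsilon>) ^ DIM('a) * measure lborel (ball (0::'a) 1))"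
      using A(3) elim(2) by (intro mult_right_mono) auto
    also have "\<dots> = 2 ^ DIM('a) * measure lborel (ball (0::'a) 1) * \<epsilon> powr (real DIM('a) - d')"
      using elim(2) by (simp add: power_mult_distrib powr_diff powr_minus powr_realpow divide_inverse)
    finally show ?case .
  qed
qed

text \<open>Summed over dyadic shells, the function is about \<open>t powr - s\<close> on a shell of
  depth about \<open>t\<close>, whose volume is at most a constant times
  \<open>t powr (real DIM('a) - d')\<close>. The series is geometric because
  \<open>d' < real DIM('a) - s\<close>.\<close>

lemma depth_powr_integrable:
  fixes d s :: real
  assumes d: "box_dim (frontier \<Omega>) = ereal d" and s: "0 \<le> s" "d < real DIM('a) - s"
  shows "set_integrable lborel \<Omega> (\<lambda>x. depth x powr - s)"
proof -
  define d' where "d' = (d + (real DIM('a) - s)) / 2"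
  have d': "d < d'" "d' < real DIM('a) - s" using s by (auto simp: d'_def)
  define c where "c = 2 ^ DIM('a) * measure lborel (ball (0::'a) 1)"
  have c0: "0 \<le> c" by (simp add: c_def)
  obtain e where e: "e > 0" "\<And>\<epsilon>. 0 < \<epsilon> \<Longrightarrow> \<epsilon> < e \<Longrightarrow> measure lborel {x \<in> \<Omega>. depth x < \<epsilon>} \<le> c * \<epsilon> powr (real DIM('a) - d')"
    using collar_measure[OF d d'(1)] unfolding c_def eventually_at_right_field by auto
  obtain k0 where k0: "(1/2::real) ^ k0 < e" using e(1) real_arch_pow_inv[of e "1/2"] by auto
  define t :: "nat \<Rightarrow> real" where "t k = (1/2) ^ (k0 + k)" for k
  have t0: "0 < t k" for k by (simp add: t_def)
  have te: "t k < e" for k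
  proof -
    have "t k \<le> (1/2) ^ k0" unfolding t_def by (rule power_decreasing) auto
    then show ?thesis using k0 by linarith
  qed
  define E where "E k = {x \<in> \<Omega>. depth x < t k}" for k
  have oE: "open (E k)" for k unfolding E_def
    using open_\<Omega> by (intro open_Collect_conj open_Collect_less continuous_intros) (auto intro: continuous_intros)
  have finE: "emeasure lborel (E k) < \<infinity>" for k
    using bounded_\<Omega> by (intro emeasure_bounded_finite) (auto simp: E_def intro: bounded_subset)
  have fin\<Omega>: "emeasure lborel \<Omega> < \<infinity>" using bounded_\<Omega> by (rule emeasure_bounded_finite)
  let ?g = "\<lambda>x. depth x powr - s"
  \<comment> \<open>A point with \<open>t (Suc k) \<le> depth x < t k\<close> is accounted for by
    the summand \<open>k\<close> alone, a point of depth at least \<open>t 0\<close> by the term in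
    front of the series.\<close>
  have pt: "ennreal (?g x) * indicator \<Omega> x \<le> ennreal (t 0 powr - s) * indicator \<Omega> x
      + (\<Sum>k. ennreal (t (Suc k) powr - s) * indicator (E k) x)" for x
  proof (cases "x \<in> \<Omega>")
    case True
    then have dx: "depth x > 0" by (simp add: depth_pos)
    show ?thesis
    proof (cases "depth x < t 0")
      case False
      then have "?g x \<le> t 0 powr - s" using s(1) t0[of 0] by (intro powr_mono2') auto
      then have "ennreal (?g x) \<le> ennreal (t 0 powr - s)" by (rule ennreal_leI)
      then have "ennreal (?g x) * indicator \<Omega> x \<le> ennreal (t 0 powr - s) * indicator \<Omega> x"
        by (rule mult_right_mono) simp
      then show ?thesis by (rule add_increasing2[rotated]) simp
    next
      case less: True
      have ex: "\<exists>k. t (Suc k) \<le> depth x"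
      proof -
        obtain m where "(1/2::real) ^ m < depth x" using dx real_arch_pow_inv[of "depth x" "1/2"] by auto
        moreover have "t (Suc m) \<le> (1/2) ^ m" unfolding t_def by (intro power_decreasing) auto
        ultimately show ?thesis by (meson less_imp_le order_trans)
      qed
      define k where "k = (LEAST k. t (Suc k) \<le> depth x)"
      have k: "t (Suc k) \<le> depth x" unfolding k_def using ex by (rule LeastI_ex)
      have "depth x < t k"
      proof (cases k)
        case (Suc j)
        then show ?thesis using not_less_Least[of j "\<lambda>k. t (Suc k) \<le> depth x"] by (simp add: k_def)
      qed (use less in simp)
      then have xE: "x \<in> E k" using True by (simp add: E_def)
      have "?g x \<le> t (Suc k) powr - s" using s(1) t0[of "Suc k"] k by (intro powr_mono2') auto
      then have "ennreal (?g x) * indicator \<Omega> x \<le> ennreal (t (Suc k) powr - s) * indicator (E k) x"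
        using True xE by (simp add: ennreal_leI)
      also have "\<dots> \<le> (\<Sum>k. ennreal (t (Suc k) powr - s) * indicator (E k) x)"
      proof -
        define F where "F j = ennreal (t (Suc j) powr - s) * indicator (E j) x" for j
        have "F k \<le> (\<Sum>j. F j)" using sum_le_suminf[of F "{k}"] by simp
        then show ?thesis unfolding F_def .
      qed
      finally show ?thesis by (rule add_increasing[rotated]) simp
    qed
  qed simp
  define \<rho> where "\<rho> = (1/2) powr (real DIM('a) - d' - s)"
  have \<rho>: "0 < \<rho>" "\<rho> < 1" using d'(2) by (auto simp: \<rho>_def powr01_less_one)
  have term_le: "ennreal (t (Suc k) powr - s) * emeasure lborel (E k) \<le> ennreal (c * 2 powr s * \<rho> ^ (k0 + k))" for k
  proof -
    have tk: "t k = (1/2) powr real (k0 + k)" by (subst powr_realpow) (simp_all add: t_def)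
    have "t (Suc k) powr - s = 2 powr s * t k powr - s"
    proof -
      have tS: "t (Suc k) = t k / 2" by (simp add: t_def)
      show ?thesis unfolding tS using t0[of k] by (subst powr_divide) (simp_all add: powr_minus_divide)
    qed
    then have "t (Suc k) powr - s * measure lborel (E k) \<le> 2 powr s * t k powr - s * (c * t k powr (real DIM('a) - d'))"
      using e(2)[OF t0 te, of k] by (auto simp: E_def intro!: mult_left_mono)
    also have "\<dots> = c * 2 powr s * t k powr (real DIM('a) - d' - s)"
    proof -
      have "t k powr (real DIM('a) - d' - s) = t k powr - s * t k powr (real DIM('a) - d')"
        by (simp add: powr_add[symmetric])
      then show ?thesis by (simp only: mult_ac)
    qed
    also have "t k powr (real DIM('a) - d' - s) = \<rho> ^ (k0 + k)"
    proof -
      have "\<rho> ^ (k0 + k) = \<rho> powr real (k0 + k)" using \<rho>(1) by (simp only: powr_realpow)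
      then show ?thesis unfolding tk \<rho>_def by (simp only: powr_powr mult.commute)
    qed
    finally have "ennreal (t (Suc k) powr - s * measure lborel (E k)) \<le> ennreal (c * 2 powr s * \<rho> ^ (k0 + k))"
      by (rule ennreal_leI)
    then show ?thesis using finE[of k] by (simp add: emeasure_eq_ennreal_measure ennreal_mult)
  qed
  have "(\<integral>\<^sup>+x. ennreal (?g x) * indicator \<Omega> x \<partial>lborel) \<le> (\<integral>\<^sup>+x. (ennreal (t 0 powr - s) * indicator \<Omega> x
      + (\<Sum>k. ennreal (t (Suc k) powr - s) * indicator (E k) x)) \<partial>lborel)"
    by (intro nn_integral_mono pt)
  also have "\<dots> = ennreal (t 0 powr - s) * emeasure lborel \<Omega> + (\<Sum>k. ennreal (t (Suc k) powr - s) * emeasure lborel (E k))"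
  proof -
    have [measurable]: "\<Omega> \<in> sets borel" "E k \<in> sets borel" for k using open_\<Omega> oE by auto
    show ?thesis by (simp add: nn_integral_add nn_integral_suminf nn_integral_cmult_indicator)
  qed
  also have "\<dots> \<le> ennreal (t 0 powr - s) * emeasure lborel \<Omega> + (\<Sum>k. ennreal (c * 2 powr s * \<rho> ^ (k0 + k)))"
    by (intro add_left_mono suminf_le term_le summableI)
  also have "\<dots> < \<infinity>"
  proof -
    have "summable (\<lambda>k. c * 2 powr s * \<rho> ^ (k0 + k))"
      unfolding power_add using \<rho> by (intro summable_mult summable_geometric) auto
    then have "(\<Sum>k. ennreal (c * 2 powr s * \<rho> ^ (k0 + k))) = ennreal (\<Sum>k. c * 2 powr s * \<rho> ^ (k0 + k))"
      using c0 \<rho> by (intro suminf_ennreal_eq summable_sums) auto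
    then show ?thesis using fin\<Omega> by (simp add: ennreal_mult_less_top)
  qed
  finally have fin: "(\<integral>\<^sup>+x. ennreal (?g x) * indicator \<Omega> x \<partial>lborel) < \<infinity>" .
  show ?thesis unfolding set_integrable_def
  proof (rule integrableI_bounded)
    have "continuous_on \<Omega> ?g" by (intro continuous_intros) (auto simp: depth_pos)
    then show "(\<lambda>x. indicator \<Omega> x *\<^sub>R ?g x) \<in> borel_measurable lborel"
      using borel_measurable_continuous_on_indicator[OF borel_open[OF open_\<Omega>], of ?g] by simp
    have "(\<integral>\<^sup>+x. ennreal (norm (indicator \<Omega> x *\<^sub>R ?g x)) \<partial>lborel) = (\<integral>\<^sup>+x. ennreal (?g x) * indicator \<Omega> x \<partial>lborel)"
      by (intro nn_integral_cong) (auto simp: indicator_def)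
    then show "(\<integral>\<^sup>+x. ennreal (norm (indicator \<Omega> x *\<^sub>R ?g x)) \<partial>lborel) < \<infinity>" using fin by simp
  qed
qed

end

text \<open>At most \<open>\<epsilon> powr - d'\<close> balls of radius \<epsilon> cover
  \<open>K\<close>, and each piece is mapped into a box whose \<open>i\<close>-th side is a constant
  times \<open>\<epsilon> powr \<alpha> i\<close>. The total volume tends to 0 since the exponents
  sum to more than \<open>d'\<close>.\<close>

lemma negligible_holder_image:
  fixes f :: "'a::euclidean_space \<Rightarrow> real^'n::finite"
  assumes K: "bounded K" and d: "box_dim K = ereal d" "d < (\<Sum>i\<in>UNIV. \<alpha> i)"
    and f: "\<And>i x y. x \<in> K \<Longrightarrow> y \<in> K \<Longrightarrow> \<bar>f x $ i - f y $ i\<bar> \<le> H i * dist x y powr \<alpha> i"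
    and \<alpha>: "\<And>i. 0 \<le> \<alpha> i" and H: "\<And>i. 0 \<le> H i"
  shows "negligible (f ` K)"
  unfolding negligible_outer
proof (intro allI impI)
  fix e :: real assume e: "e > 0"
  define d' where "d' = (d + (\<Sum>i\<in>UNIV. \<alpha> i)) / 2"
  have d': "d < d'" "d' < (\<Sum>i\<in>UNIV. \<alpha> i)" using d(2) by (auto simp: d'_def)
  define c where "c = (\<Prod>i\<in>UNIV. 2 * H i * 2 powr \<alpha> i)"
  have "((\<lambda>\<epsilon>::real. c * \<epsilon> powr ((\<Sum>i\<in>UNIV. \<alpha> i) - d')) \<longlongrightarrow> c * 0) (at_right 0)"
    using d'(2) by (intro tendsto_mult_left tendsto_zero_powrI[where b = "(\<Sum>i\<in>UNIV. \<alpha> i) - d'"])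
      (auto intro!: tendsto_intros eventually_at_right_less[THEN eventually_mono])
  then have "eventually (\<lambda>\<epsilon>. c * \<epsilon> powr ((\<Sum>i\<in>UNIV. \<alpha> i) - d') < e) (at_right 0)"
    using e by (intro order_tendstoD) simp_all
  moreover have "eventually (\<lambda>\<epsilon>::real. \<epsilon> \<in> {0<..<1}) (at_right 0)"
    by (rule eventually_at_right_real) simp
  ultimately have "eventually (\<lambda>\<epsilon>. c * \<epsilon> powr ((\<Sum>i\<in>UNIV. \<alpha> i) - d') < e \<and> \<epsilon> \<in> {0<..<1} \<and>
      (\<exists>A. finite A \<and> K \<subseteq> (\<Union>a\<in>A. ball a \<epsilon>) \<and> real (card A) \<le> \<epsilon> powr - d')) (at_right 0)"
    using box_dim_covering[OF K d(1) d'(1)] by eventually_elim blast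
  from eventually_happens[OF this] obtain \<epsilon> A where \<epsilon>: "c * \<epsilon> powr ((\<Sum>i\<in>UNIV. \<alpha> i) - d') < e" "0 < \<epsilon>"
    and A: "finite A" "K \<subseteq> (\<Union>a\<in>A. ball a \<epsilon>)" "real (card A) \<le> \<epsilon> powr - d'" by auto
  \<comment> \<open>The centres of the balls need not lie in \<open>K\<close>, where alone
    \<open>f\<close> is controlled. Replacing them by points of \<open>K\<close> doubles the
    distances, hence the \<open>2 * \<epsilon>\<close> below.\<close>
  define p where "p a = (SOME x. x \<in> K \<inter> ball a \<epsilon>)" for a
  define v :: "real^'n" where "v = (\<chi> i. H i * (2 * \<epsilon>) powr \<alpha> i)"
  define Q where "Q a = cbox (f (p a) - v) (f (p a) + v)" for a
  have v0: "0 \<le> v $ i" for i using H by (simp add: v_def)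
  show "\<exists>T. f ` K \<subseteq> T \<and> T \<in> lmeasurable \<and> measure lebesgue T < e"
  proof (intro exI[of _ "\<Union>a\<in>A. Q a"] conjI)
    show "f ` K \<subseteq> (\<Union>a\<in>A. Q a)"
    proof
      fix z assume "z \<in> f ` K"
      then obtain x where x: "x \<in> K" "z = f x" by blast
      then obtain a where a: "a \<in> A" "x \<in> K \<inter> ball a \<epsilon>" using A(2) by blast
      have pa: "p a \<in> K \<inter> ball a \<epsilon>" unfolding p_def using a(2) by (rule someI)
      have "dist x (p a) \<le> 2 * \<epsilon>" using a(2) pa dist_triangle2[of x "p a" a] by (simp add: dist_commute)
      then have "dist x (p a) powr \<alpha> i \<le> (2 * \<epsilon>) powr \<alpha> i" for i using \<alpha> by (intro powr_mono2) auto
      then have "\<bar>f x $ i - f (p a) $ i\<bar> \<le> v $ i" for i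
        using f[of x "p a" i] pa x(1) H[of i] unfolding v_def by (auto intro: order_trans mult_left_mono)
      then have "f x \<in> Q a" unfolding Q_def mem_box_cart by (auto simp: abs_le_iff diff_le_eq le_diff_eq algebra_simps)
      then show "z \<in> (\<Union>a\<in>A. Q a)" using a(1) x(2) by blast
    qed
    show "(\<Union>a\<in>A. Q a) \<in> lmeasurable" using A(1) by (intro fmeasurable.finite_UN) (auto simp: Q_def)
    have mQ: "measure lebesgue (Q a) = c * \<epsilon> powr (\<Sum>i\<in>UNIV. \<alpha> i)" for a
    proof -
      have "cbox (f (p a) - v) (f (p a) + v) \<noteq> {}" using v0 by (auto simp: interval_ne_empty_cart)
      then have "measure lebesgue (Q a) = (\<Prod>i\<in>UNIV. 2 * v $ i)"
        unfolding Q_def by (simp add: content_cbox_cart)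
      also have "\<dots> = (\<Prod>i\<in>UNIV. (2 * H i * 2 powr \<alpha> i) * \<epsilon> powr \<alpha> i)"
        using \<epsilon>(2) by (simp add: v_def powr_mult mult_ac)
      also have "\<dots> = c * \<epsilon> powr (\<Sum>i\<in>UNIV. \<alpha> i)"
        using \<epsilon>(2) unfolding c_def prod.distrib by (simp add: powr_sum)
      finally show ?thesis .
    qed
    have "c \<ge> 0" unfolding c_def using H by (intro prod_nonneg) auto
    have "measure lebesgue (\<Union>a\<in>A. Q a) \<le> (\<Sum>a\<in>A. measure lebesgue (Q a))"
      using A(1) by (intro measure_UNION_le) (auto simp: Q_def)
    also have "\<dots> = real (card A) * (c * \<epsilon> powr (\<Sum>i\<in>UNIV. \<alpha> i))" by (simp add: mQ)
    also have "\<dots> \<le> \<epsilon> powr - d' * (c * \<epsilon> powr (\<Sum>i\<in>UNIV. \<alpha> i))"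
      using A(3) \<open>c \<ge> 0\<close> by (intro mult_right_mono) auto
    also have "\<dots> = c * \<epsilon> powr ((\<Sum>i\<in>UNIV. \<alpha> i) - d')"
      using \<epsilon>(2) by (simp add: powr_diff powr_minus divide_inverse)
    finally show "measure lebesgue (\<Union>a\<in>A. Q a) < e" using \<epsilon>(1) by simp
  qed
qed

section \<open>Integrals against the degree\<close>

text \<open>The bound may vary from row to row, which is what lets every component of a map keep its
  own Hoelder exponent.\<close>

lemma abs_det_le:
  fixes A :: "real^'n^'n"
  assumes "\<And>i j. \<bar>A $ i $ j\<bar> \<le> B i" shows "\<bar>det A\<bar> \<le> fact CARD('n) * (\<Prod>i\<in>UNIV. B i)"
proof -
  have "\<bar>det A\<bar> \<le> (\<Sum>p | p permutes UNIV. \<bar>of_int (sign p) * (\<Prod>i\<in>UNIV. A $ i $ p i)\<bar>)"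
    unfolding det_def by (rule sum_abs)
  also have "\<dots> \<le> (\<Sum>p | p permutes (UNIV :: 'n set). (\<Prod>i\<in>UNIV. B i))"
  proof (rule sum_mono)
    fix p :: "'n \<Rightarrow> 'n"
    have "\<bar>of_int (sign p) * (\<Prod>i\<in>UNIV. A $ i $ p i)\<bar> = (\<Prod>i\<in>UNIV. \<bar>A $ i $ p i\<bar>)"
      by (simp add: abs_mult abs_prod flip: of_int_abs)
    also have "\<dots> \<le> (\<Prod>i\<in>UNIV. B i)" using assms by (intro prod_mono) auto
    finally show "\<bar>of_int (sign p) * (\<Prod>i\<in>UNIV. A $ i $ p i)\<bar> \<le> (\<Prod>i\<in>UNIV. B i)" .
  qed
  also have "\<dots> = fact CARD('n) * (\<Prod>i\<in>UNIV. B i)" by (simp add: card_permutations)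
  finally show ?thesis .
qed

text \<open>\<open>C\<close> is obtained before \<open>f\<close> and \<open>H\<close>, so it depends
  on \<Omega> and the exponents alone; this is the uniformity that the theorem claims. Its factor
  \<open>K\<close> comes from \<open>average_derivative_bound\<close>, the factorial from the
  Leibniz formula.\<close>

lemma jacobian_extension_exists:
  fixes \<Omega> :: "(real^'n::finite) set" and d :: real
  assumes \<Omega>: "open \<Omega>" "bounded \<Omega>" and d: "box_dim (frontier \<Omega>) = ereal d"
    and \<alpha>: "\<And>i. \<alpha> i \<le> 1" "d < (\<Sum>i\<in>UNIV. \<alpha> i)"
  obtains C where "0 \<le> C" "\<And>f H. continuous_on (closure \<Omega>) f \<Longrightarrow> (\<And>i. 0 \<le> H i) \<Longrightarrow>
     (\<And>i x y. x \<in> \<Omega> \<Longrightarrow> y \<in> \<Omega> \<Longrightarrow> \<bar>f x $ i - f y $ i\<bar> \<le> H i * dist x y powr \<alpha> i) \<Longrightarrow> (\<And>i. 0 \<le> \<alpha> i) \<Longrightarrow>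
     \<exists>u. boundary_extension \<Omega> f u \<and> (LINT x:\<Omega>|lborel. \<bar>jacobian_det u x\<bar>) \<le> C * (\<Prod>i\<in>UNIV. H i)"
proof -
  have "bounded (closure \<Omega>)" using \<Omega>(2) by (rule bounded_closure)
  then obtain a b where "closure \<Omega> \<subseteq> cbox a b" using bounded_subset_cbox_symmetric by blast
  then interpret distance_bump \<Omega> a b using \<Omega> by unfold_locales
  let ?n = "CARD('n)"
  define s where "s = real ?n - (\<Sum>i\<in>UNIV. \<alpha> i)"
  have "(\<Sum>i\<in>UNIV. \<alpha> i) \<le> (\<Sum>i\<in>(UNIV::'n set). 1)" by (intro sum_mono \<alpha>(1))
  then have s: "0 \<le> s" "d < real DIM(real^'n) - s" using \<alpha>(2) by (simp_all add: s_def)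
  have int: "set_integrable lborel \<Omega> (\<lambda>x. depth x powr - s)" by (rule depth_powr_integrable[OF d s])
  define K :: real where "K = 512 * 8 ^ DIM(real^'n)"
  define C where "C = fact ?n * K ^ ?n * (LINT x:\<Omega>|lborel. depth x powr - s)"
  have I0: "0 \<le> (LINT x:\<Omega>|lborel. depth x powr - s)"
    unfolding set_lebesgue_integral_def by (intro integral_nonneg_AE AE_I2) simp
  have K0: "0 \<le> K" by (simp add: K_def)
  show thesis
  proof (rule that[of C])
    show "0 \<le> C" unfolding C_def using I0 K0 by simp
    fix f :: "real^'n \<Rightarrow> real^'n" and H :: "'n \<Rightarrow> real"
    assume cf: "continuous_on (closure \<Omega>) f" and H: "\<And>i. 0 \<le> H i" and \<alpha>0: "\<And>i. 0 \<le> \<alpha> i"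
      and f: "\<And>i x y. x \<in> \<Omega> \<Longrightarrow> y \<in> \<Omega> \<Longrightarrow> \<bar>f x $ i - f y $ i\<bar> \<le> H i * dist x y powr \<alpha> i"
    \<comment> \<open>The averages are defined for functions on the whole space, but inside \<Omega>
      they see only values at points of \<Omega>, where \<phi> is \<open>f\<close> and the Hoelder
      bound applies.\<close>
    obtain \<phi> where \<phi>: "continuous_on UNIV \<phi>" "\<And>x. x \<in> closure \<Omega> \<Longrightarrow> \<phi> x = f x"
      by (rule Tietze_unbounded[OF cf, of UNIV]) (auto simp: closed_closedin[symmetric])
    define q where "q i = average (\<lambda>x. \<phi> x $ i)" for i
    define u where "u x = (\<chi> i. q i x)" for x
    have c\<phi>: "continuous_on UNIV (\<lambda>x. \<phi> x $ i)" for i using \<phi>(1) by (intro continuous_intros)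
    have C1q: "C1_on \<Omega> (q i)" for i unfolding q_def by (rule C1_on_average[OF c\<phi>])
    have C1u: "C1_on \<Omega> u" unfolding u_def[abs_def] by (rule C1_on_vec_lambda[OF C1q])
    have cu: "continuous_on (closure \<Omega>) u"
      unfolding u_def[abs_def] q_def by (intro continuous_on_vec_lambda continuous_on_average c\<phi>)
    have bd: "u x = f x" if "x \<in> frontier \<Omega>" for x
    proof -
      have "x \<in> closure \<Omega>" "x \<notin> \<Omega>" using that \<Omega>(1) by (auto simp: frontier_def interior_open)
      then show ?thesis using \<phi>(2) by (simp add: u_def q_def average_def vec_eq_iff)
    qed
    have Jle: "\<bar>jacobian_det u x\<bar> \<le> fact ?n * K ^ ?n * (\<Prod>i\<in>UNIV. H i) * depth x powr - s" if x: "x \<in> \<Omega>" for x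
    proof -
      have dx: "depth x > 0" using x by (simp add: depth_pos)
      have "\<bar>matrix (frechet_derivative u (at x)) $ i $ j\<bar> \<le> K * H i * depth x powr (\<alpha> i - 1)" for i j
      proof -
        have "((\<lambda>y. u y $ i) has_derivative (\<lambda>h. frechet_derivative u (at x) h $ i)) (at x)"
          by (rule bounded_linear.has_derivative[OF bounded_linear_vec_nth C1_on_frechet[OF C1u x]])
        moreover have "(\<lambda>y. u y $ i) = q i" by (simp add: u_def fun_eq_iff)
        ultimately have "(q i has_derivative (\<lambda>h. frechet_derivative u (at x) h $ i)) (at x)" by simp
        from fun_cong[OF frechet_derivative_at[OF this], of "axis j 1"]
        have "matrix (frechet_derivative u (at x)) $ i $ j = frechet_derivative (q i) (at x) (axis j 1)"
          by (simp add: matrix_def)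
        moreover have "\<bar>frechet_derivative (q i) (at x) (axis j 1)\<bar> \<le> 512 * 8 ^ DIM(real^'n) * (H i * depth x powr \<alpha> i) / depth x * norm (axis j 1 :: real^'n)"
          unfolding q_def
        proof (rule average_derivative_bound[OF c\<phi> x])
          fix w assume w: "w \<in> \<Omega>" "norm (x - w) \<le> depth x"
          have "\<phi> w = f w" "\<phi> x = f x" using \<phi>(2) w(1) x closure_subset[of \<Omega>] by blast+
          then have "\<bar>\<phi> w $ i - \<phi> x $ i\<bar> \<le> H i * dist w x powr \<alpha> i"
            using f[OF w(1) x, of i] by simp
          also have "\<dots> \<le> H i * depth x powr \<alpha> i"
            using w(2) \<alpha>0 H by (intro mult_left_mono powr_mono2) (auto simp: dist_norm norm_minus_commute)
          finally show "\<bar>\<phi> w $ i - \<phi> x $ i\<bar> \<le> H i * depth x powr \<alpha> i" .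
        qed
        moreover have "depth x powr (\<alpha> i - 1) = depth x powr \<alpha> i / depth x" using dx by (simp add: powr_diff)
        ultimately show ?thesis by (simp add: K_def)
      qed
      from abs_det_le[OF this] have "\<bar>jacobian_det u x\<bar> \<le> fact ?n * (\<Prod>i\<in>UNIV. K * H i * depth x powr (\<alpha> i - 1))"
        unfolding jacobian_det_def .
      also have "(\<Prod>i\<in>UNIV. K * H i * depth x powr (\<alpha> i - 1)) = K ^ ?n * (\<Prod>i\<in>UNIV. H i) * depth x powr (\<Sum>i\<in>UNIV. \<alpha> i - 1)"
        using dx by (simp add: prod.distrib powr_sum)
      also have "(\<Sum>i\<in>UNIV. \<alpha> i - 1) = - s" by (simp add: s_def sum_subtractf)
      finally show ?thesis by (simp only: mult_ac)
    qed
    let ?c = "fact ?n * K ^ ?n * (\<Prod>i\<in>UNIV. H i)"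
    have c0: "0 \<le> ?c" using K0 H by (intro mult_nonneg_nonneg prod_nonneg) auto
    have intc: "set_integrable lborel \<Omega> (\<lambda>x. ?c * depth x powr - s)" using int by (rule set_integrable_mult_right)
    have intJ: "set_integrable lborel \<Omega> (jacobian_det u)"
    proof (rule set_integrable_bound[OF intc])
      show "set_borel_measurable lborel \<Omega> (jacobian_det u)"
        unfolding set_borel_measurable_def
        using borel_measurable_continuous_on_indicator[OF borel_open[OF \<Omega>(1)] continuous_on_jacobian_det[OF C1u]] by simp
      show "AE x in lborel. x \<in> \<Omega> \<longrightarrow> norm (jacobian_det u x) \<le> norm (?c * depth x powr - s)"
      proof (intro AE_I2 impI)
        fix x assume "x \<in> \<Omega>"
        moreover have "0 \<le> ?c * depth x powr - s" using c0 by (simp only: mult_nonneg_nonneg powr_ge_zero)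
        ultimately show "norm (jacobian_det u x) \<le> norm (?c * depth x powr - s)"
          using Jle[of x] by (simp only: real_norm_def abs_of_nonneg)
      qed
    qed
    have be: "boundary_extension \<Omega> f u" by unfold_locales (use \<Omega> cf cu C1u bd intJ in auto)
    have "(LINT x:\<Omega>|lborel. \<bar>jacobian_det u x\<bar>) \<le> (LINT x:\<Omega>|lborel. ?c * depth x powr - s)"
      by (rule set_integral_mono[OF set_integrable_abs[OF intJ] intc]) (rule Jle)
    also have "\<dots> = C * (\<Prod>i\<in>UNIV. H i)" by (simp add: C_def)
    finally show "\<exists>u. boundary_extension \<Omega> f u \<and> (LINT x:\<Omega>|lborel. \<bar>jacobian_det u x\<bar>) \<le> C * (\<Prod>i\<in>UNIV. H i)"
      using be by blast
  qed
qed

context boundary_extension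
begin

lemma bounded_image_u:
  obtains r where "\<And>x. x \<in> closure \<Omega> \<Longrightarrow> norm (u x) \<le> r"
proof -
  have "bounded (u ` closure \<Omega>)"
    using bounded_\<Omega> by (intro compact_imp_bounded compact_continuous_image continuous_u) simp
  then show thesis using that by (auto simp: bounded_iff)
qed

text \<open>\<open>h\<close> may be unbounded, but the degree vanishes outside a ball that contains
  the values of \<open>u\<close>, so \<open>h\<close> can be cut off there.\<close>

lemma brouwer_degree_mult_integrable:
  fixes h :: "real^'n \<Rightarrow> real"
  assumes h: "continuous_on UNIV h"
  shows "integrable lborel (\<lambda>y. h y * real_of_int (brouwer_degree f \<Omega> y))"
    and "negligible (f ` frontier \<Omega>) \<Longrightarrow>
      (LINT y|lborel. h y * real_of_int (brouwer_degree f \<Omega> y)) = (LINT x:\<Omega>|lborel. h (u x) * jacobian_det u x)"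
proof -
  obtain r where r: "\<And>x. x \<in> closure \<Omega> \<Longrightarrow> norm (u x) \<le> r" by (rule bounded_image_u) (rule that)
  define g where "g y = indicator (cball 0 r) y * h y" for y
  have mh: "h \<in> borel_measurable borel" by (rule borel_measurable_continuous_onI[OF h])
  have mg: "g \<in> borel_measurable borel" unfolding g_def[abs_def]
    by (intro borel_measurable_times borel_measurable_indicator mh) auto
  have "bounded (h ` cball 0 r)" by (intro compact_imp_bounded compact_continuous_image continuous_on_subset[OF h]) auto
  then obtain B where "\<forall>z\<in>h ` cball 0 r. norm z \<le> B" unfolding bounded_iff by blast
  then have B: "\<bar>h y\<bar> \<le> B" if "y \<in> cball 0 r" for y using that by simp
  have gB: "\<bar>g y\<bar> \<le> \<bar>B\<bar>" for y using B[of y] by (auto simp: g_def indicator_def)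
  have eq: "(\<lambda>y. h y * real_of_int (brouwer_degree f \<Omega> y)) = (\<lambda>y. g y * real_of_int (brouwer_degree f \<Omega> y))"
  proof
    fix y
    have "brouwer_degree f \<Omega> y = 0" if "y \<notin> cball 0 r"
      by (rule brouwer_degree_outside) (use r that in auto)
    then show "h y * real_of_int (brouwer_degree f \<Omega> y) = g y * real_of_int (brouwer_degree f \<Omega> y)"
      by (cases "y \<in> cball 0 r") (simp_all add: g_def)
  qed
  show "integrable lborel (\<lambda>y. h y * real_of_int (brouwer_degree f \<Omega> y))"
    unfolding eq
  proof (rule Bochner_Integration.integrable_bound)
    show "integrable lborel (\<lambda>y. \<bar>B\<bar> * real_of_int (brouwer_degree f \<Omega> y))"
      using brouwer_degree_L1(1) by simp
    show "(\<lambda>y. g y * real_of_int (brouwer_degree f \<Omega> y)) \<in> borel_measurable lborel" using mg by measurable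
    show "AE y in lborel. norm (g y * real_of_int (brouwer_degree f \<Omega> y)) \<le> norm (\<bar>B\<bar> * real_of_int (brouwer_degree f \<Omega> y))"
      using gB by (intro AE_I2) (simp add: abs_mult mult_right_mono)
  qed
  assume "negligible (f ` frontier \<Omega>)"
  then have "(LINT y|lborel. g y * real_of_int (brouwer_degree f \<Omega> y)) = (LINT x:\<Omega>|lborel. g (u x) * jacobian_det u x)"
    by (rule integral_brouwer_degree[OF mg gB])
  also have "\<dots> = (LINT x:\<Omega>|lborel. h (u x) * jacobian_det u x)"
    using r closure_subset[of \<Omega>] open_\<Omega> by (intro set_lebesgue_integral_cong) (auto simp: g_def subset_iff)
  finally show "(LINT y|lborel. h y * real_of_int (brouwer_degree f \<Omega> y)) = (LINT x:\<Omega>|lborel. h (u x) * jacobian_det u x)"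
    unfolding eq .
qed

text \<open>Both sides equal the integral of the Jacobian of the composition of \<Psi> and
  \<open>u\<close>: the left by the formula for \<open>f\<close> with the Jacobian of \<Psi> as
  weight, the right by the formula for the composed map with weight 1.\<close>

lemma brouwer_degree_compose:
  assumes null: "negligible (f ` frontier \<Omega>)" and \<Psi>: "C1_on UNIV \<Psi>"
  shows "(LINT y|lborel. jacobian_det \<Psi> y * real_of_int (brouwer_degree f \<Omega> y))
       = (LINT z|lborel. real_of_int (brouwer_degree (\<lambda>x. \<Psi> (f x)) \<Omega> z))"
proof -
  have c\<Psi>: "continuous_on UNIV \<Psi>" by (rule C1_on_imp_continuous_on[OF \<Psi>])
  have cJ: "continuous_on UNIV (jacobian_det \<Psi>)" by (rule continuous_on_jacobian_det[OF \<Psi>])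
  have J: "jacobian_det (\<lambda>x. \<Psi> (u x)) x = jacobian_det \<Psi> (u x) * jacobian_det u x" if "x \<in> \<Omega>" for x
    using that by (intro jacobian_det_compose C1_on_differentiable[OF C1_u] C1_on_differentiable[OF \<Psi>]) auto
  have C1: "C1_on \<Omega> (\<lambda>x. \<Psi> (u x))" by (rule C1_on_compose[OF C1_u \<Psi> subset_UNIV])
  have "bounded ((\<lambda>x. jacobian_det \<Psi> (u x)) ` closure \<Omega>)"
    using bounded_\<Omega> by (intro compact_imp_bounded compact_continuous_image continuous_on_compose2[OF cJ continuous_u]) auto
  then obtain B where B: "\<And>x. x \<in> closure \<Omega> \<Longrightarrow> \<bar>jacobian_det \<Psi> (u x)\<bar> \<le> B" by (auto simp: bounded_iff)
  have int: "set_integrable lborel \<Omega> (jacobian_det (\<lambda>x. \<Psi> (u x)))"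
  proof (rule set_integrable_bound)
    show "set_integrable lborel \<Omega> (\<lambda>x. B * jacobian_det u x)" using integrable_u by (rule set_integrable_mult_right)
    show "set_borel_measurable lborel \<Omega> (jacobian_det (\<lambda>x. \<Psi> (u x)))"
      unfolding set_borel_measurable_def
      using borel_measurable_continuous_on_indicator[OF borel_open[OF open_\<Omega>] continuous_on_jacobian_det[OF C1]] by simp
    show "AE x in lborel. x \<in> \<Omega> \<longrightarrow> norm (jacobian_det (\<lambda>x. \<Psi> (u x)) x) \<le> norm (B * jacobian_det u x)"
    proof (intro AE_I2 impI)
      fix x assume x: "x \<in> \<Omega>"
      then have "\<bar>jacobian_det \<Psi> (u x)\<bar> \<le> \<bar>B\<bar>" using B[of x] closure_subset[of \<Omega>] by force
      then show "norm (jacobian_det (\<lambda>x. \<Psi> (u x)) x) \<le> norm (B * jacobian_det u x)"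
        by (simp add: J[OF x] abs_mult mult_right_mono)
    qed
  qed
  interpret V: boundary_extension \<Omega> "\<lambda>x. \<Psi> (f x)" "\<lambda>x. \<Psi> (u x)"
    by unfold_locales (use open_\<Omega> bounded_\<Omega> boundary C1 int continuous_on_compose2[OF c\<Psi> continuous_f]
        continuous_on_compose2[OF c\<Psi> continuous_u] in auto)
  \<comment> \<open>The composed map needs a null boundary image too, and differentiable maps
    preserve null sets.\<close>
  have "negligible (\<Psi> ` f ` frontier \<Omega>)"
    using C1_on_differentiable[OF \<Psi>]
    by (intro negligible_differentiable_image_negligible[OF order_refl null])
      (auto simp: differentiable_on_def intro: differentiable_at_withinI)
  then have nV: "negligible ((\<lambda>x. \<Psi> (f x)) ` frontier \<Omega>)" by (simp add: image_image)
  have "(LINT z|lborel. 1 * real_of_int (brouwer_degree (\<lambda>x. \<Psi> (f x)) \<Omega> z))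
      = (LINT x:\<Omega>|lborel. 1 * jacobian_det (\<lambda>x. \<Psi> (u x)) x)"
    using V.brouwer_degree_mult_integrable(2)[of "\<lambda>_. 1", OF continuous_on_const nV] by simp
  also have "\<dots> = (LINT x:\<Omega>|lborel. jacobian_det \<Psi> (u x) * jacobian_det u x)"
    using open_\<Omega> by (intro set_lebesgue_integral_cong) (auto simp: J)
  also have "\<dots> = (LINT y|lborel. jacobian_det \<Psi> y * real_of_int (brouwer_degree f \<Omega> y))"
    using brouwer_degree_mult_integrable(2)[OF cJ null] by simp
  finally show ?thesis by simp
qed

end

section \<open>Hoelder continuous maps\<close>

lemma holder_seminorm_bound:
  assumes "holder_on \<alpha> U f" "x \<in> U" "y \<in> U"
  shows "dist (f x) (f y) \<le> holder_seminorm \<alpha> U f * dist x y powr \<alpha>"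
proof (cases "x = y")
  case False
  have "dist (f x) (f y) / dist x y powr \<alpha> \<in> holder_quotients \<alpha> U f"
    using assms False unfolding holder_quotients_def by blast
  then have "dist (f x) (f y) / dist x y powr \<alpha> \<le> holder_seminorm \<alpha> U f"
    using assms(1) unfolding holder_seminorm_def holder_on_def by (intro cSup_upper) auto
  then show ?thesis using False by (simp add: divide_le_eq)
qed simp

lemma holder_seminorm_nonneg: "holder_on \<alpha> U f \<Longrightarrow> 0 \<le> holder_seminorm \<alpha> U f"
  unfolding holder_seminorm_def holder_on_def by (intro cSup_upper) auto

lemma holder_onI:
  assumes "\<And>x y. x \<in> U \<Longrightarrow> y \<in> U \<Longrightarrow> dist (f x) (f y) \<le> c * dist x y powr \<alpha>"
  shows "holder_on \<alpha> U f"
  unfolding holder_on_def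
proof (rule bdd_aboveI)
  fix z assume "z \<in> holder_quotients \<alpha> U f"
  then obtain x y where "x \<in> U" "y \<in> U" "x \<noteq> y" "z = dist (f x) (f y) / dist x y powr \<alpha>"
    unfolding holder_quotients_def by blast
  then show "z \<le> c" using assms[of x y] by (simp add: divide_le_eq)
qed

lemma uniformly_continuous_on_vec_holder:
  fixes v :: "'a::metric_space \<Rightarrow> real^'n::finite"
  assumes v: "\<And>i x y. x \<in> U \<Longrightarrow> y \<in> U \<Longrightarrow> \<bar>v x $ i - v y $ i\<bar> \<le> H i * dist x y powr \<alpha> i"
    and \<alpha>: "\<And>i. 0 < \<alpha> i"
  shows "uniformly_continuous_on U v"
  unfolding uniformly_continuous_on_def
proof (intro allI impI)
  fix e :: real assume e: "e > 0"
  have "((\<lambda>t::real. \<Sum>i\<in>UNIV. H i * t powr \<alpha> i) \<longlongrightarrow> (\<Sum>i\<in>(UNIV::'n set). H i * 0)) (at_right 0)"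
    by (intro tendsto_sum tendsto_mult_left tendsto_zero_powrI[where b = "\<alpha> _"] \<alpha>)
      (auto intro!: tendsto_intros eventually_at_right_less[THEN eventually_mono])
  then have "eventually (\<lambda>t. (\<Sum>i\<in>UNIV. H i * t powr \<alpha> i) < e) (at_right 0)"
    using e by (intro order_tendstoD) simp_all
  then obtain d where d: "d > 0" "\<And>t. 0 < t \<Longrightarrow> t < d \<Longrightarrow> (\<Sum>i\<in>UNIV. H i * t powr \<alpha> i) < e"
    unfolding eventually_at_right_field by auto
  show "\<exists>d>0. \<forall>x\<in>U. \<forall>y\<in>U. dist y x < d \<longrightarrow> dist (v y) (v x) < e"
  proof (intro exI[of _ d] conjI ballI impI d(1))
    fix x y assume xy: "x \<in> U" "y \<in> U" "dist y x < d"
    show "dist (v y) (v x) < e"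
    proof (cases "x = y")
      case False
      have "dist (v y) (v x) \<le> (\<Sum>i\<in>UNIV. \<bar>v y $ i - v x $ i\<bar>)"
        using norm_le_l1_cart[of "v y - v x"] by (simp add: dist_norm)
      also have "\<dots> \<le> (\<Sum>i\<in>UNIV. H i * dist y x powr \<alpha> i)" using v xy by (intro sum_mono) auto
      also have "\<dots> < e" using d(2)[of "dist y x"] False xy(3) by simp
      finally show ?thesis .
    qed (use e in simp)
  qed
qed

text \<open>The extension was defined by a pointwise limit; here it is identified with the extension
  that uniform continuity provides.\<close>

lemma closure_extension_props:
  fixes v :: "'a::metric_space \<Rightarrow> 'b::complete_space"
  assumes "uniformly_continuous_on \<Omega> v"
  shows "continuous_on (closure \<Omega>) (closure_extension \<Omega> v)" and "\<And>x. x \<in> \<Omega> \<Longrightarrow> closure_extension \<Omega> v x = v x"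
proof -
  obtain g where g: "uniformly_continuous_on (closure \<Omega>) g" "\<And>x. x \<in> \<Omega> \<Longrightarrow> v x = g x"
    by (rule uniformly_continuous_on_extension_on_closure[OF assms]) blast
  have cg: "continuous_on (closure \<Omega>) g" using g(1) by (rule uniformly_continuous_imp_continuous)
  have "closure_extension \<Omega> v x = g x" if x: "x \<in> closure \<Omega>" for x
  proof (cases "x \<in> \<Omega>")
    case False
    have "(g \<longlongrightarrow> g x) (at x within \<Omega>)"
      using cg x closure_subset[of \<Omega>] by (meson continuous_on_def tendsto_within_subset)
    then have "(v \<longlongrightarrow> g x) (at x within \<Omega>)"
      by (rule Lim_transform_within[OF _ zero_less_one]) (simp add: g(2))
    \<comment> \<open>A nontrivial filter makes the limit unique, so that \<open>Lim\<close> denotes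
      it.\<close>
    moreover have "at x within \<Omega> \<noteq> bot"
      using x False by (auto simp: trivial_limit_within closure_def)
    ultimately show ?thesis using False by (simp add: closure_extension_def tendsto_Lim)
  qed (simp add: closure_extension_def g(2))
  then show "continuous_on (closure \<Omega>) (closure_extension \<Omega> v)" using continuous_on_eq[OF cg] by metis
qed (simp add: closure_extension_def)

text \<open>Pass to the limit along sequences in \<open>U\<close>. Positivity of \<alpha> makes the
  power continuous also where the distance is 0.\<close>

lemma holder_bound_closure:
  fixes f :: "'a::metric_space \<Rightarrow> real"
  assumes f: "continuous_on (closure U) f" and b: "\<And>x y. x \<in> U \<Longrightarrow> y \<in> U \<Longrightarrow> \<bar>f x - f y\<bar> \<le> c * dist x y powr \<alpha>"
    and \<alpha>: "0 < \<alpha>" and x: "x \<in> closure U" and y: "y \<in> closure U"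
  shows "\<bar>f x - f y\<bar> \<le> c * dist x y powr \<alpha>"
proof -
  obtain X where X: "\<And>n. X n \<in> U" "X \<longlonglongrightarrow> x" using x unfolding closure_sequential by blast
  obtain Y where Y: "\<And>n. Y n \<in> U" "Y \<longlonglongrightarrow> y" using y unfolding closure_sequential by blast
  have mem: "X n \<in> closure U" "Y n \<in> closure U" for n using X(1) Y(1) closure_subset by blast+
  have fX: "(\<lambda>n. f (X n)) \<longlonglongrightarrow> f x"
    by (rule continuous_on_tendsto_compose[OF f X(2) x]) (simp add: mem)
  have fY: "(\<lambda>n. f (Y n)) \<longlonglongrightarrow> f y"
    by (rule continuous_on_tendsto_compose[OF f Y(2) y]) (simp add: mem)
  have "(\<lambda>n. dist (X n) (Y n) powr \<alpha>) \<longlonglongrightarrow> dist x y powr \<alpha>"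
    using \<alpha> by (intro tendsto_powr' tendsto_dist X(2) Y(2) tendsto_const) auto
  then have "(\<lambda>n. c * dist (X n) (Y n) powr \<alpha>) \<longlonglongrightarrow> c * dist x y powr \<alpha>" by (rule tendsto_mult_left)
  from LIMSEQ_le[OF tendsto_rabs[OF tendsto_diff[OF fX fY]] this] show ?thesis using b X(1) Y(1) by auto
qed

lemma closure_extension_holder:
  fixes \<Omega> :: "(real^'n::finite) set" and v :: "real^'n \<Rightarrow> real^'n"
  assumes \<alpha>: "\<And>i. 0 < \<alpha> i" and v: "\<And>i. holder_on (\<alpha> i) \<Omega> (\<lambda>x. v x $ i)"
  shows "continuous_on (closure \<Omega>) (closure_extension \<Omega> v)"
    "\<And>x. x \<in> \<Omega> \<Longrightarrow> closure_extension \<Omega> v x = v x"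
    "\<And>i x y. x \<in> \<Omega> \<Longrightarrow> y \<in> \<Omega> \<Longrightarrow> \<bar>v x $ i - v y $ i\<bar> \<le> holder_seminorm (\<alpha> i) \<Omega> (\<lambda>x. v x $ i) * dist x y powr \<alpha> i"
proof -
  show b: "\<bar>v x $ i - v y $ i\<bar> \<le> holder_seminorm (\<alpha> i) \<Omega> (\<lambda>x. v x $ i) * dist x y powr \<alpha> i"
    if "x \<in> \<Omega>" "y \<in> \<Omega>" for i x y
    using holder_seminorm_bound[OF v[of i] that] by (simp add: dist_real_def)
  have "uniformly_continuous_on \<Omega> v" by (rule uniformly_continuous_on_vec_holder[OF b \<alpha>])
  then show "continuous_on (closure \<Omega>) (closure_extension \<Omega> v)" "\<And>x. x \<in> \<Omega> \<Longrightarrow> closure_extension \<Omega> v x = v x"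
    by (rule closure_extension_props)+
qed

text \<open>Ensures that the seminorm of \<psi> is the supremum of a bounded set. On the convex ball
  \<psi> is Lipschitz, and \<open>dist x y powr (1 - \<gamma>)\<close> is absorbed by the
  diameter.\<close>

lemma C1_on_holder_on_ball:
  fixes \<psi> :: "'a::euclidean_space \<Rightarrow> 'b::euclidean_space"
  assumes \<psi>: "C1_on UNIV \<psi>" and \<gamma>: "0 < \<gamma>" "\<gamma> \<le> 1" and R: "0 < R"
  shows "holder_on \<gamma> (ball 0 R) \<psi>"
proof -
  obtain F where F: "\<And>x. (\<psi> has_derivative blinfun_apply (F x)) (at x)" "continuous_on UNIV F"
    using \<psi> unfolding C1_on_def by blast
  have "bounded (F ` cball 0 R)" by (intro compact_imp_bounded compact_continuous_image continuous_on_subset[OF F(2)]) auto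
  then obtain L where L: "\<And>x. x \<in> cball 0 R \<Longrightarrow> norm (F x) \<le> L" unfolding bounded_iff by blast
  have L0: "0 \<le> L" using order_trans[OF norm_ge_zero L[of 0]] R by simp
  have lip: "norm (\<psi> x - \<psi> y) \<le> L * norm (x - y)" if "x \<in> ball 0 R" "y \<in> ball 0 R" for x y
  proof (rule differentiable_bound[of "ball 0 R" \<psi> "\<lambda>x. blinfun_apply (F x)"])
    show "(\<psi> has_derivative blinfun_apply (F x)) (at x within ball 0 R)" for x
      using F(1) by (rule has_derivative_at_withinI)
    show "onorm (blinfun_apply (F x)) \<le> L" if "x \<in> ball 0 R" for x
      using L[of x] that by (simp add: norm_blinfun.rep_eq)
  qed (use that in auto)
  show ?thesis
  proof (rule holder_onI[where c = "L * (2 * R) powr (1 - \<gamma>)"])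
    fix x y :: 'a assume xy: "x \<in> ball 0 R" "y \<in> ball 0 R"
    have "dist x y \<le> 2 * R" using xy dist_triangle2[of x y 0] by (auto simp: dist_commute)
    then have "dist x y powr (1 - \<gamma>) \<le> (2 * R) powr (1 - \<gamma>)" using \<gamma>(2) by (intro powr_mono2) auto
    moreover have "dist x y = dist x y powr (1 - \<gamma>) * dist x y powr \<gamma>"
      using \<gamma> by (cases "x = y") (simp_all add: powr_add[symmetric])
    ultimately have "dist x y \<le> (2 * R) powr (1 - \<gamma>) * dist x y powr \<gamma>"
      by (metis mult_right_mono powr_ge_zero)
    then have "L * dist x y \<le> L * ((2 * R) powr (1 - \<gamma>) * dist x y powr \<gamma>)" using L0 by (rule mult_left_mono)
    then show "dist (\<psi> x) (\<psi> y) \<le> L * (2 * R) powr (1 - \<gamma>) * dist x y powr \<gamma>"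
      using lip[OF xy] by (simp add: dist_norm mult.assoc)
  qed
qed

section \<open>Replacing one component of the identity\<close>

definition replace_component :: "'n::finite \<Rightarrow> (real^'n \<Rightarrow> real^'n) \<Rightarrow> real^'n \<Rightarrow> real^'n" where
  "replace_component i \<psi> y = (\<chi> j. if j = i then \<psi> y $ i else y $ j)"

lemma C1_on_replace_component: "C1_on S \<psi> \<Longrightarrow> C1_on S (replace_component i \<psi>)"
proof -
  assume \<psi>: "C1_on S \<psi>"
  have "C1_on S (\<lambda>y. if j = i then \<psi> y $ i else y $ j)" for j
    by (cases "j = i") (simp_all add: C1_on_vec_nth[OF \<psi>] C1_on_vec_nth[OF C1_on_ident])
  then have "C1_on S (\<lambda>y. \<chi> j. if j = i then \<psi> y $ i else y $ j)" by (rule C1_on_vec_lambda)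
  then show ?thesis by (simp add: replace_component_def[abs_def])
qed

lemma jacobian_det_replace_component:
  assumes \<psi>: "\<psi> differentiable (at y)"
  shows "jacobian_det (replace_component i \<psi>) y = frechet_derivative \<psi> (at y) (axis i 1) $ i"
proof -
  let ?D = "frechet_derivative \<psi> (at y)"
  have D: "(\<psi> has_derivative ?D) (at y)" using \<psi> frechet_derivative_works by blast
  have comp: "((\<lambda>y. replace_component i \<psi> y $ j) has_derivative (\<lambda>h. if j = i then ?D h $ i else h $ j)) (at y)" for j
    using bounded_linear.has_derivative[OF bounded_linear_vec_nth D, of i]
      bounded_linear_imp_has_derivative[OF bounded_linear_vec_nth, of j]
    by (cases "j = i") (simp_all add: replace_component_def)
  have "(replace_component i \<psi> has_derivative (\<lambda>h. \<chi> j. if j = i then ?D h $ i else h $ j)) (at y)"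
  proof (subst has_derivative_componentwise_within, intro ballI)
    fix b :: "real^'a" assume "b \<in> Basis"
    then obtain j where "b = axis j 1" by (auto simp: Basis_vec_def)
    then show "((\<lambda>x. replace_component i \<psi> x \<bullet> b) has_derivative (\<lambda>h. (\<chi> j. if j = i then ?D h $ i else h $ j) \<bullet> b)) (at y)"
      using comp[of j] by (simp add: cart_eq_inner_axis[symmetric])
  qed
  then have "jacobian_det (replace_component i \<psi>) y = det (matrix (\<lambda>h. \<chi> j. if j = i then ?D h $ i else h $ j))"
    by (rule jacobian_det_eqI)
  \<comment> \<open>The identity with its \<open>i\<close>-th row replaced by the gradient of the
    \<open>i\<close>-th component of \<psi>; transposed and written with \<open>mat 1 *v\<close> it
    has the form that Cramer's lemma evaluates.\<close>
  also have "matrix (\<lambda>h. \<chi> j. if j = i then ?D h $ i else h $ j)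
      = transpose (\<chi> k j. if j = i then (mat 1 *v (\<chi> k. ?D (axis k 1) $ i)) $ k else (mat 1 :: real^'a^'a) $ k $ j)"
    unfolding matrix_vector_mul_lid by (auto simp: matrix_def transpose_def vec_eq_iff mat_def axis_def)
  also have "det \<dots> = ?D (axis i 1) $ i * det (mat 1 :: real^'a^'a)"
    unfolding det_transpose cramer_lemma by simp
  finally show ?thesis by simp
qed

text \<open>Integrability is asserted with every integral, which would otherwise be 0 by default. In
  the second part \<open>C\<close> is chosen after \<open>a\<close> and \<gamma> but before
  \<alpha>, so the estimate may use only the smallest exponent.\<close>

theorem theorem2p1:
  fixes \<Omega> :: "(real^'n) set" and d :: real
  assumes "open \<Omega>" and "bounded \<Omega>"
    and "box_dim (frontier \<Omega>) = ereal d"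
    and "real CARD('n) - 1 \<le> d" and "d < real CARD('n)"
  shows
    "(\<forall>\<alpha> :: 'n \<Rightarrow> real.
        (\<forall>i. 0 < \<alpha> i \<and> \<alpha> i \<le> 1) \<and> (\<Sum>i\<in>UNIV. \<alpha> i) > d \<longrightarrow>
        (\<exists>C. \<forall>v :: real^'n \<Rightarrow> real^'n.
           continuous_on \<Omega> v \<and> (\<forall>i. holder_on (\<alpha> i) \<Omega> (\<lambda>x. v x $ i)) \<longrightarrow>
             integrable lborel (\<lambda>y. real_of_int (brouwer_degree (closure_extension \<Omega> v) \<Omega> y)) \<and>
             (LINT y|lborel. \<bar>real_of_int (brouwer_degree (closure_extension \<Omega> v) \<Omega> y)\<bar>)
               \<le> C * (\<Prod>i\<in>UNIV. holder_seminorm (\<alpha> i) \<Omega> (\<lambda>x. v x $ i)))) \<and>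
     (\<forall>a \<gamma>.
        a > d / real CARD('n) \<and> 0 < \<gamma> \<and> \<gamma> < 1 \<and> (real CARD('n) - 1 + \<gamma>) * a > d \<longrightarrow>
        (\<exists>C. \<forall>(\<alpha> :: 'n \<Rightarrow> real) (v :: real^'n \<Rightarrow> real^'n) R (\<psi> :: real^'n \<Rightarrow> real^'n).
           (\<forall>i. 0 < \<alpha> i \<and> \<alpha> i \<le> 1) \<and> (\<Sum>i\<in>UNIV. \<alpha> i) > d \<and> Min (range \<alpha>) = a \<and>
           continuous_on \<Omega> v \<and> (\<forall>i. holder_on (\<alpha> i) \<Omega> (\<lambda>x. v x $ i)) \<and>
           R > 0 \<and> closure (v ` \<Omega>) \<subseteq> ball 0 R \<and> C1_map \<psi> \<longrightarrow>
             integrable lborel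
               (\<lambda>y. real_of_int (brouwer_degree (closure_extension \<Omega> v) \<Omega> y) * divergence \<psi> y) \<and>
             \<bar>LINT y|lborel.
                real_of_int (brouwer_degree (closure_extension \<Omega> v) \<Omega> y) * divergence \<psi> y\<bar>
               \<le> C * holder_seminorm a \<Omega> v powr (real CARD('n) - 1 + \<gamma>)
                   * holder_seminorm \<gamma> (ball 0 R) \<psi>))"
proof (intro conjI allI impI)
  fix \<alpha> :: "'n \<Rightarrow> real"
  assume \<alpha>: "(\<forall>i. 0 < \<alpha> i \<and> \<alpha> i \<le> 1) \<and> (\<Sum>i\<in>UNIV. \<alpha> i) > d"
  obtain C where C: "0 \<le> C" "\<And>f H. continuous_on (closure \<Omega>) f \<Longrightarrow> (\<And>i. 0 \<le> H i) \<Longrightarrow>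
     (\<And>i x y. x \<in> \<Omega> \<Longrightarrow> y \<in> \<Omega> \<Longrightarrow> \<bar>f x $ i - f y $ i\<bar> \<le> H i * dist x y powr \<alpha> i) \<Longrightarrow> (\<And>i. 0 \<le> \<alpha> i) \<Longrightarrow>
     \<exists>u. boundary_extension \<Omega> f u \<and> (LINT x:\<Omega>|lborel. \<bar>jacobian_det u x\<bar>) \<le> C * (\<Prod>i\<in>UNIV. H i)"
    by (rule jacobian_extension_exists[OF assms(1-3), of \<alpha>]) (use \<alpha> in blast)+
  show "\<exists>C. \<forall>v :: real^'n \<Rightarrow> real^'n.
           continuous_on \<Omega> v \<and> (\<forall>i. holder_on (\<alpha> i) \<Omega> (\<lambda>x. v x $ i)) \<longrightarrow>
             integrable lborel (\<lambda>y. real_of_int (brouwer_degree (closure_extension \<Omega> v) \<Omega> y)) \<and>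
             (LINT y|lborel. \<bar>real_of_int (brouwer_degree (closure_extension \<Omega> v) \<Omega> y)\<bar>)
               \<le> C * (\<Prod>i\<in>UNIV. holder_seminorm (\<alpha> i) \<Omega> (\<lambda>x. v x $ i))"
  proof (intro exI[of _ C] allI impI)
    fix v :: "real^'n \<Rightarrow> real^'n"
    assume v: "continuous_on \<Omega> v \<and> (\<forall>i. holder_on (\<alpha> i) \<Omega> (\<lambda>x. v x $ i))"
    let ?f = "closure_extension \<Omega> v" and ?H = "\<lambda>i. holder_seminorm (\<alpha> i) \<Omega> (\<lambda>x. v x $ i)"
    have \<alpha>0: "\<And>i. 0 < \<alpha> i" and hv: "\<And>i. holder_on (\<alpha> i) \<Omega> (\<lambda>x. v x $ i)" using \<alpha> v by blast+
    note ce = closure_extension_holder[OF \<alpha>0 hv]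
    have "\<exists>u. boundary_extension \<Omega> ?f u \<and> (LINT x:\<Omega>|lborel. \<bar>jacobian_det u x\<bar>) \<le> C * (\<Prod>i\<in>UNIV. ?H i)"
    proof (rule C(2)[OF ce(1)])
      show "0 \<le> ?H i" for i by (rule holder_seminorm_nonneg[OF hv])
      show "\<bar>?f x $ i - ?f y $ i\<bar> \<le> ?H i * dist x y powr \<alpha> i" if "x \<in> \<Omega>" "y \<in> \<Omega>" for i x y
        using ce(3)[OF that] ce(2) that by simp
      show "0 \<le> \<alpha> i" for i using \<alpha>0[of i] by simp
    qed
    then obtain u where u: "boundary_extension \<Omega> ?f u" "(LINT x:\<Omega>|lborel. \<bar>jacobian_det u x\<bar>) \<le> C * (\<Prod>i\<in>UNIV. ?H i)"
      by blast
    show "integrable lborel (\<lambda>y. real_of_int (brouwer_degree ?f \<Omega> y)) \<and>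
        (LINT y|lborel. \<bar>real_of_int (brouwer_degree ?f \<Omega> y)\<bar>) \<le> C * (\<Prod>i\<in>UNIV. ?H i)"
      using boundary_extension.brouwer_degree_L1[OF u(1)] u(2) by linarith
  qed
next
  fix a \<gamma> :: real
  assume a: "a > d / real CARD('n) \<and> 0 < \<gamma> \<and> \<gamma> < 1 \<and> (real CARD('n) - 1 + \<gamma>) * a > d"
  let ?n = "CARD('n)"
  show "\<exists>C. \<forall>(\<alpha> :: 'n \<Rightarrow> real) (v :: real^'n \<Rightarrow> real^'n) R (\<psi> :: real^'n \<Rightarrow> real^'n).
           (\<forall>i. 0 < \<alpha> i \<and> \<alpha> i \<le> 1) \<and> (\<Sum>i\<in>UNIV. \<alpha> i) > d \<and> Min (range \<alpha>) = a \<and>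
           continuous_on \<Omega> v \<and> (\<forall>i. holder_on (\<alpha> i) \<Omega> (\<lambda>x. v x $ i)) \<and>
           R > 0 \<and> closure (v ` \<Omega>) \<subseteq> ball 0 R \<and> C1_map \<psi> \<longrightarrow>
             integrable lborel
               (\<lambda>y. real_of_int (brouwer_degree (closure_extension \<Omega> v) \<Omega> y) * divergence \<psi> y) \<and>
             \<bar>LINT y|lborel.
                real_of_int (brouwer_degree (closure_extension \<Omega> v) \<Omega> y) * divergence \<psi> y\<bar>
               \<le> C * holder_seminorm a \<Omega> v powr (real CARD('n) - 1 + \<gamma>)
                   * holder_seminorm \<gamma> (ball 0 R) \<psi>"
  proof (cases "0 < a \<and> a \<le> 1")
    \<comment> \<open>The smallest of numbers in (0,1] lies there as well, so for such
      \<open>a\<close> no \<alpha> is admissible.\<close>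
    case False
    have "Min (range \<alpha>) \<noteq> a" if "\<forall>i. 0 < \<alpha> i \<and> \<alpha> i \<le> 1" for \<alpha> :: "'n \<Rightarrow> real"
    proof
      assume "Min (range \<alpha>) = a"
      then have "a \<in> range \<alpha>" using Min_in[of "range \<alpha>"] by auto
      then show False using that False by auto
    qed
    then show ?thesis by blast
  next
    case True
    \<comment> \<open>Exponents of the composed map for the index \<open>i\<close>. They involve
      \<open>a\<close> and \<gamma> only, and their sum is exactly the quantity assumed to exceed
      \<open>d\<close>.\<close>
    define \<beta> where "\<beta> i j = (if j = i then a * \<gamma> else a)" for i j :: 'n
    have sum\<beta>: "(\<Sum>j\<in>UNIV. \<beta> i j) = (real ?n - 1 + \<gamma>) * a" for i
    proof -
      have "(\<Sum>j\<in>UNIV. \<beta> i j) = a * \<gamma> + (\<Sum>j\<in>UNIV - {i}. \<beta> i j)"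
        by (subst sum.remove[of _ i]) (simp_all add: \<beta>_def)
      also have "(\<Sum>j\<in>UNIV - {i}. \<beta> i j) = (\<Sum>j\<in>UNIV - {i}. a)" by (intro sum.cong) (auto simp: \<beta>_def)
      also have "\<dots> = (real ?n - 1) * a" by (simp add: card_Diff_singleton of_nat_diff Suc_leI)
      finally show ?thesis by (simp add: algebra_simps)
    qed
    have \<beta>: "0 < \<beta> i j" "\<beta> i j \<le> 1" for i j using True a by (auto simp: \<beta>_def mult_le_one)
    \<comment> \<open>Packaging the estimate as a predicate allows a constant to be chosen for every
      index before any map is fixed.\<close>
    define P where "P i C \<longleftrightarrow> 0 \<le> C \<and> (\<forall>f H. continuous_on (closure \<Omega>) f \<longrightarrow> (\<forall>j. 0 \<le> H j) \<longrightarrow>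
       (\<forall>j x y. x \<in> \<Omega> \<longrightarrow> y \<in> \<Omega> \<longrightarrow> \<bar>f x $ j - f y $ j\<bar> \<le> H j * dist x y powr \<beta> i j) \<longrightarrow>
       (\<exists>u. boundary_extension \<Omega> f u \<and> (LINT x:\<Omega>|lborel. \<bar>jacobian_det u x\<bar>) \<le> C * (\<Prod>j\<in>UNIV. H j)))" for i C
    have "\<exists>C. P i C" for i
    proof -
      obtain C where C: "0 \<le> C" "\<And>f H. continuous_on (closure \<Omega>) f \<Longrightarrow> (\<And>j. 0 \<le> H j) \<Longrightarrow>
        (\<And>j x y. x \<in> \<Omega> \<Longrightarrow> y \<in> \<Omega> \<Longrightarrow> \<bar>f x $ j - f y $ j\<bar> \<le> H j * dist x y powr \<beta> i j) \<Longrightarrow> (\<And>j. 0 \<le> \<beta> i j) \<Longrightarrow>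
        \<exists>u. boundary_extension \<Omega> f u \<and> (LINT x:\<Omega>|lborel. \<bar>jacobian_det u x\<bar>) \<le> C * (\<Prod>j\<in>UNIV. H j)"
        by (rule jacobian_extension_exists[OF assms(1-3), of "\<beta> i"]) (use \<beta>(2) sum\<beta>[of i] a in \<open>simp, simp, blast\<close>)
      have "P i C" unfolding P_def using C \<beta>(1) by (meson less_imp_le)
      then show ?thesis ..
    qed
    then obtain C where C: "\<And>i. P i (C i)" by metis
    show ?thesis
    proof (intro exI[of _ "\<Sum>i\<in>UNIV. C i"] allI impI)
      fix \<alpha> :: "'n \<Rightarrow> real" and v :: "real^'n \<Rightarrow> real^'n" and R and \<psi> :: "real^'n \<Rightarrow> real^'n"
      assume h: "(\<forall>i. 0 < \<alpha> i \<and> \<alpha> i \<le> 1) \<and> (\<Sum>i\<in>UNIV. \<alpha> i) > d \<and> Min (range \<alpha>) = a \<and>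
           continuous_on \<Omega> v \<and> (\<forall>i. holder_on (\<alpha> i) \<Omega> (\<lambda>x. v x $ i)) \<and>
           R > 0 \<and> closure (v ` \<Omega>) \<subseteq> ball 0 R \<and> C1_map \<psi>"
      let ?f = "closure_extension \<Omega> v"
      let ?deg = "\<lambda>y. real_of_int (brouwer_degree ?f \<Omega> y)"
      have \<alpha>0: "\<And>i. 0 < \<alpha> i" and hv: "\<And>i. holder_on (\<alpha> i) \<Omega> (\<lambda>x. v x $ i)" using h by blast+
      have \<alpha>1: "\<alpha> i \<le> 1" for i using h by blast
      have a\<alpha>: "a \<le> \<alpha> i" for i using h Min_le[of "range \<alpha>" "\<alpha> i"] by auto
      have R: "0 < R" "v ` \<Omega> \<subseteq> ball 0 R" using h closure_subset by blast+
      have \<psi>: "C1_on UNIV \<psi>" using h by (simp add: C1_map_eq_C1_on)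
      note ce = closure_extension_holder[OF \<alpha>0 hv]
      define S where "S = holder_seminorm a \<Omega> v"
      define Q where "Q = holder_seminorm \<gamma> (ball 0 R) \<psi>"
      have h\<psi>: "holder_on \<gamma> (ball 0 R) \<psi>" using a R(1) by (intro C1_on_holder_on_ball[OF \<psi>]) auto
      \<comment> \<open>Without this bound \<open>holder_seminorm a \<Omega> v\<close> would be an
        unspecified value. Since \<open>a\<close> is the smallest exponent, the excess powers
        \<open>\<alpha> i - a\<close> of the distance are bounded on the bounded set
        \<Omega>.\<close>
      have hav: "holder_on a \<Omega> v"
      proof -
        let ?H = "\<lambda>i. holder_seminorm (\<alpha> i) \<Omega> (\<lambda>x. v x $ i)"
        obtain r where r: "r > 0" "\<And>x. x \<in> \<Omega> \<Longrightarrow> norm x \<le> r" using assms(2) by (auto simp: bounded_pos)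
        show ?thesis
        proof (rule holder_onI[where c = "\<Sum>i\<in>UNIV. ?H i * (2 * r) powr (\<alpha> i - a)"])
          fix x y assume xy: "x \<in> \<Omega>" "y \<in> \<Omega>"
          have dr: "dist x y \<le> 2 * r" using r(2)[OF xy(1)] r(2)[OF xy(2)] norm_triangle_ineq4[of x y] by (simp add: dist_norm)
          have "dist (v x) (v y) \<le> (\<Sum>i\<in>UNIV. \<bar>v x $ i - v y $ i\<bar>)"
            using norm_le_l1_cart[of "v x - v y"] by (simp add: dist_norm)
          also have "\<dots> \<le> (\<Sum>i\<in>UNIV. ?H i * (2 * r) powr (\<alpha> i - a) * dist x y powr a)"
          proof (rule sum_mono)
            fix i
            have "dist x y powr \<alpha> i = dist x y powr (\<alpha> i - a) * dist x y powr a"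
              using \<alpha>0[of i] True by (simp add: powr_add[symmetric])
            also have "\<dots> \<le> (2 * r) powr (\<alpha> i - a) * dist x y powr a"
              using dr a\<alpha>[of i] by (intro mult_right_mono powr_mono2) auto
            finally have "?H i * dist x y powr \<alpha> i \<le> ?H i * ((2 * r) powr (\<alpha> i - a) * dist x y powr a)"
              by (rule mult_left_mono) (rule holder_seminorm_nonneg[OF hv])
            then show "\<bar>v x $ i - v y $ i\<bar> \<le> ?H i * (2 * r) powr (\<alpha> i - a) * dist x y powr a"
              using ce(3)[OF xy, of i] by (simp add: mult.assoc)
          qed
          also have "\<dots> = (\<Sum>i\<in>UNIV. ?H i * (2 * r) powr (\<alpha> i - a)) * dist x y powr a" by (simp add: sum_distrib_right)
          finally show "dist (v x) (v y) \<le> (\<Sum>i\<in>UNIV. ?H i * (2 * r) powr (\<alpha> i - a)) * dist x y powr a" .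
        qed
      qed
      have S0: "0 \<le> S" unfolding S_def by (rule holder_seminorm_nonneg[OF hav])
      have Q0: "0 \<le> Q" unfolding Q_def by (rule holder_seminorm_nonneg[OF h\<psi>])
      have vS: "dist (v x) (v y) \<le> S * dist x y powr a" if "x \<in> \<Omega>" "y \<in> \<Omega>" for x y
        unfolding S_def by (rule holder_seminorm_bound[OF hav that])
      \<comment> \<open>An extension of \<open>?f\<close> itself, found with the exponents \<alpha>,
        gives access to the degree of \<open>v\<close>; the quantitative bound will come from
        extensions of the composed maps.\<close>
      obtain u where u: "boundary_extension \<Omega> ?f u"
      proof -
        have "d < (\<Sum>i\<in>UNIV. \<alpha> i)" using h by blast
        obtain C' where C': "\<And>f H. continuous_on (closure \<Omega>) f \<Longrightarrow> (\<And>i. 0 \<le> H i) \<Longrightarrow>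
          (\<And>i x y. x \<in> \<Omega> \<Longrightarrow> y \<in> \<Omega> \<Longrightarrow> \<bar>f x $ i - f y $ i\<bar> \<le> H i * dist x y powr \<alpha> i) \<Longrightarrow> (\<And>i. 0 \<le> \<alpha> i) \<Longrightarrow>
          \<exists>u. boundary_extension \<Omega> f u \<and> (LINT x:\<Omega>|lborel. \<bar>jacobian_det u x\<bar>) \<le> C' * (\<Prod>i\<in>UNIV. H i)"
          by (rule jacobian_extension_exists[OF assms(1-3) \<alpha>1 \<open>d < (\<Sum>i\<in>UNIV. \<alpha> i)\<close>]) blast
        have "\<exists>u. boundary_extension \<Omega> ?f u \<and> (LINT x:\<Omega>|lborel. \<bar>jacobian_det u x\<bar>)
            \<le> C' * (\<Prod>i\<in>UNIV. holder_seminorm (\<alpha> i) \<Omega> (\<lambda>x. v x $ i))"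
        proof (rule C'[OF ce(1)])
          show "0 \<le> holder_seminorm (\<alpha> i) \<Omega> (\<lambda>x. v x $ i)" for i by (rule holder_seminorm_nonneg[OF hv])
          show "\<bar>?f x $ i - ?f y $ i\<bar> \<le> holder_seminorm (\<alpha> i) \<Omega> (\<lambda>x. v x $ i) * dist x y powr \<alpha> i"
            if "x \<in> \<Omega>" "y \<in> \<Omega>" for i x y using ce(3)[OF that] ce(2) that by simp
          show "0 \<le> \<alpha> i" for i using \<alpha>0[of i] by simp
        qed
        then show thesis using that by blast
      qed
      interpret boundary_extension \<Omega> ?f u by (rule u)
      have null: "negligible (?f ` frontier \<Omega>)"
      proof (rule negligible_holder_image[OF _ assms(3), of \<alpha> ?f "\<lambda>i. holder_seminorm (\<alpha> i) \<Omega> (\<lambda>x. v x $ i)"])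
        show "bounded (frontier \<Omega>)" by (rule compact_imp_bounded[OF compact_frontier_bounded[OF assms(2)]])
        show "d < (\<Sum>i\<in>UNIV. \<alpha> i)" using h by blast
        show "\<bar>?f x $ i - ?f y $ i\<bar> \<le> holder_seminorm (\<alpha> i) \<Omega> (\<lambda>x. v x $ i) * dist x y powr \<alpha> i"
          if "x \<in> frontier \<Omega>" "y \<in> frontier \<Omega>" for i x y
        proof (rule holder_bound_closure[where U = \<Omega>])
          show "continuous_on (closure \<Omega>) (\<lambda>x. ?f x $ i)" using ce(1) by (intro continuous_intros)
          show "\<bar>?f x $ i - ?f y $ i\<bar> \<le> holder_seminorm (\<alpha> i) \<Omega> (\<lambda>x. v x $ i) * dist x y powr \<alpha> i"
            if "x \<in> \<Omega>" "y \<in> \<Omega>" for x y using ce(3)[OF that] ce(2) that by simp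
        qed (use that \<alpha>0 in \<open>auto simp: frontier_def\<close>)
        show "0 \<le> \<alpha> i" for i using \<alpha>0[of i] by simp
        show "0 \<le> holder_seminorm (\<alpha> i) \<Omega> (\<lambda>x. v x $ i)" for i by (rule holder_seminorm_nonneg[OF hv])
      qed
      let ?\<Psi> = "\<lambda>i. replace_component i \<psi>"
      have C1\<Psi>: "C1_on UNIV (?\<Psi> i)" for i by (rule C1_on_replace_component[OF \<psi>])
      have div: "divergence \<psi> y = (\<Sum>i\<in>UNIV. jacobian_det (?\<Psi> i) y)" for y
        unfolding divergence_def by (intro sum.cong refl jacobian_det_replace_component[symmetric] C1_on_differentiable[OF \<psi> UNIV_I])
      have cJ: "continuous_on UNIV (jacobian_det (?\<Psi> i))" for i by (rule continuous_on_jacobian_det[OF C1\<Psi>])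
      have int: "integrable lborel (\<lambda>y. jacobian_det (?\<Psi> i) y * ?deg y)" for i
        by (rule brouwer_degree_mult_integrable(1)[OF cJ])
      have eq: "(\<lambda>y. ?deg y * divergence \<psi> y) = (\<lambda>y. \<Sum>i\<in>UNIV. jacobian_det (?\<Psi> i) y * ?deg y)"
        unfolding div by (simp add: sum_distrib_left mult.commute)
      have bound: "\<bar>LINT y|lborel. jacobian_det (?\<Psi> i) y * ?deg y\<bar> \<le> C i * (S powr (real ?n - 1 + \<gamma>) * Q)" for i
      proof -
        let ?V = "\<lambda>x. ?\<Psi> i (?f x)"
        \<comment> \<open>In the component \<open>i\<close>, applying \<psi> raises the bound
          \<open>S * dist x y powr a\<close> to the power \<gamma> and multiplies it by
          \<open>Q\<close>; the other components are those of \<open>v\<close>.\<close>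
        define H where "H j = (if j = i then Q * S powr \<gamma> else S)" for j
        have prodH: "(\<Prod>j\<in>UNIV. H j) = S powr (real ?n - 1 + \<gamma>) * Q"
        proof -
          have "(\<Prod>j\<in>UNIV. H j) = Q * S powr \<gamma> * (\<Prod>j\<in>UNIV - {i}. H j)"
            by (subst prod.remove[of _ i]) (simp_all add: H_def)
          also have "(\<Prod>j\<in>UNIV - {i}. H j) = (\<Prod>j\<in>UNIV - {i}. S)" by (intro prod.cong) (auto simp: H_def)
          also have "\<dots> = S ^ (?n - 1)" by (simp add: card_Diff_singleton)
          finally have 1: "(\<Prod>j\<in>UNIV. H j) = Q * (S powr \<gamma> * S ^ (?n - 1))" by simp
          have "S powr \<gamma> * S ^ (?n - 1) = S powr (real ?n - 1 + \<gamma>)"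
          proof (cases "S = 0")
            \<comment> \<open>The conversion to \<open>powr\<close> needs a positive base. For
              \<open>S = 0\<close> both sides vanish, in dimension one too, where
              \<open>S ^ (?n - 1)\<close> is 1 but \<open>S powr \<gamma>\<close> is 0.\<close>
            case False
            then have "S ^ (?n - 1) = S powr real (?n - 1)" using S0 by (subst powr_realpow) auto
            also have "real (?n - 1) = real ?n - 1" by (simp add: of_nat_diff Suc_leI)
            finally show ?thesis using False S0 by (simp add: powr_add mult.commute)
          qed simp
          then show ?thesis using 1 by simp
        qed
        have "\<exists>w. boundary_extension \<Omega> ?V w \<and> (LINT x:\<Omega>|lborel. \<bar>jacobian_det w x\<bar>) \<le> C i * (\<Prod>j\<in>UNIV. H j)"
        proof -
          have "continuous_on (closure \<Omega>) ?V"
            by (rule continuous_on_compose2[OF C1_on_imp_continuous_on[OF C1\<Psi>] ce(1) subset_UNIV])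
          moreover have "0 \<le> H j" for j using S0 Q0 by (simp add: H_def)
          moreover have "\<bar>?V x $ j - ?V y $ j\<bar> \<le> H j * dist x y powr \<beta> i j" if xy: "x \<in> \<Omega>" "y \<in> \<Omega>" for j x y
          proof (cases "j = i")
            case True
            have "\<bar>?V x $ j - ?V y $ j\<bar> = \<bar>(\<psi> (v x) - \<psi> (v y)) $ i\<bar>"
              using True xy ce(2) by (simp add: replace_component_def)
            also have "\<dots> \<le> dist (\<psi> (v x)) (\<psi> (v y))" unfolding dist_norm by (rule component_le_norm_cart)
            also have "\<dots> \<le> Q * dist (v x) (v y) powr \<gamma>"
              unfolding Q_def by (rule holder_seminorm_bound[OF h\<psi>]) (use R(2) xy in blast)+
            also have "\<dots> \<le> Q * (S * dist x y powr a) powr \<gamma>"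
              using vS[OF xy] a Q0 by (intro mult_left_mono powr_mono2) auto
            also have "\<dots> = H j * dist x y powr \<beta> i j"
              using True S0 by (simp add: H_def \<beta>_def powr_mult powr_powr)
            finally show ?thesis .
          next
            case False
            have "\<bar>?V x $ j - ?V y $ j\<bar> = \<bar>(v x - v y) $ j\<bar>"
              using False xy ce(2) by (simp add: replace_component_def)
            also have "\<dots> \<le> dist (v x) (v y)" unfolding dist_norm by (rule component_le_norm_cart)
            also have "\<dots> \<le> S * dist x y powr a" by (rule vS[OF xy])
            finally show ?thesis using False by (simp add: H_def \<beta>_def)
          qed
          ultimately show ?thesis using C[of i] unfolding P_def by blast
        qed
        then obtain w where w: "boundary_extension \<Omega> ?V w" "(LINT x:\<Omega>|lborel. \<bar>jacobian_det w x\<bar>) \<le> C i * (\<Prod>j\<in>UNIV. H j)" by blast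
        have "\<bar>LINT y|lborel. jacobian_det (?\<Psi> i) y * ?deg y\<bar> = \<bar>LINT z|lborel. real_of_int (brouwer_degree ?V \<Omega> z)\<bar>"
          by (simp only: brouwer_degree_compose[OF null C1\<Psi>])
        also have "\<dots> \<le> (LINT z|lborel. \<bar>real_of_int (brouwer_degree ?V \<Omega> z)\<bar>)" by (rule integral_abs_bound)
        also have "\<dots> \<le> C i * (\<Prod>j\<in>UNIV. H j)"
          using boundary_extension.brouwer_degree_L1(2)[OF w(1)] w(2) by linarith
        finally show ?thesis unfolding prodH .
      qed
      show "integrable lborel (\<lambda>y. ?deg y * divergence \<psi> y) \<and>
         \<bar>LINT y|lborel. ?deg y * divergence \<psi> y\<bar>
         \<le> (\<Sum>i\<in>UNIV. C i) * holder_seminorm a \<Omega> v powr (real ?n - 1 + \<gamma>) * holder_seminorm \<gamma> (ball 0 R) \<psi>"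
      proof
        show "integrable lborel (\<lambda>y. ?deg y * divergence \<psi> y)"
          unfolding eq by (intro Bochner_Integration.integrable_sum int)
        have "(LINT y|lborel. ?deg y * divergence \<psi> y) = (\<Sum>i\<in>UNIV. LINT y|lborel. jacobian_det (?\<Psi> i) y * ?deg y)"
          unfolding eq by (intro Bochner_Integration.integral_sum int)
        then have "\<bar>LINT y|lborel. ?deg y * divergence \<psi> y\<bar> \<le> (\<Sum>i\<in>UNIV. C i * (S powr (real ?n - 1 + \<gamma>) * Q))"
          using bound by (auto intro!: order_trans[OF sum_abs] sum_mono)
        then show "\<bar>LINT y|lborel. ?deg y * divergence \<psi> y\<bar>
         \<le> (\<Sum>i\<in>UNIV. C i) * holder_seminorm a \<Omega> v powr (real ?n - 1 + \<gamma>) * holder_seminorm \<gamma> (ball 0 R) \<psi>"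
          by (simp only: S_def Q_def sum_distrib_right mult.assoc)
      qed
    qed
  qed
qed

end
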